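(* If $\mathcal V$ is an overcommutative semigroup variety and the lattice $\mathrm L_{\mathbf{OC}}(\mathcal V)$ satisfies a non-trivial lattice identity, then the lattice $\mathrm L_{\mathbf{OC}}(\mathcal V)$ has a finite identity basis.
   Context: $\mathcal{COM}$ is the variety of all commutative semigroups. A semigroup variety $\mathcal V$ is overcommutative if $\mathcal{COM}\subseteq\mathcal V$. For such $\mathcal V$, $\mathrm L_{\mathbf{OC}}(\mathcal V)$ denotes the lattice (ordered by inclusion) of all overcommutative subvarieties of $\mathcal V$, i.e. the interval between $\mathcal{COM}$ and $\mathcal V$ in the lattice of all semigroup varieties. A lattice identity is a universally quantified equality of two lattice terms (in join and meet); it is non-trivial if it fails in some lattice. A lattice $L$ has a finite identity basis if there is a finite set of lattice identities that hold in $L$ and from which (together with the lattice axioms) all lattice identities holding in $L$ follow. *)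

theory Defs
  imports "HOL-Algebra.Lattice"
begin

section \<open>Semigroup varieties\<close>

record 'a sgrp = "'a partial_object" +
  sgmult :: "'a \<Rightarrow> 'a \<Rightarrow> 'a"

definition is_sgrp :: "'a sgrp \<Rightarrow> bool" where
  "is_sgrp S \<longleftrightarrow> carrier S \<noteq> {}
     \<and> (\<forall>x\<in>carrier S. \<forall>y\<in>carrier S. sgmult S x y \<in> carrier S)
     \<and> (\<forall>x\<in>carrier S. \<forall>y\<in>carrier S. \<forall>z\<in>carrier S.
          sgmult S (sgmult S x y) z = sgmult S x (sgmult S y z))"

text \<open>Semigroup words are the nonempty lists over the countable alphabet of letters
  \<open>0, 1, 2, \<dots>\<close>; a semigroup identity is a pair of such words.\<close>

fun word_value :: "'a sgrp \<Rightarrow> (nat \<Rightarrow> 'a) \<Rightarrow> nat list \<Rightarrow> 'a" where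
  "word_value S \<phi> [] = undefined"
| "word_value S \<phi> [i] = \<phi> i"
| "word_value S \<phi> (i # j # w) = sgmult S (\<phi> i) (word_value S \<phi> (j # w))"

definition sgrp_identities :: "(nat list \<times> nat list) set" where
  "sgrp_identities = {(u, v). u \<noteq> [] \<and> v \<noteq> []}"

definition sgrp_satisfies :: "'a sgrp \<Rightarrow> nat list \<times> nat list \<Rightarrow> bool" where
  "sgrp_satisfies S e \<longleftrightarrow>
     (\<forall>\<phi>. range \<phi> \<subseteq> carrier S \<longrightarrow> word_value S \<phi> (fst e) = word_value S \<phi> (snd e))"

definition sgrp_models :: "(nat list \<times> nat list) set \<Rightarrow> 'a sgrp set" where
  "sgrp_models \<Sigma> = {S. is_sgrp S \<and> (\<forall>e\<in>\<Sigma>. sgrp_satisfies S e)}"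

text \<open>A variety is the class of all semigroups satisfying some set of identities, taken here
  among the semigroups whose carrier is a subset of the type \<open>'a\<close>. A variety is
  generated by its free semigroup on countably many generators, which is countable; so when
  \<open>'a\<close> is infinite, passing to the members of a variety with carrier in \<open>'a\<close> is an
  order isomorphism for inclusion, and nothing depends on the choice of \<open>'a\<close>.\<close>

definition sgrp_variety :: "'a sgrp set \<Rightarrow> bool" where
  "sgrp_variety V \<longleftrightarrow> (\<exists>\<Sigma> \<subseteq> sgrp_identities. V = sgrp_models \<Sigma>)"

definition COM :: "'a sgrp set" where
  "COM = {S. is_sgrp S \<and>
     (\<forall>x\<in>carrier S. \<forall>y\<in>carrier S. sgmult S x y = sgmult S y x)}"

definition overcommutative :: "'a sgrp set \<Rightarrow> bool" where
  "overcommutative V \<longleftrightarrow> sgrp_variety V \<and> COM \<subseteq> V"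

definition L_OC :: "'a sgrp set \<Rightarrow> 'a sgrp set gorder" where
  "L_OC V = \<lparr>carrier = {W. overcommutative W \<and> W \<subseteq> V}, eq = (=), le = (\<subseteq>)\<rparr>"

text \<open>The joins and meets of the library are \<open>SOME\<close> bounds; for \<open>L_OC V\<close> they exist.\<close>

lemma lattice_L_OC:
  fixes V :: "'a sgrp set"
  assumes "sgrp_variety V"
  shows "lattice (L_OC V)"
proof -
  interpret po: partial_order "L_OC V"
    by unfold_locales (auto simp: L_OC_def)
  show ?thesis
  proof unfold_locales
    fix X Y assume X: "X \<in> carrier (L_OC V)" and Y: "Y \<in> carrier (L_OC V)"
    define \<Sigma> where "\<Sigma> = {e \<in> sgrp_identities. \<forall>S \<in> X \<union> Y. sgrp_satisfies S e}"
    define J :: "'a sgrp set" where "J = sgrp_models \<Sigma>"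
    have sg: "is_sgrp S" if "S \<in> X \<union> Y" for S
      using X Y that by (auto simp: L_OC_def overcommutative_def sgrp_variety_def sgrp_models_def)
    have XY: "X \<subseteq> J" "Y \<subseteq> J"
      using sg by (auto simp: J_def sgrp_models_def \<Sigma>_def)
    have least_J: "J \<subseteq> Z" if Z: "sgrp_variety Z" and XZ: "X \<subseteq> Z" and YZ: "Y \<subseteq> Z" for Z
    proof -
      from Z obtain \<Gamma> where \<Gamma>: "\<Gamma> \<subseteq> sgrp_identities" and Z_eq: "Z = sgrp_models \<Gamma>"
        unfolding sgrp_variety_def by (elim exE conjE)
      have "sgrp_satisfies S e" if "e \<in> \<Gamma>" "S \<in> Z" for e S
        using that unfolding Z_eq sgrp_models_def by simp
      then have "\<Gamma> \<subseteq> \<Sigma>"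
        unfolding \<Sigma>_def using \<Gamma> XZ YZ by blast
      then show ?thesis
        unfolding Z_eq J_def sgrp_models_def by blast
    qed
    have "sgrp_variety J"
      unfolding sgrp_variety_def J_def by (rule exI[of _ \<Sigma>]) (auto simp: \<Sigma>_def)
    then have J: "J \<in> carrier (L_OC V)"
      using X XY(1) least_J[OF assms] Y subset_trans[of COM X J]
      unfolding L_OC_def overcommutative_def by simp
    have "least (L_OC V) J (Upper (L_OC V) {X, Y})"
      unfolding least_def
    proof (intro conjI ballI)
      show "Upper (L_OC V) {X, Y} \<subseteq> carrier (L_OC V)"
        by (simp add: Upper_def)
      show "J \<in> Upper (L_OC V) {X, Y}"
        using J XY by (simp add: Upper_def) (auto simp: L_OC_def)
      fix Z assume "Z \<in> Upper (L_OC V) {X, Y}"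
      then have "sgrp_variety Z" "X \<subseteq> Z" "Y \<subseteq> Z"
        using X Y unfolding Upper_def by (auto simp: L_OC_def overcommutative_def)
      then show "J \<sqsubseteq>\<^bsub>L_OC V\<^esub> Z"
        using least_J by (simp add: L_OC_def)
    qed
    then show "\<exists>s. least (L_OC V) s (Upper (L_OC V) {X, Y})" ..
  next
    fix X Y assume X: "X \<in> carrier (L_OC V)" and Y: "Y \<in> carrier (L_OC V)"
    have "sgrp_variety X" "sgrp_variety Y"
      using X Y by (simp_all add: L_OC_def overcommutative_def)
    then obtain \<Gamma> \<Delta> where \<Gamma>: "\<Gamma> \<subseteq> sgrp_identities" "X = sgrp_models \<Gamma>"
      and \<Delta>: "\<Delta> \<subseteq> sgrp_identities" "Y = sgrp_models \<Delta>"
      unfolding sgrp_variety_def by blast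
    have "X \<inter> Y = sgrp_models (\<Gamma> \<union> \<Delta>)"
      by (auto simp: \<Gamma> \<Delta> sgrp_models_def)
    then have "sgrp_variety (X \<inter> Y)"
      using \<Gamma> \<Delta> unfolding sgrp_variety_def by (intro exI[of _ "\<Gamma> \<union> \<Delta>"]) auto
    then show "\<exists>s. greatest (L_OC V) s (Lower (L_OC V) {X, Y})"
      using X Y
      by (intro exI[of _ "X \<inter> Y"]) (auto simp: greatest_def Lower_def L_OC_def overcommutative_def)
  qed
qed


section \<open>Lattice identities\<close>

datatype lterm = LVar nat | LJoin lterm lterm | LMeet lterm lterm

primrec lterm_value :: "('b, 'c) gorder_scheme \<Rightarrow> (nat \<Rightarrow> 'b) \<Rightarrow> lterm \<Rightarrow> 'b" where
  "lterm_value L \<phi> (LVar n) = \<phi> n"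
| "lterm_value L \<phi> (LJoin s t) = lterm_value L \<phi> s \<squnion>\<^bsub>L\<^esub> lterm_value L \<phi> t"
| "lterm_value L \<phi> (LMeet s t) = lterm_value L \<phi> s \<sqinter>\<^bsub>L\<^esub> lterm_value L \<phi> t"

definition lat_satisfies :: "('b, 'c) gorder_scheme \<Rightarrow> lterm \<times> lterm \<Rightarrow> bool" where
  "lat_satisfies L e \<longleftrightarrow>
     (\<forall>\<phi>. range \<phi> \<subseteq> carrier L \<longrightarrow> lterm_value L \<phi> (fst e) = lterm_value L \<phi> (snd e))"

primrec lterm_subst :: "(nat \<Rightarrow> lterm) \<Rightarrow> lterm \<Rightarrow> lterm" where
  "lterm_subst \<sigma> (LVar n) = \<sigma> n"
| "lterm_subst \<sigma> (LJoin s t) = LJoin (lterm_subst \<sigma> s) (lterm_subst \<sigma> t)"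
| "lterm_subst \<sigma> (LMeet s t) = LMeet (lterm_subst \<sigma> s) (lterm_subst \<sigma> t)"

text \<open>Consequence of \<open>\<Sigma>\<close> and the lattice axioms is derivability in equational logic.
  By Birkhoff's completeness theorem this is the same as holding in every lattice, of whatever
  type, that satisfies \<open>\<Sigma>\<close>. The idempotent laws follow from absorption.\<close>

inductive lat_derivable :: "(lterm \<times> lterm) set \<Rightarrow> lterm \<Rightarrow> lterm \<Rightarrow> bool"
  for \<Sigma> :: "(lterm \<times> lterm) set" where
  hyp: "(s, t) \<in> \<Sigma> \<Longrightarrow> lat_derivable \<Sigma> (lterm_subst \<sigma> s) (lterm_subst \<sigma> t)"
| join_comm: "lat_derivable \<Sigma> (LJoin s t) (LJoin t s)"
| meet_comm: "lat_derivable \<Sigma> (LMeet s t) (LMeet t s)"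
| join_assoc: "lat_derivable \<Sigma> (LJoin (LJoin s t) r) (LJoin s (LJoin t r))"
| meet_assoc: "lat_derivable \<Sigma> (LMeet (LMeet s t) r) (LMeet s (LMeet t r))"
| join_absorb: "lat_derivable \<Sigma> (LJoin s (LMeet s t)) s"
| meet_absorb: "lat_derivable \<Sigma> (LMeet s (LJoin s t)) s"
| refl: "lat_derivable \<Sigma> s s"
| sym: "lat_derivable \<Sigma> s t \<Longrightarrow> lat_derivable \<Sigma> t s"
| trans: "lat_derivable \<Sigma> s t \<Longrightarrow> lat_derivable \<Sigma> t r \<Longrightarrow> lat_derivable \<Sigma> s r"
| join_cong: "lat_derivable \<Sigma> s s' \<Longrightarrow> lat_derivable \<Sigma> t t' \<Longrightarrow>
    lat_derivable \<Sigma> (LJoin s t) (LJoin s' t')"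
| meet_cong: "lat_derivable \<Sigma> s s' \<Longrightarrow> lat_derivable \<Sigma> t t' \<Longrightarrow>
    lat_derivable \<Sigma> (LMeet s t) (LMeet s' t')"

definition has_finite_identity_basis :: "('b, 'c) gorder_scheme \<Rightarrow> bool" where
  "has_finite_identity_basis L \<longleftrightarrow>
     (\<exists>\<Sigma>. finite \<Sigma> \<and> (\<forall>e\<in>\<Sigma>. lat_satisfies L e)
        \<and> (\<forall>s t. lat_satisfies L (s, t) \<longrightarrow> lat_derivable \<Sigma> s t))"

end

theory Submission
  imports Defs "HOL-Library.Nat_Bijection" "HOL-Library.Multiset"
begin

text \<open>The proof bounds finite lattices attached to \<open>V\<close> and then applies a finite basis theorem for
lattices of bounded size.

An overcommutative variety is determined by the fully invariant congruence of its identities, and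
these identities are balanced: every letter occurs equally often on both sides. Hence \<open>L_OC V\<close> is
dual to an interval of fully invariant congruences. Restricting such a congruence to the finite set of
words with a given multiset \<open>c\<close> of letters gives an equivalence that is invariant under the letter
renamings preserving \<open>c\<close>; restriction turns joins and meets of varieties into intersections and
joins of equivalences, and every invariant equivalence containing the identities of \<open>V\<close> arises
in this way. So \<open>L_OC V\<close> satisfies exactly the identities that hold in all the finite lattices
\<open>invariant_equivs c\<close> (\<open>satisfies_iff_invariant_equivs\<close>).

A lattice identity that fails somewhere fails in a finite partition lattice, also in dualised
form (\<open>partition_countermodel_of_lattice\<close>). Partition lattices embed into the lattices above in two
ways: by gluing orbits of words under renaming, and, when \<open>V\<close> satisfies no permutation identity, by
Young subgroups acting on words without repeated letters. An identity of \<open>L_OC V\<close> therefore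
bounds the number of orbits (\<open>few_orbits\<close>) and forces a permutation identity
(\<open>permutation_identity\<close>). The latter makes the interior of long words commutative
(\<open>interior_commutes\<close>), so modulo \<open>V\<close> a long word is given by its content and boundedly many letters at
its two ends. An invariant equivalence is then described by which orbit representatives and which
coincidences between end letters occur, and the cardinalities of all the lattices
\<open>invariant_equivs c\<close> have a common bound \<open>N\<close> (\<open>card_invariant_equivs_bounded\<close>).

It remains to see that a lattice satisfying the identities of all lattices with at most \<open>N\<close>
elements has a finite basis (\<open>finite_basis_of_bounded_size\<close>); for a single finite lattice this is
McKenzie's theorem, and Baker's theorem generalises it. Finitely many explicit identities
force every subdirectly irreducible lattice that satisfies them to have at most \<open>N\<close> elements: one family shortens weak
projections between quotients, another one turns short projections of many distinct elements onto one
quotient into a contradiction. Only finitely many lattices remain, and each of them that violates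
some identity of \<open>L_OC V\<close> is excluded by one such identity.\<close>

section \<open>Lattice terms and lattice preorders\<close>

text \<open>Terms are interpreted in an arbitrary pair of binary operations. This covers substitution (term
constructors as operations), finite operation tables, and lattices of relations that are not given as
orders.\<close>

primrec eval :: "('c \<Rightarrow> 'c \<Rightarrow> 'c) \<Rightarrow> ('c \<Rightarrow> 'c \<Rightarrow> 'c) \<Rightarrow> (nat \<Rightarrow> 'c) \<Rightarrow> lterm \<Rightarrow> 'c" where
  "eval J M \<phi> (LVar n) = \<phi> n"
| "eval J M \<phi> (LJoin s t) = J (eval J M \<phi> s) (eval J M \<phi> t)"
| "eval J M \<phi> (LMeet s t) = M (eval J M \<phi> s) (eval J M \<phi> t)"

lemma lterm_value_eval: "lterm_value L \<phi> t = eval (join L) (meet L) \<phi> t"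
  by (induction t) auto

lemma eval_LVar: "eval LJoin LMeet LVar t = t"
  by (induction t) auto

lemma lterm_subst_eval: "lterm_subst \<sigma> t = eval LJoin LMeet \<sigma> t"
  by (induction t) auto

lemma eval_hom:
  assumes "\<And>x y. h (J x y) = J' (h x) (h y)" and "\<And>x y. h (M x y) = M' (h x) (h y)"
  shows "h (eval J M \<phi> t) = eval J' M' (\<lambda>n. h (\<phi> n)) t"
  by (induction t) (auto simp: assms)

lemma eval_hom_on:
  assumes "\<And>x y. x \<in> B \<Longrightarrow> y \<in> B \<Longrightarrow> J x y \<in> B \<and> h (J x y) = J' (h x) (h y)"
    and "\<And>x y. x \<in> B \<Longrightarrow> y \<in> B \<Longrightarrow> M x y \<in> B \<and> h (M x y) = M' (h x) (h y)"
    and "\<And>n. \<phi> n \<in> B"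
  shows "eval J M \<phi> t \<in> B \<and> h (eval J M \<phi> t) = eval J' M' (\<lambda>n. h (\<phi> n)) t"
  by (induction t) (auto simp: assms)

text \<open>A lattice up to equivalence. Quotients of the term algebra are represented by such preorders on terms:
passing to a larger quotient is just passing to a larger preorder.\<close>

locale lattice_preorder =
  fixes le :: "'c \<Rightarrow> 'c \<Rightarrow> bool" (infix "\<preceq>" 50)
    and J :: "'c \<Rightarrow> 'c \<Rightarrow> 'c" and M :: "'c \<Rightarrow> 'c \<Rightarrow> 'c"
  assumes le_refl [simp, intro!]: "x \<preceq> x"
    and le_trans [trans]: "x \<preceq> y \<Longrightarrow> y \<preceq> z \<Longrightarrow> x \<preceq> z"
    and J_ub1 [simp, intro!]: "x \<preceq> J x y" and J_ub2 [simp, intro!]: "y \<preceq> J x y"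
    and J_least: "x \<preceq> z \<Longrightarrow> y \<preceq> z \<Longrightarrow> J x y \<preceq> z"
    and M_lb1 [simp, intro!]: "M x y \<preceq> x" and M_lb2 [simp, intro!]: "M x y \<preceq> y"
    and M_greatest: "z \<preceq> x \<Longrightarrow> z \<preceq> y \<Longrightarrow> z \<preceq> M x y"

lemma (in lattice_preorder) dual: "lattice_preorder (\<lambda>x y. y \<preceq> x) M J"
  by unfold_locales (auto intro: J_least M_greatest le_trans)

section \<open>Translations and linked quotients\<close>

text \<open>On a quotient \<open>a \<le> b\<close> the steps \<open>x \<mapsto> (x \<squnion> c) \<sqinter> d\<close> yield all translations: joining with \<open>c\<close>
is the step \<open>(c, b \<squnion> c)\<close>, meeting with \<open>d\<close> is the step \<open>(a \<sqinter> d, d)\<close>, and passing to a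
subinterval \<open>[c, d]\<close> is the step \<open>(c, d)\<close>. A single shape of step keeps the identities below uniform.\<close>

definition run :: "('c \<Rightarrow> 'c \<Rightarrow> 'c) \<Rightarrow> ('c \<Rightarrow> 'c \<Rightarrow> 'c) \<Rightarrow> ('c \<times> 'c) list \<Rightarrow> 'c \<Rightarrow> 'c" where
  "run J M ts x = fold (\<lambda>(c, d) y. M (J y c) d) ts x"

lemma run_Nil [simp]: "run J M [] x = x"
  and run_Cons [simp]: "run J M ((c, d) # ts) x = run J M ts (M (J x c) d)"
  and run_append: "run J M (ts @ us) x = run J M us (run J M ts x)"
  by (simp_all add: run_def)

lemma run_hom:
  assumes "\<And>x y. h (J x y) = J' (h x) (h y)" and "\<And>x y. h (M x y) = M' (h x) (h y)"
  shows "h (run J M ts x) = run J' M' (map (map_prod h h) ts) (h x)"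
  by (induction ts arbitrary: x) (auto simp: assms)

lemma run_closed:
  assumes "\<And>x y. x \<in> B \<Longrightarrow> y \<in> B \<Longrightarrow> J x y \<in> B" and "\<And>x y. x \<in> B \<Longrightarrow> y \<in> B \<Longrightarrow> M x y \<in> B"
    and "set ts \<subseteq> B \<times> B" and "x \<in> B"
  shows "run J M ts x \<in> B"
  using assms(3,4) by (induction ts arbitrary: x) (auto simp: assms(1,2))

context lattice_preorder
begin

definition equivalent (infix "\<approx>" 50) where "x \<approx> y \<longleftrightarrow> x \<preceq> y \<and> y \<preceq> x"

abbreviation "Run \<equiv> run J M"

lemma equivalent_refl [simp]: "x \<approx> x" and equivalent_sym: "x \<approx> y \<Longrightarrow> y \<approx> x"
  and equivalent_trans [trans]: "x \<approx> y \<Longrightarrow> y \<approx> z \<Longrightarrow> x \<approx> z"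
  unfolding equivalent_def by (blast intro: le_trans)+

lemma J_mono: "x \<preceq> x' \<Longrightarrow> y \<preceq> y' \<Longrightarrow> J x y \<preceq> J x' y'"
  by (meson J_least J_ub1 J_ub2 le_trans)

lemma M_mono: "x \<preceq> x' \<Longrightarrow> y \<preceq> y' \<Longrightarrow> M x y \<preceq> M x' y'"
  by (meson M_greatest M_lb1 M_lb2 le_trans)

lemma Run_mono: "x \<preceq> y \<Longrightarrow> Run ts x \<preceq> Run ts y"
proof (induction ts arbitrary: x y)
  case (Cons t ts)
  obtain c d where "t = (c, d)" by (cases t)
  then show ?case using Cons.IH[OF M_mono[OF J_mono[OF Cons.prems le_refl] le_refl]] by simp
qed simp

lemma Run_cong: "x \<approx> y \<Longrightarrow> Run ts x \<approx> Run ts y"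
  by (simp add: equivalent_def Run_mono)

lemma clamp_low: "x \<preceq> c \<Longrightarrow> c \<preceq> d \<Longrightarrow> M (J x c) d \<approx> c"
  unfolding equivalent_def by (meson J_least J_ub2 M_greatest M_lb1 le_refl le_trans)

lemma clamp_high: "d \<preceq> x \<Longrightarrow> M (J x c) d \<approx> d"
  unfolding equivalent_def by (meson J_ub1 M_greatest M_lb2 le_refl le_trans)

lemma clamp_between:
  assumes "c \<preceq> x" and "x \<preceq> d"
  shows "M (J x c) d \<approx> x"
  unfolding equivalent_def by (meson J_least J_ub1 M_greatest M_lb1 assms le_refl le_trans)

lemma clamp_ge: "c \<preceq> d \<Longrightarrow> c \<preceq> M (J x c) d"
  by (simp add: M_greatest)

text \<open>Two quotients are linked if translations carry both onto the same nontrivial quotient; this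
means that the congruences that they generate have a nontrivial intersection. The number \<open>m\<close> of steps is
recorded because the identities below serve to bound it.\<close>

definition linked_in :: "nat \<Rightarrow> 'c \<Rightarrow> 'c \<Rightarrow> 'c \<Rightarrow> 'c \<Rightarrow> bool" where
  "linked_in m a b c d \<longleftrightarrow> (\<exists>ts us. length ts + length us = m \<and> Run ts a \<approx> Run us c \<and>
      Run ts b \<approx> Run us d \<and> \<not> Run ts b \<preceq> Run ts a)"

definition linked :: "'c \<Rightarrow> 'c \<Rightarrow> 'c \<Rightarrow> 'c \<Rightarrow> bool" where
  "linked a b c d \<longleftrightarrow> (\<exists>m. linked_in m a b c d)"

lemma linkedI:
  "Run ts a \<approx> Run us c \<Longrightarrow> Run ts b \<approx> Run us d \<Longrightarrow> \<not> Run ts b \<preceq> Run ts a \<Longrightarrow> linked a b c d"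
  unfolding linked_def linked_in_def by blast

lemma linkedE:
  assumes "linked a b c d"
  obtains ts us where "Run ts a \<approx> Run us c" "Run ts b \<approx> Run us d" "\<not> Run ts b \<preceq> Run ts a"
  using assms unfolding linked_def linked_in_def by blast

lemma linked_in_sym:
  assumes "linked_in m a b c d" shows "linked_in m c d a b"
proof -
  from assms obtain ts us where "length ts + length us = m" "Run ts a \<approx> Run us c"
    "Run ts b \<approx> Run us d" "\<not> Run ts b \<preceq> Run ts a" unfolding linked_in_def by blast
  then have "length us + length ts = m" "Run us c \<approx> Run ts a" "Run us d \<approx> Run ts b"
    "\<not> Run us d \<preceq> Run us c"
    unfolding equivalent_def by (simp_all, meson le_trans)
  then show ?thesis unfolding linked_in_def by blast
qed

lemma linked_sym: "linked a b c d \<Longrightarrow> linked c d a b"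
  unfolding linked_def using linked_in_sym by blast

lemma linked_if_projection_linked:
  assumes "linked l' u' a b" and "Run ws l \<approx> l'" and "Run ws u \<approx> u'"
  shows "linked l u a b"
proof -
  from assms(1) obtain ts us where *: "Run ts l' \<approx> Run us a" "Run ts u' \<approx> Run us b"
    "\<not> Run ts u' \<preceq> Run ts l'" by (rule linkedE)
  have l: "Run (ws @ ts) l \<approx> Run ts l'" and u: "Run (ws @ ts) u \<approx> Run ts u'"
    using assms(2,3) by (simp_all add: run_append Run_cong)
  show ?thesis
    by (rule linkedI[of "ws @ ts" _ us]) (use l u * in \<open>unfold equivalent_def, (meson le_trans)+\<close>)
qed

lemma linked_join:
  assumes "linked (J l c) (J u c) a b" and "l \<preceq> u" shows "linked l u a b"
proof (rule linked_if_projection_linked[OF assms(1), of "[(c, J u c)]"])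
  show "Run [(c, J u c)] l \<approx> J l c" using assms(2) unfolding equivalent_def
    by (simp add: J_mono M_greatest)
  show "Run [(c, J u c)] u \<approx> J u c" by (simp add: equivalent_def M_greatest)
qed

lemma linked_meet:
  assumes "linked (M l d) (M u d) a b" and "l \<preceq> u" shows "linked l u a b"
proof (rule linked_if_projection_linked[OF assms(1), of "[(M l d, d)]"])
  show "Run [(M l d, d)] l \<approx> M l d" unfolding equivalent_def
    by (simp add: M_mono M_greatest J_least le_trans[OF M_lb1])
  show "Run [(M l d, d)] u \<approx> M u d" unfolding equivalent_def using assms(2)
    by (simp add: M_mono J_least le_trans[OF M_lb1])
qed

lemma linked_low:
  assumes "linked l' u a b" and "l \<preceq> l'" and "l' \<preceq> u" shows "linked l u a b"
  by (rule linked_if_projection_linked[OF assms(1), of "[(l', u)]"])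
    (use assms in \<open>auto simp: clamp_low clamp_high\<close>)

text \<open>A common nontrivial image of \<open>[l, u]\<close> is cut by the image of \<open>m\<close> into two parts, one of which is
nontrivial; clamping the other translation to this part links it to the corresponding part of
\<open>[l, u]\<close>.\<close>

lemma linked_split:
  assumes "linked l u a b" and "l \<preceq> m" and "m \<preceq> u" and "a \<preceq> b"
  shows "linked l m a b \<or> linked m u a b"
proof -
  from assms(1) obtain ts us where *: "Run ts l \<approx> Run us a" "Run ts u \<approx> Run us b"
    "\<not> Run ts u \<preceq> Run ts l" by (rule linkedE)
  define p q where "p = Run us a" and "q = Run us b"
  have pq: "p \<preceq> q" unfolding p_def q_def by (rule Run_mono[OF assms(4)])
  define ts' where "ts' = ts @ [(p, q)]"
  have l: "Run ts' l \<approx> p" using *(1) pq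
    by (simp add: ts'_def run_append p_def[symmetric] equivalent_def[of _ p] clamp_low[unfolded equivalent_def])
  have u: "Run ts' u \<approx> q" using *(2)
    by (simp add: ts'_def run_append q_def[symmetric] clamp_high equivalent_def[of _ q] clamp_high[unfolded equivalent_def])
  define r where "r = Run ts' m"
  have pr: "p \<preceq> r" and rq: "r \<preceq> q"
    using Run_mono[OF assms(2), of ts'] Run_mono[OF assms(3), of ts'] l u
    unfolding r_def[symmetric] by (auto simp: equivalent_def intro: le_trans)
  have npq: "\<not> q \<preceq> p" using * unfolding p_def q_def equivalent_def by (meson le_trans)
  show ?thesis
  proof (cases "q \<preceq> r")
    case True
    have "linked l m a b"
      by (rule linkedI[of ts' _ us])
        (use l u npq True rq in \<open>auto simp: equivalent_def r_def[symmetric] p_def[symmetric] q_def[symmetric] intro: le_trans\<close>)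
    then show ?thesis ..
  next
    case False
    have "linked m u a b"
    proof (rule linkedI[of ts' _ "us @ [(r, q)]"])
      show "Run ts' m \<approx> Run (us @ [(r, q)]) a"
        using clamp_low[OF pr rq] by (simp add: run_append p_def[symmetric] r_def[symmetric] equivalent_sym)
      show "Run ts' u \<approx> Run (us @ [(r, q)]) b"
        using clamp_high[OF le_refl, of q r] u
        by (simp add: run_append q_def[symmetric]) (meson equivalent_sym equivalent_trans)
      show "\<not> Run ts' u \<preceq> Run ts' m"
        using False u unfolding r_def[symmetric] equivalent_def by (meson le_trans)
    qed
    then show ?thesis ..
  qed
qed

text \<open>The pseudocomplement of the congruence generated by the quotient \<open>a \<le> b\<close>.\<close>

definition polar :: "'c \<Rightarrow> 'c \<Rightarrow> 'c \<Rightarrow> 'c \<Rightarrow> bool" where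
  "polar a b u v \<longleftrightarrow> \<not> linked (M u v) u a b"

lemma polar_extends: "u \<preceq> v \<Longrightarrow> polar a b u v"
  unfolding polar_def by (metis Run_mono linkedE M_greatest le_refl)

text \<open>In each closure condition the quotient to be tested is a chain of two translates of quotients that are
already known not to be linked, so \<open>linked_split\<close> applies.\<close>

lemma lattice_preorder_polar:
  assumes "a \<preceq> b" shows "lattice_preorder (polar a b) J M"
proof
  fix u v w
  assume uv: "polar a b u v" and vw: "polar a b v w"
  show "polar a b u w"
    unfolding polar_def
  proof
    assume "linked (M u w) u a b"
    then have "linked (M (M v w) u) u a b"
      by (rule linked_low) (auto intro!: M_greatest intro: le_trans[OF M_lb1])
    then have "linked (M (M v w) u) (M v u) a b \<or> linked (M v u) u a b"
      by (rule linked_split) (use assms in \<open>auto intro!: M_mono\<close>)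
    then show False
    proof
      assume "linked (M (M v w) u) (M v u) a b"
      then have "linked (M v w) v a b" by (rule linked_meet) simp
      then show False using vw by (simp add: polar_def)
    next
      assume "linked (M v u) u a b"
      then have "linked (M u v) u a b" by (rule linked_low) (auto intro: M_greatest)
      then show False using uv by (simp add: polar_def)
    qed
  qed
next
  fix u v w
  assume u: "polar a b u w" and v: "polar a b v w"
  show "polar a b (J u v) w"
    unfolding polar_def
  proof
    assume "linked (M (J u v) w) (J u v) a b"
    then have "linked (J (M u w) (M v w)) (J u v) a b"
      by (rule linked_low) (auto intro!: J_least M_mono)
    then have "linked (J (M u w) (M v w)) (J u (M v w)) a b \<or> linked (J u (M v w)) (J u v) a b"
      by (rule linked_split) (use assms in \<open>auto intro!: J_mono\<close>)
    then show False
    proof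
      assume "linked (J (M u w) (M v w)) (J u (M v w)) a b"
      then have "linked (M u w) u a b" by (rule linked_join) simp
      then show False using u by (simp add: polar_def)
    next
      assume "linked (J u (M v w)) (J u v) a b"
      then have "linked (J (M v w) u) (J v u) a b"
        by (rule linked_if_projection_linked[of _ _ _ _ "[]"]) (auto simp: equivalent_def intro: J_least)
      then have "linked (M v w) v a b" by (rule linked_join) simp
      then show False using v by (simp add: polar_def)
    qed
  qed
next
  fix u v w
  assume v: "polar a b u v" and w: "polar a b u w"
  show "polar a b u (M v w)"
    unfolding polar_def
  proof
    assume "linked (M u (M v w)) u a b"
    then have "linked (M u (M v w)) (M u v) a b \<or> linked (M u v) u a b"
      by (rule linked_split) (use assms in \<open>auto intro!: M_mono\<close>)
    then show False
    proof
      assume "linked (M u (M v w)) (M u v) a b"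
      then have "linked (M (M u w) v) (M u v) a b"
        by (rule linked_if_projection_linked[of _ _ _ _ "[]"])
          (simp_all add: equivalent_def M_greatest le_trans[OF M_lb1] le_trans[OF M_lb2])
      then have "linked (M u w) u a b" by (rule linked_meet) simp
      then show False using w by (simp add: polar_def)
    qed (use v in \<open>simp add: polar_def\<close>)
  qed
qed (auto intro: polar_extends)

text \<open>The quotient by such a preorder is subdirectly irreducible.\<close>

definition maximal_avoiding :: "'c \<Rightarrow> 'c \<Rightarrow> bool" where
  "maximal_avoiding s t \<longleftrightarrow> \<not> s \<preceq> t \<and> (\<forall>le'. lattice_preorder le' J M \<longrightarrow>
     (\<forall>x y. x \<preceq> y \<longrightarrow> le' x y) \<longrightarrow> \<not> le' s t \<longrightarrow> (\<forall>x y. le' x y \<longrightarrow> x \<preceq> y))"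

text \<open>If two nontrivial quotients were not linked, each would lie in the polar of the other. By maximality
both polars then contain the pair \<open>(s, t)\<close>, and so the quotient \<open>s \<sqinter> t \<le> s\<close> would not even be linked to itself.\<close>

lemma linked_of_maximal:
  assumes max: "maximal_avoiding s t"
    and ab: "a \<preceq> b" "\<not> b \<preceq> a" and cd: "c \<preceq> d" "\<not> d \<preceq> c"
  shows "linked a b c d"
proof (rule ccontr)
  assume n: "\<not> linked a b c d"
  have *: "polar x y s t" if "x \<preceq> y" "u \<preceq> v" "\<not> v \<preceq> u" "\<not> linked u v x y" for x y u v
  proof (rule ccontr)
    assume "\<not> polar x y s t"
    then have "polar x y v u \<Longrightarrow> v \<preceq> u"
      using max lattice_preorder_polar[OF that(1)] polar_extends unfolding maximal_avoiding_def by blast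
    with that(3) have "\<not> polar x y v u" by blast
    then have "linked (M v u) v x y" by (simp add: polar_def)
    then have "linked u v x y"
      by (rule linked_if_projection_linked[of _ _ _ _ "[]"])
        (use that(2) in \<open>auto simp: equivalent_def intro: M_greatest\<close>)
    with that(4) show False ..
  qed
  from *[OF cd(1) ab n] have "\<not> linked (M s t) s c d" by (simp add: polar_def)
  then have "\<not> linked c d (M s t) s" using linked_sym by blast
  from *[OF _ cd this] have "\<not> linked (M s t) s (M s t) s" by (simp add: polar_def)
  moreover have "linked (M s t) s (M s t) s"
    by (rule linkedI[of "[]" _ "[]"]) (use max in \<open>auto simp: maximal_avoiding_def intro: le_trans\<close>)
  ultimately show False by blast
qed

end

section \<open>Shortening translations by identities\<close>

text \<open>The pairs \<open>(\<alpha>, \<beta>)\<close> are collapsed one after the other: clamped to \<open>[lo, hi]\<close> such a pair leaves a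
lower and an upper part, and \<open>paths\<close> lists the intervals left over at the end. If all of them are
trivial, the initial interval is collapsed by collapsing the pairs. Expressing this by equations between
explicit terms replaces the appeal to compactness in the usual proof of the finite basis theorem.\<close>

fun paths :: "('c \<Rightarrow> 'c \<Rightarrow> 'c) \<Rightarrow> ('c \<Rightarrow> 'c \<Rightarrow> 'c) \<Rightarrow> ('c \<times> 'c) list \<Rightarrow> 'c \<Rightarrow> 'c \<Rightarrow> ('c \<times> 'c) list" where
  "paths J M [] lo hi = [(lo, hi)]"
| "paths J M ((\<alpha>, \<beta>) # rs) lo hi =
     paths J M rs lo (M (J \<alpha> lo) hi) @ paths J M rs (M (J \<beta> lo) hi) hi"

lemma paths_hom:
  assumes "\<And>x y. h (J x y) = J' (h x) (h y)" and "\<And>x y. h (M x y) = M' (h x) (h y)"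
  shows "map (map_prod h h) (paths J M rs lo hi)
      = paths J' M' (map (map_prod h h) rs) (h lo) (h hi)"
  by (induction rs arbitrary: lo hi rule: list.induct) (auto simp: assms)

text \<open>Images under translations from which the steps between \<open>5 * i\<close> and \<open>5 * j\<close> are omitted, clamped to
the image under the full translation. Linking a shortcut again costs four additional steps in total,
so removing five or more steps at a time makes the total number smaller.\<close>

definition shortcuts ::
  "('c \<Rightarrow> 'c \<Rightarrow> 'c) \<Rightarrow> ('c \<Rightarrow> 'c \<Rightarrow> 'c) \<Rightarrow> nat \<Rightarrow> ('c \<times> 'c) list \<Rightarrow> 'c \<Rightarrow> 'c \<Rightarrow> ('c \<times> 'c) list" where
  "shortcuts J M m ts a b =
     (let p = run J M ts a; q = run J M ts b in
      [(run J M (take (5 * i) ts @ drop (5 * j) ts @ [(p, q)]) a,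
        run J M (take (5 * i) ts @ drop (5 * j) ts @ [(p, q)]) b).
        j \<leftarrow> [0..<Suc m], i \<leftarrow> [0..<j]])"

lemma shortcuts_hom:
  assumes "\<And>x y. h (J x y) = J' (h x) (h y)" and "\<And>x y. h (M x y) = M' (h x) (h y)"
  shows "map (map_prod h h) (shortcuts J M m ts a b)
      = shortcuts J' M' m (map (map_prod h h) ts) (h a) (h b)"
  by (simp add: shortcuts_def Let_def map_concat run_hom[of h J J' M M', OF assms] o_def
      take_map drop_map)

lemma set_shortcuts:
  "set (shortcuts J M m ts a b) =
    (let p = run J M ts a; q = run J M ts b in
     {(run J M (take (5 * i) ts @ drop (5 * j) ts @ [(p, q)]) a,
        run J M (take (5 * i) ts @ drop (5 * j) ts @ [(p, q)]) b) | i j. i < j \<and> j \<le> m})"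
  unfolding shortcuts_def Let_def by (fastforce simp del: upt_Suc)

definition radius_pairs ::
  "('c \<Rightarrow> 'c \<Rightarrow> 'c) \<Rightarrow> ('c \<Rightarrow> 'c \<Rightarrow> 'c) \<Rightarrow> nat \<Rightarrow> ('c \<times> 'c) list \<Rightarrow> 'c \<Rightarrow> 'c \<Rightarrow> ('c \<times> 'c) list" where
  "radius_pairs J M m ts a b =
     paths J M (shortcuts J M m ts a b) (run J M ts a) (run J M ts b)"

lemma radius_pairs_hom:
  assumes "\<And>x y. h (J x y) = J' (h x) (h y)" and "\<And>x y. h (M x y) = M' (h x) (h y)"
  shows "map (map_prod h h) (radius_pairs J M m ts a b)
      = radius_pairs J' M' m (map (map_prod h h) ts) (h a) (h b)"
  by (simp add: radius_pairs_def paths_hom[of h J J' M M', OF assms]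
      shortcuts_hom[of h J J' M M', OF assms] run_hom[of h J J' M M', OF assms])

context lattice_preorder
begin

lemma paths_collapsed:
  assumes "hi \<preceq> lo" and "(lo', hi') \<in> set (paths J M rs lo hi)"
  shows "hi' \<preceq> lo'"
  using assms
proof (induction rs arbitrary: lo hi)
  case (Cons r rs)
  obtain \<alpha> \<beta> where r: "r = (\<alpha>, \<beta>)" by (cases r)
  from Cons.prems(2) consider "(lo', hi') \<in> set (paths J M rs lo (M (J \<alpha> lo) hi))"
    | "(lo', hi') \<in> set (paths J M rs (M (J \<beta> lo) hi) hi)" by (auto simp: r)
  then show ?case
  proof cases
    case 1
    show ?thesis by (rule Cons.IH[OF _ 1]) (use Cons.prems(1) in \<open>meson M_lb2 le_trans\<close>)
  next
    case 2
    show ?thesis by (rule Cons.IH[OF _ 2]) (use Cons.prems(1) in \<open>meson M_greatest J_ub2 le_refl le_trans\<close>)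
  qed
qed simp

text \<open>Once a pair that spans the whole initial interval has been processed, both remaining parts are trivial.\<close>

lemma paths_collapse:
  assumes "(\<alpha>, \<beta>) \<in> set rs" and "\<alpha> \<preceq> p" and "q \<preceq> \<beta>"
    and "p \<preceq> lo" and "hi \<preceq> q" and "(lo', hi') \<in> set (paths J M rs lo hi)" and "lo \<preceq> hi"
  shows "hi' \<preceq> lo'"
  using assms(1,4-)
proof (induction rs arbitrary: lo hi)
  case (Cons r rs)
  obtain \<gamma> \<delta> where r: "r = (\<gamma>, \<delta>)" by (cases r)
  from Cons.prems(4) consider "(lo', hi') \<in> set (paths J M rs lo (M (J \<gamma> lo) hi))"
    | "(lo', hi') \<in> set (paths J M rs (M (J \<delta> lo) hi) hi)" by (auto simp: r)
  then show ?case
  proof cases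
    case 1
    show ?thesis
    proof (cases "(\<alpha>, \<beta>) = r")
      case True
      then have "M (J \<gamma> lo) hi \<preceq> lo"
        using r assms(2) Cons.prems(2) by (auto intro: le_trans[OF M_lb1] J_least le_trans[of \<gamma> p])
      then show ?thesis using 1 paths_collapsed by blast
    next
      case False
      moreover have "M (J \<gamma> lo) hi \<preceq> q" using Cons.prems(3) by (meson M_lb2 le_trans)
      ultimately show ?thesis using Cons.IH[OF _ _ _ 1] Cons.prems
        by (auto simp: M_greatest)
    qed
  next
    case 2
    show ?thesis
    proof (cases "(\<alpha>, \<beta>) = r")
      case True
      then have "hi \<preceq> M (J \<delta> lo) hi"
        using r assms(3) Cons.prems(3)
        by (auto intro!: M_greatest intro: le_trans[of hi q] le_trans[of hi \<delta>])
      then show ?thesis using 2 paths_collapsed by blast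
    next
      case False
      have "p \<preceq> M (J \<delta> lo) hi" using Cons.prems(2,5) by (meson J_ub2 M_greatest le_trans)
      then show ?thesis using Cons.IH[OF _ _ _ 2] Cons.prems False by auto
    qed
  qed
qed simp

text \<open>If no clamped pair were separated by \<open>f\<close>, the values of \<open>f\<close> at the two ends would be
glued together along the trivial intervals left over at the end.\<close>

lemma paths_witness:
  assumes "\<And>lo' hi'. (lo', hi') \<in> set (paths J M rs lo hi) \<Longrightarrow> hi' \<preceq> lo'"
    and "\<And>x y. x \<preceq> y \<Longrightarrow> f x \<preceq> f y" and "\<not> f hi \<preceq> f lo"
  shows "\<exists>\<alpha> \<beta> c d. (\<alpha>, \<beta>) \<in> set rs \<and> \<not> f (M (J \<beta> c) d) \<preceq> f (M (J \<alpha> c) d)"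
  using assms(1,3)
proof (induction rs arbitrary: lo hi)
  case (Cons r rs)
  obtain \<alpha> \<beta> where r: "r = (\<alpha>, \<beta>)" by (cases r)
  consider "\<not> f (M (J \<beta> lo) hi) \<preceq> f (M (J \<alpha> lo) hi)" | "\<not> f (M (J \<alpha> lo) hi) \<preceq> f lo"
    | "\<not> f hi \<preceq> f (M (J \<beta> lo) hi)" using Cons.prems(2) le_trans by blast
  then show ?case
  proof cases
    case 1 then show ?thesis by (auto simp: r)
  next
    case 2 with Cons.IH[OF _ 2] Cons.prems(1) show ?thesis by (auto simp: r)
  next
    case 3 with Cons.IH[OF _ 3] Cons.prems(1) show ?thesis by (auto simp: r)
  qed
qed (use assms(2) in auto)

text \<open>The collapsed paths express that the quotient reached after the first \<open>5 * m\<close> steps is collapsed by its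
shortcuts. The common image is nontrivial, so some shortcut has a nontrivial image in it: a new link
with fewer steps.\<close>

lemma linked_shorten_step:
  assumes rad: "\<And>lo hi. (lo, hi) \<in> set (radius_pairs J M m (take (5 * m) ts) a b) \<Longrightarrow> hi \<preceq> lo"
    and "a \<preceq> b" "c \<preceq> d" and ts: "Run ts a \<approx> Run us c" "Run ts b \<approx> Run us d"
      "\<not> Run ts b \<preceq> Run ts a" and len: "5 * m \<le> length ts"
  shows "\<exists>k < length ts + length us. linked_in k a b c d"
proof -
  define ts1 ts2 where "ts1 = take (5 * m) ts" and "ts2 = drop (5 * m) ts"
  have l1: "length ts1 = 5 * m" and l2: "length ts2 + 5 * m = length ts"
    using len by (auto simp: ts1_def ts2_def)
  have app: "ts = ts1 @ ts2" by (simp add: ts1_def ts2_def)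
  define p q where "p = Run ts1 a" and "q = Run ts1 b"
  define p' q' where "p' = Run us c" and "q' = Run us d"
  have pq': "p' \<preceq> q'" unfolding p'_def q'_def by (rule Run_mono[OF assms(3)])
  define f where "f = Run (ts2 @ [(p', q')])"
  have p: "Run ts2 p \<approx> p'" and q: "Run ts2 q \<approx> q'"
    using ts(1,2) by (simp_all add: app run_append p_def q_def p'_def q'_def)
  have fp: "f p \<approx> p'" using clamp_low[OF _ pq'] p unfolding f_def equivalent_def[of "Run ts2 p"]
    by (simp add: run_append)
  have fq: "f q \<approx> q'" using clamp_high q unfolding f_def equivalent_def[of "Run ts2 q"]
    by (simp add: run_append)
  have "\<not> q' \<preceq> p'" using ts unfolding p'_def q'_def equivalent_def by (meson le_trans)
  then have "\<not> f q \<preceq> f p" using fp fq unfolding equivalent_def by (meson le_trans)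
  with paths_witness[of "shortcuts J M m ts1 a b" p q f]
  obtain \<alpha> \<beta> x y where \<alpha>\<beta>: "(\<alpha>, \<beta>) \<in> set (shortcuts J M m ts1 a b)"
    and n: "\<not> f (M (J \<beta> x) y) \<preceq> f (M (J \<alpha> x) y)"
    using rad unfolding radius_pairs_def f_def p_def q_def ts1_def by (metis Run_mono)
  from \<alpha>\<beta> obtain i j where ij: "i < j" "j \<le> m"
    and \<alpha>: "\<alpha> = Run (take (5 * i) ts1 @ drop (5 * j) ts1 @ [(p, q)]) a"
    and \<beta>: "\<beta> = Run (take (5 * i) ts1 @ drop (5 * j) ts1 @ [(p, q)]) b"
    by (auto simp: set_shortcuts Let_def p_def q_def)
  define vs where "vs = take (5 * i) ts1 @ drop (5 * j) ts1 @ [(p, q), (x, y)] @ ts2 @ [(p', q')]"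
  have va: "Run vs a = f (M (J \<alpha> x) y)" and vb: "Run vs b = f (M (J \<beta> x) y)"
    by (simp_all add: vs_def \<alpha> \<beta> run_append f_def)
  define P Q where "P = Run vs a" and "Q = Run vs b"
  have PQ: "P \<preceq> Q" unfolding P_def Q_def by (rule Run_mono[OF assms(2)])
  have fr: "p' \<preceq> f z \<and> f z \<preceq> q'" for z
    unfolding f_def by (simp add: run_append clamp_ge[OF pq'])
  have P: "M (J p' P) Q \<approx> P" by (rule clamp_low) (use fr va PQ in \<open>auto simp: P_def\<close>)
  have Q: "M (J q' P) Q \<approx> Q" by (rule clamp_high) (use fr vb in \<open>auto simp: Q_def\<close>)
  \<comment> \<open>the translation of \<open>a, b\<close> loses at least five steps and gains three; that of \<open>c, d\<close> gains one\<close>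
  have "linked_in (length vs + length (us @ [(P, Q)])) a b c d"
    unfolding linked_in_def
    by (rule exI[of _ vs], rule exI[of _ "us @ [(P, Q)]"])
      (use P Q n va vb in \<open>auto simp: run_append p'_def[symmetric] q'_def[symmetric] P_def[symmetric] Q_def[symmetric] equivalent_sym\<close>)
  moreover have "length vs + length (us @ [(P, Q)]) < length ts + length us"
  proof -
    have "5 * i + 5 \<le> 5 * j" "5 * j \<le> 5 * m" using ij by auto
    then show ?thesis using l1 l2 by (simp add: vs_def)
  qed
  ultimately show ?thesis by blast
qed

definition bounded_radius :: "nat \<Rightarrow> bool" where
  "bounded_radius m \<longleftrightarrow> (\<forall>a b ts. length ts = 5 * m \<longrightarrow>
     (\<forall>(lo, hi) \<in> set (radius_pairs J M m ts (M a b) b). hi \<preceq> lo))"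

lemma linked_shorten:
  assumes rad: "bounded_radius m"
    and ab: "a \<preceq> b" and cd: "c \<preceq> d" and ts: "Run ts a \<approx> Run us c" "Run ts b \<approx> Run us d"
      "\<not> Run ts b \<preceq> Run ts a" and len: "5 * m \<le> length ts"
  shows "\<exists>k < length ts + length us. linked_in k a b c d"
proof -
  have eq: "M a b \<approx> a" using ab by (simp add: equivalent_def M_greatest)
  have ne: "\<not> Run ts b \<preceq> Run ts (M a b)"
    using ts(3) Run_cong[OF eq, of ts] unfolding equivalent_def by (meson le_trans)
  have "hi \<preceq> lo" if "(lo, hi) \<in> set (radius_pairs J M m (take (5 * m) ts) (M a b) b)" for lo hi
    using rad[unfolded bounded_radius_def, rule_format, OF _ that] len by simp
  then obtain k where k: "k < length ts + length us" "linked_in k (M a b) b c d"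
    using linked_shorten_step[OF _ M_lb2 cd equivalent_trans[OF Run_cong[OF eq] ts(1)] ts(2) ne len]
    by blast
  from k(2) obtain vs ws where vs: "length vs + length ws = k" "Run vs (M a b) \<approx> Run ws c"
    "Run vs b \<approx> Run ws d" "\<not> Run vs b \<preceq> Run vs (M a b)" unfolding linked_in_def by blast
  have "Run vs a \<approx> Run ws c"
    using equivalent_trans[OF equivalent_sym[OF Run_cong[OF eq]] vs(2)] .
  moreover have "\<not> Run vs b \<preceq> Run vs a"
    using vs(4) Run_cong[OF eq, of vs] unfolding equivalent_def by (meson le_trans)
  ultimately have "linked_in k a b c d" using vs unfolding linked_in_def by blast
  then show ?thesis using k(1) by blast
qed

lemma Run_pad:
  assumes "x \<preceq> y" and "length ws \<le> n"
  shows "\<exists>vs. length vs = n \<and> Run vs x \<approx> Run ws x \<and> Run vs y \<approx> Run ws y"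
  using assms(2)
proof (induction rule: dec_induct)
  case (step n)
  then obtain vs where vs: "length vs = n" "Run vs x \<approx> Run ws x" "Run vs y \<approx> Run ws y" by blast
  have le: "Run vs x \<preceq> Run vs y" by (rule Run_mono[OF assms(1)])
  let ?v = "vs @ [(Run vs x, Run vs y)]"
  have "Run ?v x \<approx> Run vs x" "Run ?v y \<approx> Run vs y"
    using clamp_low[OF le_refl le] clamp_high[OF le_refl] by (simp_all add: run_append)
  then show ?case using vs by (intro exI[of _ ?v]) (auto intro: equivalent_trans)
qed auto

text \<open>A link with the least total number of steps cannot be shortened on either side, so both sides have fewer
than \<open>5 * m\<close> steps; padding makes the lengths equal, as the terms of the identities require.\<close>

lemma linked_bounded:
  assumes rad: "bounded_radius m" and "linked a b c d" and "a \<preceq> b" "c \<preceq> d"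
  shows "\<exists>ts us. length ts = 5 * m \<and> length us = 5 * m \<and> Run ts a \<approx> Run us c \<and>
      Run ts b \<approx> Run us d \<and> \<not> Run ts b \<preceq> Run ts a"
proof -
  define k where "k = (LEAST k. linked_in k a b c d)"
  have "linked_in k a b c d"
    using assms(2) unfolding k_def linked_def by (rule LeastI_ex)
  then obtain ts us where len: "length ts + length us = k" and
    ts: "Run ts a \<approx> Run us c" "Run ts b \<approx> Run us d" "\<not> Run ts b \<preceq> Run ts a"
    unfolding linked_in_def by blast
  have min: "\<not> linked_in k' a b c d" if "k' < k" for k'
    using that not_less_Least unfolding k_def by blast
  have sym: "linked_in k' c d a b \<longleftrightarrow> linked_in k' a b c d" for k'
    using linked_in_sym by blast
  have 1: "length ts < 5 * m"
    using linked_shorten[OF rad assms(3,4) ts] min len by (meson not_less)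
  have 2: "length us < 5 * m"
  proof (rule ccontr)
    assume "\<not> length us < 5 * m"
    moreover have "\<not> Run us d \<preceq> Run us c"
      using ts unfolding equivalent_def by (meson le_trans)
    ultimately obtain k' where "k' < length us + length ts" "linked_in k' c d a b"
      using linked_shorten[OF rad assms(4,3), of us ts] ts equivalent_sym by fastforce
    then show False using min[of k'] sym len by simp
  qed
  obtain ts' where ts': "length ts' = 5 * m" "Run ts' a \<approx> Run ts a" "Run ts' b \<approx> Run ts b"
    using Run_pad[OF assms(3), of ts] 1 by (meson less_imp_le)
  obtain us' where us': "length us' = 5 * m" "Run us' c \<approx> Run us c" "Run us' d \<approx> Run us d"
    using Run_pad[OF assms(4), of us] 2 by (meson less_imp_le)
  have "Run ts' a \<approx> Run us' c" "Run ts' b \<approx> Run us' d"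
    using ts' us' ts(1,2) equivalent_sym equivalent_trans by meson+
  moreover have "\<not> Run ts' b \<preceq> Run ts' a"
    using ts' ts(3) unfolding equivalent_def by (meson le_trans)
  ultimately show ?thesis using ts'(1) us'(1) by blast
qed

end

context lattice_preorder
begin

lemma paths_ordered:
  assumes "lo \<preceq> hi" and "(lo', hi') \<in> set (paths J M rs lo hi)"
  shows "lo' \<preceq> hi'"
  using assms
proof (induction rs arbitrary: lo hi)
  case (Cons r rs)
  obtain \<alpha> \<beta> where r: "r = (\<alpha>, \<beta>)" by (cases r)
  from Cons.prems(2) consider "(lo', hi') \<in> set (paths J M rs lo (M (J \<alpha> lo) hi))"
    | "(lo', hi') \<in> set (paths J M rs (M (J \<beta> lo) hi) hi)" by (auto simp: r)
  then show ?case
  proof cases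
    case 1
    show ?thesis by (rule Cons.IH[OF _ 1]) (rule clamp_ge[OF Cons.prems(1)])
  next
    case 2
    show ?thesis by (rule Cons.IH[OF _ 2]) simp
  qed
qed simp

text \<open>With at most \<open>N\<close> elements two of the \<open>N * N + 1\<close> quotients met after \<open>0, 5, 10, \<dots>\<close> steps coincide.
Omitting the steps between them does not change the final quotient, so the corresponding shortcut spans it.\<close>

lemma radius_pairs_collapse:
  assumes J: "\<And>x y. x \<in> B \<Longrightarrow> y \<in> B \<Longrightarrow> J x y \<in> B" and M: "\<And>x y. x \<in> B \<Longrightarrow> y \<in> B \<Longrightarrow> M x y \<in> B"
    and B: "finite B" "card B \<le> N" and ts: "set ts \<subseteq> B \<times> B" "length ts = 5 * (N * N)"
    and ab: "a \<in> B" "b \<in> B" "a \<preceq> b" and in_pairs: "(lo, hi) \<in> set (radius_pairs J M (N * N) ts a b)"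
  shows "lo \<approx> hi"
proof -
  define g where "g i = (Run (take (5 * i) ts) a, Run (take (5 * i) ts) b)" for i
  have "g ` {..N * N} \<subseteq> B \<times> B"
    unfolding g_def using ts(1) ab by (auto intro!: run_closed[OF J M] dest: in_set_takeD)
  then have "card (g ` {..N * N}) \<le> card (B \<times> B)" by (intro card_mono) (use B in auto)
  also have "\<dots> \<le> N * N" using B by (simp add: card_cartesian_product mult_le_mono)
  finally have "\<not> inj_on g {..N * N}" by (intro pigeonhole) simp
  then obtain i j where ij: "i < j" "j \<le> N * N" "g i = g j"
    unfolding inj_on_def by (metis atMost_iff linorder_neqE_nat)
  define p q where "p = Run ts a" and "q = Run ts b"
  have "Run (take (5 * i) ts @ drop (5 * j) ts) a = p" "Run (take (5 * i) ts @ drop (5 * j) ts) b = q"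
    using ij(3) unfolding p_def q_def g_def by (metis Pair_inject append_take_drop_id run_append)+
  then have *: "Run (take (5 * i) ts @ drop (5 * j) ts @ [(p, q)]) a = M (J p p) q"
    "Run (take (5 * i) ts @ drop (5 * j) ts @ [(p, q)]) b = M (J q p) q"
    by (simp_all add: run_append)
  have pq: "p \<preceq> q" unfolding p_def q_def by (rule Run_mono[OF ab(3)])
  have mem: "(M (J p p) q, M (J q p) q) \<in> set (shortcuts J M (N * N) ts a b)"
    unfolding set_shortcuts Let_def p_def[symmetric] q_def[symmetric] using ij(1,2) * by force
  have "M (J p p) q \<preceq> p" "q \<preceq> M (J q p) q"
    using clamp_low[OF le_refl pq] clamp_high[OF le_refl, of q p] by (auto simp: equivalent_def)
  from paths_collapse[OF mem this _ _ _ pq] paths_ordered[OF pq] in_pairs show ?thesis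
    unfolding radius_pairs_def p_def[symmetric] q_def[symmetric] equivalent_def by blast
qed

end

text \<open>The variables \<open>0, 1\<close> give the initial quotient \<open>v\<^sub>0 \<sqinter> v\<^sub>1 \<le> v\<^sub>1\<close>, all later ones the parameters of the steps.\<close>

definition radius_identities :: "nat \<Rightarrow> (lterm \<times> lterm) set" where
  "radius_identities m = set (radius_pairs LJoin LMeet m
     (map (\<lambda>i. (LVar (2 * i + 2), LVar (2 * i + 3))) [0..<5 * m]) (LMeet (LVar 0) (LVar 1)) (LVar 1))"

lemma radius_identities_eval:
  assumes "(s, t) \<in> radius_identities m"
  shows "(eval J M \<phi> s, eval J M \<phi> t) \<in> set (radius_pairs J M m
     (map (\<lambda>i. (\<phi> (2 * i + 2), \<phi> (2 * i + 3))) [0..<5 * m]) (M (\<phi> 0) (\<phi> 1)) (\<phi> 1))"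
proof -
  let ?h = "map_prod (eval J M \<phi>) (eval J M \<phi>)"
  have "?h (s, t) \<in> ?h ` radius_identities m" using assms by (rule imageI)
  also have "\<dots> = set (map ?h (radius_pairs LJoin LMeet m
     (map (\<lambda>i. (LVar (2 * i + 2), LVar (2 * i + 3))) [0..<5 * m]) (LMeet (LVar 0) (LVar 1)) (LVar 1)))"
    by (simp add: radius_identities_def)
  also have "\<dots> = set (radius_pairs J M m
     (map (\<lambda>i. (\<phi> (2 * i + 2), \<phi> (2 * i + 3))) [0..<5 * m]) (M (\<phi> 0) (\<phi> 1)) (\<phi> 1))"
    by (subst radius_pairs_hom[where J' = J and M' = M]) (simp_all add: o_def)
  finally show ?thesis by simp
qed

lemma (in lattice_preorder) bounded_radius_if_identities:
  assumes "\<And>s t \<phi>. (s, t) \<in> radius_identities m \<Longrightarrow> eval J M \<phi> s \<approx> eval J M \<phi> t"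
  shows "bounded_radius m"
  unfolding bounded_radius_def
proof (intro allI impI, clarify)
  fix a b lo hi and ts :: "('c \<times> 'c) list"
  assume len: "length ts = 5 * m" and mem: "(lo, hi) \<in> set (radius_pairs J M m ts (M a b) b)"
  define \<phi> where "\<phi> n = (if n = 0 then a else if n = 1 then b else
    if even n then fst (ts ! ((n - 2) div 2)) else snd (ts ! ((n - 2) div 2)))" for n
  have ts: "map (\<lambda>i. (\<phi> (2 * i + 2), \<phi> (2 * i + 3))) [0..<5 * m] = ts"
    by (rule nth_equalityI) (auto simp: len \<phi>_def)
  let ?h = "map_prod (eval J M \<phi>) (eval J M \<phi>)"
  have "set (radius_pairs J M m ts (M a b) b) = ?h ` radius_identities m"
    unfolding radius_identities_def set_map[symmetric]
    by (subst radius_pairs_hom[where J' = J and M' = M])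
      (simp_all add: o_def ts[unfolded o_def, simplified] del: One_nat_def, simp_all add: \<phi>_def)
  with mem obtain s t where "(s, t) \<in> radius_identities m" "lo = eval J M \<phi> s" "hi = eval J M \<phi> t"
    by auto
  then show "hi \<preceq> lo" using assms unfolding equivalent_def by blast
qed

lemma (in lattice_preorder) radius_identities_valid:
  assumes "\<And>x y. x \<in> B \<Longrightarrow> y \<in> B \<Longrightarrow> J x y \<in> B" and "\<And>x y. x \<in> B \<Longrightarrow> y \<in> B \<Longrightarrow> M x y \<in> B"
    and "finite B" "card B \<le> N" and \<phi>: "\<And>n. \<phi> n \<in> B" and "(s, t) \<in> radius_identities (N * N)"
  shows "eval J M \<phi> s \<approx> eval J M \<phi> t"
  by (rule radius_pairs_collapse[OF assms(1-4) _ _ _ _ _ radius_identities_eval[OF assms(6)]])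
    (use assms(2) \<phi> in auto)

section \<open>Identities bounding the number of elements\<close>

definition index_pairs :: "nat \<Rightarrow> (nat \<times> nat) list" where
  "index_pairs N = [(i, j). j \<leftarrow> [0..<Suc N], i \<leftarrow> [0..<j]]"

lemma set_index_pairs: "set (index_pairs N) = {(i, j). i < j \<and> j \<le> N}"
  unfolding index_pairs_def by (fastforce simp del: upt_Suc)

text \<open>For each pair \<open>i < j\<close> the quotient \<open>a\<^sub>i \<sqinter> a\<^sub>j \<le> a\<^sub>i \<squnion> a\<^sub>j\<close> is translated, and \<open>y\<close> is clamped to all
the resulting intervals in turn. If two of the \<open>a\<^sub>i\<close> coincide, one of the intervals is trivial and the result
does not depend on \<open>y\<close>. If all intervals equal one nontrivial interval, its elements are fixed.\<close>

definition size_run where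
  "size_run J M N a ps y = run J M (map (\<lambda>(i, j).
     (run J M (ps i j) (M (a i) (a j)), run J M (ps i j) (J (a i) (a j)))) (index_pairs N)) y"

lemma size_run_hom:
  assumes "\<And>x y. h (J x y) = J' (h x) (h y)" and "\<And>x y. h (M x y) = M' (h x) (h y)"
  shows "h (size_run J M N a ps y)
    = size_run J' M' N (\<lambda>i. h (a i)) (\<lambda>i j. map (map_prod h h) (ps i j)) (h y)"
  unfolding size_run_def
  by (simp add: run_hom[of h J J' M M', OF assms] o_def case_prod_unfold assms)

text \<open>Variables are named by encoded lists of indices: \<open>[i]\<close> for the elements, \<open>[i, j, k, _]\<close> for the parameters of
step \<open>k\<close> on the pair \<open>(i, j)\<close>, and \<open>[0, b]\<close> for the argument.\<close>

definition size_term :: "nat \<Rightarrow> nat \<Rightarrow> nat \<Rightarrow> lterm" where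
  "size_term N R b = size_run LJoin LMeet N (\<lambda>i. LVar (list_encode [i]))
     (\<lambda>i j. map (\<lambda>k. (LVar (list_encode [i, j, k, 0]), LVar (list_encode [i, j, k, 1]))) [0..<R])
     (LVar (list_encode [0, b]))"

lemma eval_size_term:
  "eval J M \<phi> (size_term N R b) = size_run J M N (\<lambda>i. \<phi> (list_encode [i]))
     (\<lambda>i j. map (\<lambda>k. (\<phi> (list_encode [i, j, k, 0]), \<phi> (list_encode [i, j, k, 1]))) [0..<R])
     (\<phi> (list_encode [0, b]))"
  unfolding size_term_def
  by (subst size_run_hom[where J' = J and M' = M]) (simp_all add: o_def del: list_encode.simps)

context lattice_preorder
begin

lemma Run_collapsed:
  assumes "(c, d) \<in> set ts" and "d \<preceq> c"
  shows "Run ts x \<approx> Run ts y"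
  using assms(1)
proof (induction ts arbitrary: x y)
  case (Cons t ts)
  show ?case
  proof (cases "t = (c, d)")
    case True
    have "M (J z c) d \<approx> d" for z
      using assms(2) by (simp add: equivalent_def M_greatest le_trans[OF _ J_ub2])
    then have "M (J x c) d \<approx> M (J y c) d" by (meson equivalent_sym equivalent_trans)
    then show ?thesis by (simp add: True Run_cong)
  qed (use Cons in \<open>cases t, auto\<close>)
qed simp

lemma Run_fixed:
  assumes "\<And>c d. (c, d) \<in> set ts \<Longrightarrow> c \<approx> p \<and> d \<approx> q" and "p \<preceq> x" and "x \<preceq> q"
  shows "Run ts x \<approx> x"
  using assms
proof (induction ts arbitrary: x)
  case (Cons t ts)
  obtain c d where t: "t = (c, d)" by (cases t)
  have cd: "c \<approx> p" "d \<approx> q" using Cons.prems(1) t by auto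
  have "M (J x c) d \<approx> x"
    by (rule clamp_between) (use cd Cons.prems in \<open>unfold equivalent_def, (meson le_trans)+\<close>)
  moreover have "Run ts x \<approx> x" by (rule Cons.IH) (use Cons.prems in auto)
  ultimately show ?case by (simp add: t) (meson Run_cong equivalent_trans)
qed simp

lemma size_term_valid:
  assumes "finite B" "card B \<le> N" and \<phi>: "\<And>n. \<phi> n \<in> B"
  shows "eval J M \<phi> (size_term N R 0) \<approx> eval J M \<phi> (size_term N R 1)"
proof -
  define g where "g i = \<phi> (list_encode [i])" for i
  have "card (g ` {..N}) \<le> card B" by (intro card_mono) (use assms in \<open>auto simp: g_def\<close>)
  then have "\<not> inj_on g {..N}" by (intro pigeonhole) (use assms(2) in simp)
  then obtain i j where ij: "i < j" "j \<le> N" "g i = g j"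
    unfolding inj_on_def by (metis atMost_iff linorder_neqE_nat)
  have "Run ts (M (g i) (g j)) \<approx> Run ts (J (g i) (g j))" for ts
    unfolding ij(3) by (intro Run_cong) (simp add: equivalent_def J_least M_greatest le_trans[OF M_lb1 J_ub1])
  then show ?thesis
    unfolding eval_size_term size_run_def g_def[symmetric]
    by (intro Run_collapsed) (use ij in \<open>auto simp: set_index_pairs equivalent_def intro!: rev_image_eqI[of "(i, j)"]\<close>)
qed

text \<open>A nontrivial common image of the first quotients is itself a nontrivial quotient, so it is linked to the
next one; each link adds a bounded number of steps.\<close>

lemma common_projection:
  assumes rad: "bounded_radius m"
    and link: "\<And>a b c d. a \<preceq> b \<Longrightarrow> \<not> b \<preceq> a \<Longrightarrow> c \<preceq> d \<Longrightarrow> \<not> d \<preceq> c \<Longrightarrow> linked a b c d"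
    and qs: "\<And>a b. (a, b) \<in> set qs \<Longrightarrow> a \<preceq> b \<and> \<not> b \<preceq> a" and xy: "x \<preceq> y" "\<not> y \<preceq> x"
  shows "\<exists>p q. p \<preceq> q \<and> \<not> q \<preceq> p \<and> (\<forall>(a, b) \<in> set qs. \<exists>ts. length ts = length qs * (5 * m) \<and>
      Run ts a \<approx> p \<and> Run ts b \<approx> q)"
  using qs
proof (induction qs)
  case Nil
  then show ?case using xy by auto
next
  case (Cons r qs)
  obtain c d where r: "r = (c, d)" by (cases r)
  have cd: "c \<preceq> d" "\<not> d \<preceq> c" using Cons.prems r by auto
  obtain p q where pq: "p \<preceq> q" "\<not> q \<preceq> p" and
    all: "\<forall>(a, b) \<in> set qs. \<exists>ts. length ts = length qs * (5 * m) \<and> Run ts a \<approx> p \<and> Run ts b \<approx> q"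
    using Cons by force
  obtain ts us where l: "length ts = 5 * m" "length us = 5 * m" and
    ts: "Run ts p \<approx> Run us c" "Run ts q \<approx> Run us d" "\<not> Run ts q \<preceq> Run ts p"
    using linked_bounded[OF rad link[OF pq cd] pq(1) cd(1)] by blast
  obtain us' where us': "length us' = length (r # qs) * (5 * m)" "Run us' c \<approx> Run us c" "Run us' d \<approx> Run us d"
    using Run_pad[OF cd(1), of us "length (r # qs) * (5 * m)"] l by auto
  show ?case
  proof (rule exI[of _ "Run ts p"], rule exI[of _ "Run ts q"], intro conjI ballI)
    show "Run ts p \<preceq> Run ts q" by (rule Run_mono[OF pq(1)])
    fix ab assume ab: "ab \<in> set (r # qs)"
    show "case ab of (a, b) \<Rightarrow> \<exists>vs. length vs = length (r # qs) * (5 * m) \<and>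
      Run vs a \<approx> Run ts p \<and> Run vs b \<approx> Run ts q"
    proof (cases "ab = r")
      case True
      have "Run us' c \<approx> Run ts p" "Run us' d \<approx> Run ts q"
        using us' ts(1,2) by (meson equivalent_sym equivalent_trans)+
      then show ?thesis using us'(1) True r by blast
    next
      case False
      then obtain a b vs where "ab = (a, b)" "length vs = length qs * (5 * m)"
        "Run vs a \<approx> p" "Run vs b \<approx> q" using all ab by (cases ab) auto
      then show ?thesis using l by (auto intro!: exI[of _ "vs @ ts"] simp: run_append Run_cong)
    qed
  qed (rule ts(3))
qed

text \<open>Were all \<open>a\<^sub>0, \<dots>, a\<^sub>N\<close> inequivalent, their pairs would generate nontrivial quotients with a common
image \<open>p < q\<close>; for suitable parameters the two size terms then evaluate to \<open>p\<close> and \<open>q\<close>.\<close>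

lemma few_classes:
  assumes rad: "bounded_radius m"
    and link: "\<And>a b c d. a \<preceq> b \<Longrightarrow> \<not> b \<preceq> a \<Longrightarrow> c \<preceq> d \<Longrightarrow> \<not> d \<preceq> c \<Longrightarrow> linked a b c d"
    and size: "\<And>\<phi>. eval J M \<phi> (size_term N (length (index_pairs N) * (5 * m)) 0)
      \<approx> eval J M \<phi> (size_term N (length (index_pairs N) * (5 * m)) 1)"
    and "0 < N"
  shows "\<exists>i j. i < j \<and> j \<le> N \<and> a i \<approx> a j"
proof (rule ccontr)
  assume n: "\<nexists>i j. i < j \<and> j \<le> N \<and> a i \<approx> a j"
  define R where "R = length (index_pairs N) * (5 * m)"
  define qs where "qs = map (\<lambda>(i, j). (M (a i) (a j), J (a i) (a j))) (index_pairs N)"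
  have nontriv: "\<not> J (a i) (a j) \<preceq> M (a i) (a j)" if "i < j" "j \<le> N" for i j
    using n that unfolding equivalent_def by (meson J_ub1 J_ub2 M_lb1 M_lb2 le_trans)
  have le: "M x y \<preceq> J x y" for x y by (meson J_ub1 M_lb1 le_trans)
  obtain p q where pq: "p \<preceq> q" "\<not> q \<preceq> p" and
    all: "\<forall>(x, y) \<in> set qs. \<exists>ts. length ts = R \<and> Run ts x \<approx> p \<and> Run ts y \<approx> q"
  proof -
    have "(0::nat) < 1 \<and> 1 \<le> N" using assms(4) by simp
    then show ?thesis
      using common_projection[OF rad link, of qs "M (a 0) (a 1)" "J (a 0) (a 1)"] nontriv le that
      by (force simp: qs_def set_index_pairs R_def)
  qed
  have "\<exists>ts. length ts = R \<and> Run ts (M (a i) (a j)) \<approx> p \<and> Run ts (J (a i) (a j)) \<approx> q"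
    if "i < j" "j \<le> N" for i j
    using all that by (force simp: qs_def set_index_pairs)
  then obtain F where F: "\<And>i j. i < j \<Longrightarrow> j \<le> N \<Longrightarrow> length (F i j) = R \<and>
      Run (F i j) (M (a i) (a j)) \<approx> p \<and> Run (F i j) (J (a i) (a j)) \<approx> q" by metis
  define \<phi> where "\<phi> n = (case list_decode n of [i] \<Rightarrow> a i | [_, b] \<Rightarrow> if b = 0 then p else q
    | [i, j, k, b] \<Rightarrow> if b = 0 then fst (F i j ! k) else snd (F i j ! k) | _ \<Rightarrow> p)" for n
  define L where "L = map (\<lambda>(i, j). (Run (map (\<lambda>k. (\<phi> (list_encode [i, j, k, 0]),
      \<phi> (list_encode [i, j, k, 1]))) [0..<R]) (M (\<phi> (list_encode [i])) (\<phi> (list_encode [j]))),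
      Run (map (\<lambda>k. (\<phi> (list_encode [i, j, k, 0]),
      \<phi> (list_encode [i, j, k, 1]))) [0..<R]) (J (\<phi> (list_encode [i])) (\<phi> (list_encode [j]))))) (index_pairs N)"
  have ev: "eval J M \<phi> (size_term N R b) = Run L (\<phi> (list_encode [0, b]))" for b
    unfolding eval_size_term size_run_def L_def ..
  have F': "map (\<lambda>k. (\<phi> (list_encode [i, j, k, 0]), \<phi> (list_encode [i, j, k, 1]))) [0..<R] = F i j"
    if "i < j" "j \<le> N" for i j
    by (rule nth_equalityI) (use F[OF that] in \<open>auto simp: \<phi>_def simp del: list_encode.simps\<close>)
  have L: "c \<approx> p \<and> d \<approx> q" if "(c, d) \<in> set L" for c d
    using that F F' unfolding L_def
    by (auto simp: set_index_pairs \<phi>_def simp del: list_encode.simps)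
  have "Run L p \<approx> Run L q"
    using size[of \<phi>] unfolding R_def[symmetric] ev by (simp add: \<phi>_def del: list_encode.simps)
  moreover have "Run L p \<approx> p" by (rule Run_fixed[OF L]) (use pq in auto)
  moreover have "Run L q \<approx> q" by (rule Run_fixed[OF L]) (use pq in auto)
  ultimately show False using pq(2) unfolding equivalent_def by (meson le_trans)
qed

end

section \<open>A finite basis for lattices of bounded size\<close>

lemma lattice_preorder_derivable:
  "lattice_preorder (\<lambda>s t. lat_derivable \<Sigma> (LMeet s t) s) LJoin LMeet"
proof -
  note [trans] = lat_derivable.trans
  let ?D = "lat_derivable \<Sigma>"
  note S = lat_derivable.sym
  note D = lat_derivable.refl
    lat_derivable.join_cong[where \<Sigma> = \<Sigma>] lat_derivable.meet_cong[where \<Sigma> = \<Sigma>]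
  have meet_idem: "?D (LMeet s s) s" for s
  proof -
    have "?D (LMeet s s) (LMeet s (LJoin s (LMeet s s)))"
      by (intro D S[OF lat_derivable.join_absorb])
    also have "?D \<dots> s" by (rule lat_derivable.meet_absorb)
    finally show ?thesis .
  qed
  have to_join: "?D (LJoin x y) y" if "?D (LMeet x y) x" for x y
  proof -
    have "?D (LJoin x y) (LJoin (LMeet x y) y)" by (intro D S[OF that])
    also have "?D \<dots> (LJoin y (LMeet x y))" by (rule lat_derivable.join_comm)
    also have "?D \<dots> (LJoin y (LMeet y x))" by (intro D lat_derivable.meet_comm)
    also have "?D \<dots> y" by (rule lat_derivable.join_absorb)
    finally show ?thesis .
  qed
  have of_join: "?D (LMeet x y) x" if "?D (LJoin x y) y" for x y
  proof -
    have "?D (LMeet x y) (LMeet x (LJoin x y))" by (intro D S[OF that])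
    also have "?D \<dots> x" by (rule lat_derivable.meet_absorb)
    finally show ?thesis .
  qed
  show ?thesis
  proof
    fix x y z
    show "?D (LMeet x x) x" by (rule meet_idem)
    show "?D (LMeet x (LJoin x y)) x" by (rule lat_derivable.meet_absorb)
    have "?D (LMeet y (LJoin x y)) (LMeet y (LJoin y x))"
      by (intro D lat_derivable.join_comm)
    also have "?D \<dots> y" by (rule lat_derivable.meet_absorb)
    finally show "?D (LMeet y (LJoin x y)) y" .
    have "?D (LMeet (LMeet x y) x) (LMeet x (LMeet x y))" by (rule lat_derivable.meet_comm)
    also have "?D \<dots> (LMeet (LMeet x x) y)" by (rule S, rule lat_derivable.meet_assoc)
    also have "?D \<dots> (LMeet x y)" by (intro D meet_idem)
    finally show "?D (LMeet (LMeet x y) x) (LMeet x y)" .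
    have "?D (LMeet (LMeet x y) y) (LMeet x (LMeet y y))" by (rule lat_derivable.meet_assoc)
    also have "?D \<dots> (LMeet x y)" by (intro D meet_idem)
    finally show "?D (LMeet (LMeet x y) y) (LMeet x y)" .
  next
    fix x y z
    assume xy: "?D (LMeet x y) x" and yz: "?D (LMeet y z) y"
    have "?D (LMeet x z) (LMeet (LMeet x y) z)" by (intro D S[OF xy])
    also have "?D \<dots> (LMeet x (LMeet y z))" by (rule lat_derivable.meet_assoc)
    also have "?D \<dots> (LMeet x y)" by (intro D yz)
    also have "?D \<dots> x" by (rule xy)
    finally show "?D (LMeet x z) x" .
  next
    fix x y z
    assume "?D (LMeet x z) x" and "?D (LMeet y z) y"
    then have xz: "?D (LJoin x z) z" and yz: "?D (LJoin y z) z" by (simp_all add: to_join)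
    have "?D (LJoin (LJoin x y) z) (LJoin x (LJoin y z))" by (rule lat_derivable.join_assoc)
    also have "?D \<dots> (LJoin x z)" by (intro D yz)
    also have "?D \<dots> z" by (rule xz)
    finally show "?D (LMeet (LJoin x y) z) (LJoin x y)" by (rule of_join)
  next
    fix x y z
    assume zx: "?D (LMeet z x) z" and zy: "?D (LMeet z y) z"
    have "?D (LMeet z (LMeet x y)) (LMeet (LMeet z x) y)" by (rule S, rule lat_derivable.meet_assoc)
    also have "?D \<dots> (LMeet z y)" by (intro D zx)
    also have "?D \<dots> z" by (rule zy)
    finally show "?D (LMeet z (LMeet x y)) z" .
  qed
qed

lemma derivable_le:
  assumes "lat_derivable \<Sigma> s t" shows "lat_derivable \<Sigma> (LMeet s t) s"
proof -
  interpret lattice_preorder "\<lambda>s t. lat_derivable \<Sigma> (LMeet s t) s" LJoin LMeet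
    by (rule lattice_preorder_derivable)
  have "lat_derivable \<Sigma> (LMeet s t) (LMeet s s)"
    by (intro lat_derivable.meet_cong lat_derivable.refl lat_derivable.sym[OF assms])
  then show ?thesis by (rule lat_derivable.trans) simp
qed

lemma derivable_antisym:
  assumes "lat_derivable \<Sigma> (LMeet s t) s" and "lat_derivable \<Sigma> (LMeet t s) t"
  shows "lat_derivable \<Sigma> s t"
  using assms lat_derivable.meet_comm lat_derivable.sym lat_derivable.trans by metis

lemma lattice_preorder_Union_chain:
  assumes chain: "subset.chain A C" and "C \<noteq> {}"
    and wl: "\<And>r. r \<in> A \<Longrightarrow> lattice_preorder (\<lambda>x y. (x, y) \<in> r) J M"
  shows "lattice_preorder (\<lambda>x y. (x, y) \<in> \<Union> C) J M"
proof -
  have C: "lattice_preorder (\<lambda>x y. (x, y) \<in> r) J M" if "r \<in> C" for r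
    using that chain wl by (auto simp: subset.chain_def)
  obtain r where r: "r \<in> C" using \<open>C \<noteq> {}\<close> by blast
  note in_r = lattice_preorder.le_refl[OF C[OF r]] lattice_preorder.J_ub1[OF C[OF r]]
    lattice_preorder.J_ub2[OF C[OF r]] lattice_preorder.M_lb1[OF C[OF r]] lattice_preorder.M_lb2[OF C[OF r]]
  have two: "\<exists>r \<in> C. p \<in> r \<and> q \<in> r" if pq: "p \<in> \<Union> C" "q \<in> \<Union> C" for p q
  proof -
    obtain r1 r2 where "r1 \<in> C" "p \<in> r1" "r2 \<in> C" "q \<in> r2" using pq by blast
    moreover from this have "r1 \<subseteq> r2 \<or> r2 \<subseteq> r1" using chain unfolding subset_chain_def by blast
    ultimately show ?thesis by blast
  qed
  show ?thesis
  proof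
    fix x y z
    show "(x, x) \<in> \<Union> C" "(x, J x y) \<in> \<Union> C" "(y, J x y) \<in> \<Union> C" "(M x y, x) \<in> \<Union> C" "(M x y, y) \<in> \<Union> C"
      using r in_r by blast+
  next
    fix x y z assume "(x, y) \<in> \<Union> C" "(y, z) \<in> \<Union> C"
    then show "(x, z) \<in> \<Union> C" using two lattice_preorder.le_trans[OF C] by (meson UnionI)
  next
    fix x y z assume "(x, z) \<in> \<Union> C" "(y, z) \<in> \<Union> C"
    then show "(J x y, z) \<in> \<Union> C" using two lattice_preorder.J_least[OF C] by (meson UnionI)
  next
    fix x y z assume "(z, x) \<in> \<Union> C" "(z, y) \<in> \<Union> C"
    then show "(z, M x y) \<in> \<Union> C" using two lattice_preorder.M_greatest[OF C] by (meson UnionI)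
  qed
qed

lemma exists_maximal_lattice_preorder:
  fixes le :: "'c \<Rightarrow> 'c \<Rightarrow> bool"
  assumes "lattice_preorder le J M" and "\<not> le s t"
  shows "\<exists>le'. lattice_preorder le' J M \<and> (\<forall>x y. le x y \<longrightarrow> le' x y) \<and>
    lattice_preorder.maximal_avoiding le' J M s t"
proof -
  define A where "A = {r. lattice_preorder (\<lambda>x y. (x, y) \<in> r) J M \<and> {(x, y). le x y} \<subseteq> r \<and> (s, t) \<notin> r}"
  have "{(x, y). le x y} \<in> A" using assms by (simp add: A_def)
  then have "A \<noteq> {}" by blast
  moreover have "\<Union> C \<in> A" if "C \<noteq> {}" "subset.chain A C" for C
  proof -
    have "lattice_preorder (\<lambda>x y. (x, y) \<in> \<Union> C) J M"
      by (rule lattice_preorder_Union_chain[OF that(2,1)]) (simp add: A_def)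
    moreover have "C \<subseteq> A" using that(2) by (simp add: subset.chain_def)
    ultimately show ?thesis using that(1) unfolding A_def by blast
  qed
  ultimately obtain r where r: "r \<in> A" and max: "\<And>X. X \<in> A \<Longrightarrow> r \<subseteq> X \<Longrightarrow> X = r"
    using subset_Zorn_nonempty[of A] by blast
  interpret lattice_preorder "\<lambda>x y. (x, y) \<in> r" J M using r by (simp add: A_def)
  have "maximal_avoiding s t"
    unfolding maximal_avoiding_def
  proof (intro conjI allI impI)
    show "(s, t) \<notin> r" using r by (simp add: A_def)
    fix le' x y
    assume "lattice_preorder le' J M" "\<forall>x y. (x, y) \<in> r \<longrightarrow> le' x y" "\<not> le' s t" and xy: "le' x y"
    then have "{(x, y). le' x y} \<in> A" "r \<subseteq> {(x, y). le' x y}"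
      using r by (auto simp: A_def)
    then show "(x, y) \<in> r" using max xy by blast
  qed
  then show ?thesis
    by (intro exI[of _ "\<lambda>x y. (x, y) \<in> r"]) (use r lattice_preorder_axioms in \<open>auto simp: A_def\<close>)
qed

lemma class_numbering:
  fixes f :: "'c \<Rightarrow> 'd"
  assumes "\<And>a :: nat \<Rightarrow> 'c. \<exists>i j. i < j \<and> j \<le> N \<and> f (a i) = f (a j)"
  obtains k and \<kappa> :: "'c \<Rightarrow> nat" where "k \<le> N" and "range \<kappa> = {..<k}"
    and "\<And>x y. \<kappa> x = \<kappa> y \<longleftrightarrow> f x = f y"
proof -
  have no: False if D: "D \<subseteq> range f" "card D = Suc N" "finite D" for D
  proof -
    obtain g where g: "bij_betw g {0..<Suc N} D"
      using ex_bij_betw_nat_finite[OF D(3)] D(2) by auto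
    have "\<exists>x. i < Suc N \<longrightarrow> f x = g i" for i
      using D(1) bij_betwE[OF g] by (metis atLeastLessThan_iff imageE le0 subsetD)
    then obtain a where a: "\<And>i. i < Suc N \<Longrightarrow> f (a i) = g i" by metis
    obtain i j where "i < j" "j \<le> N" "f (a i) = f (a j)" using assms by blast
    then show False using a g unfolding bij_betw_def inj_on_def
      by (metis atLeastLessThan_iff le_imp_less_Suc le0 less_irrefl order.strict_trans1 less_imp_le)
  qed
  have fin: "finite (range f)"
  proof (rule ccontr)
    assume "infinite (range f)"
    then show False using infinite_arbitrarily_large[of "range f" "Suc N"] no by blast
  qed
  have card: "card (range f) \<le> N"
  proof (rule ccontr)
    assume "\<not> card (range f) \<le> N"
    then show False using obtain_subset_with_card_n[of "Suc N" "range f"] no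
      by (metis not_less_eq_eq)
  qed
  obtain h where h: "bij_betw h (range f) {0..<card (range f)}"
    using ex_bij_betw_finite_nat[OF fin] by blast
  show thesis
  proof (rule that[of "card (range f)" "h \<circ> f"])
    show "range (h \<circ> f) = {..<card (range f)}"
      using h unfolding bij_betw_def by (metis image_comp lessThan_atLeast0)
    show "(h \<circ> f) x = (h \<circ> f) y \<longleftrightarrow> f x = f y" for x y
      using h unfolding bij_betw_def inj_on_def by auto
  qed (rule card)
qed

type_synonym table = "nat \<times> (nat \<times> nat \<Rightarrow> nat) \<times> (nat \<times> nat \<Rightarrow> nat)"

text \<open>A table \<open>(k, j, m)\<close> carries two operations on \<open>{..<k}\<close>. Prescribing the value \<open>0\<close> outside
\<open>{..<N}\<close> leaves only finitely many tables.\<close>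

definition tables :: "nat \<Rightarrow> table set" where
  "tables N = {..N} \<times>
     {f. \<forall>x. (x \<in> {..<N} \<times> {..<N} \<longrightarrow> f x \<in> {..<N}) \<and> (x \<notin> {..<N} \<times> {..<N} \<longrightarrow> f x = 0)} \<times>
     {f. \<forall>x. (x \<in> {..<N} \<times> {..<N} \<longrightarrow> f x \<in> {..<N}) \<and> (x \<notin> {..<N} \<times> {..<N} \<longrightarrow> f x = 0)}"

lemma finite_tables: "finite (tables N)"
  unfolding tables_def by (intro finite_cartesian_product finite_set_of_finite_funs) auto

definition fails_in_table :: "table \<Rightarrow> lterm \<times> lterm \<Rightarrow> bool" where
  "fails_in_table \<tau> e \<longleftrightarrow> (case \<tau> of (k, j, m) \<Rightarrow> \<exists>\<phi>. (\<forall>n. \<phi> n < k) \<and>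
     eval (curry j) (curry m) \<phi> (fst e) \<noteq> eval (curry j) (curry m) \<phi> (snd e))"

text \<open>A numbering of the classes of a congruence of the term algebra by \<open>{..<k}\<close> transports the quotient to a table;
valuations in the table are the images of substitutions.\<close>

lemma table_of_numbering:
  fixes \<kappa> :: "lterm \<Rightarrow> nat"
  assumes "k \<le> N" and ran: "range \<kappa> = {..<k}"
    and J: "\<And>s s' t t'. \<kappa> s = \<kappa> s' \<Longrightarrow> \<kappa> t = \<kappa> t' \<Longrightarrow> \<kappa> (LJoin s t) = \<kappa> (LJoin s' t')"
    and M: "\<And>s s' t t'. \<kappa> s = \<kappa> s' \<Longrightarrow> \<kappa> t = \<kappa> t' \<Longrightarrow> \<kappa> (LMeet s t) = \<kappa> (LMeet s' t')"
  obtains \<tau> where "\<tau> \<in> tables N" and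
    "\<And>e. fails_in_table \<tau> e \<longleftrightarrow> (\<exists>\<sigma>. \<kappa> (lterm_subst \<sigma> (fst e)) \<noteq> \<kappa> (lterm_subst \<sigma> (snd e)))"
proof -
  define rep where "rep i = (SOME t. \<kappa> t = i)" for i
  have rep: "\<kappa> (rep i) = i" if "i < k" for i
    unfolding rep_def by (rule someI_ex) (use ran that in \<open>metis imageE lessThan_iff\<close>)
  have lt: "\<kappa> t < k" for t using ran by blast
  define j m where "j = (\<lambda>(x, y). if x < k \<and> y < k then \<kappa> (LJoin (rep x) (rep y)) else 0)"
    and "m = (\<lambda>(x, y). if x < k \<and> y < k then \<kappa> (LMeet (rep x) (rep y)) else 0)"
  have j: "\<kappa> (LJoin s t) = curry j (\<kappa> s) (\<kappa> t)" and m: "\<kappa> (LMeet s t) = curry m (\<kappa> s) (\<kappa> t)" for s t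
    unfolding j_def m_def using lt by (auto intro!: J M simp: rep)
  have ev: "\<kappa> (lterm_subst \<sigma> t) = eval (curry j) (curry m) (\<lambda>n. \<kappa> (\<sigma> n)) t" for \<sigma> t
    unfolding lterm_subst_eval by (rule eval_hom) (rule j m)+
  show thesis
  proof (rule that[of "(k, j, m)"])
    have k0: "0 < k" using lt[of undefined] by simp
    have "\<kappa> t < N" for t using lt \<open>k \<le> N\<close> order_less_le_trans by blast
    then show "(k, j, m) \<in> tables N"
      using \<open>k \<le> N\<close> k0 by (auto simp: tables_def j_def m_def)
    fix e
    show "fails_in_table (k, j, m) e \<longleftrightarrow>
      (\<exists>\<sigma>. \<kappa> (lterm_subst \<sigma> (fst e)) \<noteq> \<kappa> (lterm_subst \<sigma> (snd e)))"
    proof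
      assume "fails_in_table (k, j, m) e"
      then obtain \<phi> where \<phi>: "\<And>n. \<phi> n < k"
        "eval (curry j) (curry m) \<phi> (fst e) \<noteq> eval (curry j) (curry m) \<phi> (snd e)"
        by (auto simp: fails_in_table_def)
      have "(\<lambda>n. \<kappa> (rep (\<phi> n))) = \<phi>" using rep \<phi>(1) by auto
      then show "\<exists>\<sigma>. \<kappa> (lterm_subst \<sigma> (fst e)) \<noteq> \<kappa> (lterm_subst \<sigma> (snd e))"
        using \<phi>(2) by (intro exI[of _ "\<lambda>n. rep (\<phi> n)"]) (simp add: ev)
    next
      assume "\<exists>\<sigma>. \<kappa> (lterm_subst \<sigma> (fst e)) \<noteq> \<kappa> (lterm_subst \<sigma> (snd e))"
      then show "fails_in_table (k, j, m) e"
        unfolding ev fails_in_table_def using lt by fastforce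
    qed
  qed
qed

text \<open>One identity from \<open>I\<close> for each small table that violates \<open>I\<close>.\<close>

definition table_basis :: "nat \<Rightarrow> (lterm \<times> lterm) set \<Rightarrow> (lterm \<times> lterm) set" where
  "table_basis N I = (\<lambda>\<tau>. SOME e. e \<in> I \<and> fails_in_table \<tau> e) `
     {\<tau> \<in> tables N. \<exists>e \<in> I. fails_in_table \<tau> e}"

lemma finite_table_basis: "finite (table_basis N I)"
  unfolding table_basis_def using finite_tables by simp

lemma table_basis_pick:
  assumes "\<tau> \<in> tables N" and "e \<in> I" and "fails_in_table \<tau> e"
  obtains e' where "e' \<in> table_basis N I" and "fails_in_table \<tau> e'"
proof
  let ?e = "SOME e. e \<in> I \<and> fails_in_table \<tau> e"
  show "fails_in_table \<tau> ?e" using someI[of "\<lambda>e. e \<in> I \<and> fails_in_table \<tau> e"] assms(2,3) by blast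
  show "?e \<in> table_basis N I" unfolding table_basis_def using assms by blast
qed

lemma table_basis_subset: "table_basis N I \<subseteq> I"
proof
  fix e assume "e \<in> table_basis N I"
  then obtain \<tau> where "e = (SOME e. e \<in> I \<and> fails_in_table \<tau> e)" "\<exists>e. e \<in> I \<and> fails_in_table \<tau> e"
    unfolding table_basis_def by blast
  then show "e \<in> I" using someI_ex[of "\<lambda>e. e \<in> I \<and> fails_in_table \<tau> e"] by blast
qed

text \<open>A subdirectly irreducible quotient satisfying the radius and size identities has at most \<open>N\<close> elements, hence is
given by a table. This table violates no identity of the table basis, so it violates none of \<open>I\<close>.\<close>

lemma maximal_satisfies:
  fixes le :: "lterm \<Rightarrow> lterm \<Rightarrow> bool"
  assumes wl: "lattice_preorder le LJoin LMeet" and max: "lattice_preorder.maximal_avoiding le LJoin LMeet s t"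
    and "0 < N"
    and \<Sigma>: "\<And>x y \<sigma>. (x, y) \<in> radius_identities (N * N) \<union>
        {(size_term N (length (index_pairs N) * (5 * (N * N))) 0,
          size_term N (length (index_pairs N) * (5 * (N * N))) 1)} \<union> table_basis N I \<Longrightarrow>
        le (lterm_subst \<sigma> x) (lterm_subst \<sigma> y) \<and> le (lterm_subst \<sigma> y) (lterm_subst \<sigma> x)"
    and uv: "(u, v) \<in> I"
  shows "le u v \<and> le v u"
proof -
  interpret lattice_preorder le LJoin LMeet by (rule wl)
  have \<Sigma>: "lterm_subst \<sigma> x \<approx> lterm_subst \<sigma> y" if "(x, y) \<in> radius_identities (N * N) \<union>
        {(size_term N (length (index_pairs N) * (5 * (N * N))) 0,
          size_term N (length (index_pairs N) * (5 * (N * N))) 1)} \<union> table_basis N I" for x y \<sigma>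
    unfolding equivalent_def by (rule \<Sigma>[OF that])
  have radius: "bounded_radius (N * N)"
    by (rule bounded_radius_if_identities) (simp add: \<Sigma>[unfolded lterm_subst_eval])
  have size: "eval LJoin LMeet \<phi> (size_term N (length (index_pairs N) * (5 * (N * N))) 0)
      \<approx> eval LJoin LMeet \<phi> (size_term N (length (index_pairs N) * (5 * (N * N))) 1)" for \<phi>
    by (simp add: \<Sigma>[unfolded lterm_subst_eval])
  have link: "linked a b c d" if "le a b" "\<not> le b a" "le c d" "\<not> le d c" for a b c d
    using linked_of_maximal[OF max that] .
  have few: "\<exists>i j. i < j \<and> j \<le> N \<and> a i \<approx> a j" for a
    by (rule few_classes[OF radius link size \<open>0 < N\<close>])
  have cls: "{y. x \<approx> y} = {y. x' \<approx> y} \<longleftrightarrow> x \<approx> x'" for x x'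
    using equivalent_sym equivalent_trans equivalent_refl by blast
  obtain k and \<kappa> :: "lterm \<Rightarrow> nat" where \<kappa>: "k \<le> N" "range \<kappa> = {..<k}"
    "\<And>x y. \<kappa> x = \<kappa> y \<longleftrightarrow> x \<approx> y"
    using class_numbering[of N "\<lambda>x. {y. x \<approx> y}"] few unfolding cls by blast
  obtain \<tau> where \<tau>: "\<tau> \<in> tables N"
    "\<And>e. fails_in_table \<tau> e \<longleftrightarrow> (\<exists>\<sigma>. \<kappa> (lterm_subst \<sigma> (fst e)) \<noteq> \<kappa> (lterm_subst \<sigma> (snd e)))"
    by (rule table_of_numbering[OF \<kappa>(1,2)])
      (auto simp: \<kappa>(3) equivalent_def intro: J_mono M_mono)
  have "\<not> fails_in_table \<tau> (u, v)"
  proof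
    assume "fails_in_table \<tau> (u, v)"
    then obtain x y where "(x, y) \<in> table_basis N I" and f: "fails_in_table \<tau> (x, y)"
      using table_basis_pick[OF \<tau>(1) uv] by (metis prod.collapse)
    then show False using \<Sigma> unfolding \<tau>(2) \<kappa>(3) by auto
  qed
  then have "\<kappa> (lterm_subst LVar u) = \<kappa> (lterm_subst LVar v)" unfolding \<tau>(2) by simp
  then show ?thesis
    unfolding \<kappa>(3) lterm_subst_eval eval_LVar equivalent_def .
qed

text \<open>If an identity of \<open>L\<close> were not derivable, a maximal preorder avoiding one of its two inequalities would satisfy
all identities of \<open>L\<close>, including that one.\<close>

theorem finite_basis_of_bounded_size:
  fixes L :: "('b, 'c) gorder_scheme"
  assumes "0 < N" and rad: "\<And>e. e \<in> radius_identities (N * N) \<Longrightarrow> lat_satisfies L e"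
    and size: "\<And>R. lat_satisfies L (size_term N R 0, size_term N R 1)"
  shows "has_finite_identity_basis L"
proof -
  define I where "I = {e. lat_satisfies L e}"
  define \<Sigma> where "\<Sigma> = radius_identities (N * N) \<union>
        {(size_term N (length (index_pairs N) * (5 * (N * N))) 0,
          size_term N (length (index_pairs N) * (5 * (N * N))) 1)} \<union> table_basis N I"
  have "finite \<Sigma>"
    unfolding \<Sigma>_def radius_identities_def using finite_table_basis by simp
  moreover have "lat_satisfies L e" if "e \<in> \<Sigma>" for e
    using that rad size table_basis_subset[of N I] unfolding \<Sigma>_def I_def by blast
  moreover have sound: "lat_derivable \<Sigma> (LMeet s t) s"
    if L: "lat_satisfies L (s, t) \<or> lat_satisfies L (t, s)" for s t
  proof (rule ccontr)
    assume "\<not> lat_derivable \<Sigma> (LMeet s t) s"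
    then obtain leq where wl: "lattice_preorder leq LJoin LMeet" and
      ext: "\<And>x y. lat_derivable \<Sigma> (LMeet x y) x \<Longrightarrow> leq x y" and
      max: "lattice_preorder.maximal_avoiding leq LJoin LMeet s t"
      using exists_maximal_lattice_preorder[OF lattice_preorder_derivable[of \<Sigma>], of s t] by blast
    have st: "\<not> leq s t" using max lattice_preorder.maximal_avoiding_def[OF wl] by blast
    have \<Sigma>: "leq (lterm_subst \<sigma> x) (lterm_subst \<sigma> y) \<and> leq (lterm_subst \<sigma> y) (lterm_subst \<sigma> x)"
      if "(x, y) \<in> \<Sigma>" for \<sigma> x y
      by (intro conjI ext derivable_le lat_derivable.hyp[OF that] lat_derivable.sym[OF lat_derivable.hyp[OF that]])
    have "leq u v \<and> leq v u" if "(u, v) \<in> I" for u v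
      by (rule maximal_satisfies[OF wl max \<open>0 < N\<close> \<Sigma>[unfolded \<Sigma>_def] that])
    then show False using st L unfolding I_def by blast
  qed
  moreover have "lat_derivable \<Sigma> s t" if "lat_satisfies L (s, t)" for s t
    by (rule derivable_antisym; rule sound) (simp_all add: that)
  ultimately show ?thesis
    unfolding has_finite_identity_basis_def by (intro exI[of _ \<Sigma>]) simp
qed

section \<open>Finite partition lattices satisfy only trivial identities\<close>

text \<open>Transitive closures are taken even in the intersection, so that the operations form a lattice preorder on all
relations and not just on the transitive ones.\<close>

definition rmeet :: "('x \<times> 'x) set \<Rightarrow> ('x \<times> 'x) set \<Rightarrow> ('x \<times> 'x) set" where
  "rmeet R S = R\<^sup>+ \<inter> S\<^sup>+"

definition rjoin :: "('x \<times> 'x) set \<Rightarrow> ('x \<times> 'x) set \<Rightarrow> ('x \<times> 'x) set" where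
  "rjoin R S = (R \<union> S)\<^sup>+"

lemma trans_rmeet: "trans (rmeet R S)" and trans_rjoin: "trans (rjoin R S)"
  by (auto simp: rmeet_def rjoin_def trans_Int)

lemma rmeet_trans: "trans R \<Longrightarrow> trans S \<Longrightarrow> rmeet R S = R \<inter> S"
  by (simp add: rmeet_def trancl_id)

lemma trancl_subset_trans: "R \<subseteq> T \<Longrightarrow> trans T \<Longrightarrow> R\<^sup>+ \<subseteq> T"
  by (metis trancl_id trancl_mono_subset)

lemma rjoin_subset: "R \<subseteq> T \<Longrightarrow> S \<subseteq> T \<Longrightarrow> trans T \<Longrightarrow> rjoin R S \<subseteq> T"
  unfolding rjoin_def by (rule trancl_subset_trans) auto

lemma rjoin_ub: "R \<subseteq> rjoin R S" "S \<subseteq> rjoin R S"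
  by (auto simp: rjoin_def)

lemma rjoin_map:
  assumes "\<And>x y. (x, y) \<in> R \<Longrightarrow> (f x, f y) \<in> R'" and "\<And>x y. (x, y) \<in> S \<Longrightarrow> (f x, f y) \<in> S'"
    and "(x, y) \<in> rjoin R S"
  shows "(f x, f y) \<in> rjoin R' S'"
proof -
  have step: "(f x, f y) \<in> R' \<union> S'" if "(x, y) \<in> R \<union> S" for x y using that assms(1,2) by blast
  show ?thesis
    using assms(3) unfolding rjoin_def
    by (induction rule: trancl_induct) (use step in \<open>meson r_into_trancl trancl_into_trancl\<close>)+
qed

lemma eval_relation_mono:
  assumes "\<And>n. \<psi> n \<subseteq> \<psi>' n"
  shows "eval rmeet rjoin \<psi> t \<subseteq> eval rmeet rjoin \<psi>' t"
proof (induction t)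
  case (LJoin s t)
  then show ?case unfolding eval.simps rmeet_def by (meson Int_mono trancl_mono_subset)
next
  case (LMeet s t)
  then show ?case unfolding eval.simps rjoin_def by (meson Un_mono trancl_mono_subset)
qed (use assms in simp)

text \<open>The order is reversed: larger equational theories belong to smaller varieties.\<close>

lemma lattice_preorder_relations: "lattice_preorder (\<lambda>R S. S\<^sup>+ \<subseteq> R\<^sup>+) rmeet rjoin"
proof
  fix R S T :: "('x \<times> 'x) set"
  have meet: "(rmeet R S)\<^sup>+ = rmeet R S" and join: "(rjoin R S)\<^sup>+ = rjoin R S" for R S :: "('x \<times> 'x) set"
    by (simp_all add: trancl_id trans_rmeet trans_rjoin)
  show "R\<^sup>+ \<subseteq> R\<^sup>+" ..
  show "(rmeet R S)\<^sup>+ \<subseteq> R\<^sup>+" "(rmeet R S)\<^sup>+ \<subseteq> S\<^sup>+" unfolding meet by (auto simp: rmeet_def)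
  show "R\<^sup>+ \<subseteq> (rjoin R S)\<^sup>+" "S\<^sup>+ \<subseteq> (rjoin R S)\<^sup>+"
    by (rule trancl_mono_subset, rule rjoin_ub)+
  show "T\<^sup>+ \<subseteq> R\<^sup>+ \<Longrightarrow> T\<^sup>+ \<subseteq> S\<^sup>+ \<Longrightarrow> T\<^sup>+ \<subseteq> (rmeet R S)\<^sup>+" unfolding meet by (auto simp: rmeet_def)
  show "R\<^sup>+ \<subseteq> T\<^sup>+ \<Longrightarrow> S\<^sup>+ \<subseteq> T\<^sup>+ \<Longrightarrow> (rjoin R S)\<^sup>+ \<subseteq> T\<^sup>+" unfolding join
    by (rule rjoin_subset) (auto intro: r_into_trancl)
  show "S\<^sup>+ \<subseteq> R\<^sup>+ \<Longrightarrow> T\<^sup>+ \<subseteq> S\<^sup>+ \<Longrightarrow> T\<^sup>+ \<subseteq> R\<^sup>+" by (rule subset_trans)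
qed

definition finite_partition :: "nat \<Rightarrow> (nat \<times> nat) set \<Rightarrow> bool" where
  "finite_partition k R \<longleftrightarrow> equiv UNIV R \<and> (\<forall>(p, q) \<in> R. p \<noteq> q \<longrightarrow> p < k \<and> q < k)"

definition kernel :: "nat \<Rightarrow> (nat \<Rightarrow> nat) \<Rightarrow> (nat \<times> nat) set" where
  "kernel k h = {(p, q). p = q \<or> p < k \<and> q < k \<and> h p = h q}"

lemma finite_partition_kernel: "finite_partition k (kernel k h)"
  by (auto simp: finite_partition_def kernel_def equiv_def refl_on_def sym_def trans_def)

lemma trans_kernel: "trans (kernel k h)"
  by (auto simp: kernel_def trans_def)

context lattice_preorder
begin

text \<open>A map from the lattice to the partitions of \<open>{..<k}\<close> that preserves meets, the partition assigned to \<open>w\<close> being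
the kernel of \<open>h w\<close>. Joins are only respected after adding points.\<close>

definition meet_family :: "nat \<Rightarrow> ('c \<Rightarrow> nat \<Rightarrow> nat) \<Rightarrow> bool" where
  "meet_family k h \<longleftrightarrow> (\<forall>w p. p < k \<longrightarrow> h w p < k) \<and>
     (\<forall>w w' p q. w \<preceq> w' \<longrightarrow> p < k \<longrightarrow> q < k \<longrightarrow> h w p = h w q \<longrightarrow> h w' p = h w' q) \<and>
     (\<forall>w w' p q. p < k \<longrightarrow> q < k \<longrightarrow> h w p = h w q \<longrightarrow> h w' p = h w' q \<longrightarrow>
        h (M w w') p = h (M w w') q)"

lemma le_M_iff: "x \<preceq> M w w' \<longleftrightarrow> x \<preceq> w \<and> x \<preceq> w'"
  by (meson M_greatest M_lb1 M_lb2 le_trans)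

text \<open>Given a pair in the partition of \<open>J x y\<close>, three new points are inserted on a path from \<open>i\<close> to \<open>j\<close> whose edges
belong alternately to \<open>x, y, x, y\<close>. A single new point would not do: an old point could be related to it
through \<open>i\<close> for one element and through \<open>j\<close> for another one, but not for their meet. This is the step
in Whitman's embedding of lattices into partition lattices, as simplified by Jonsson.\<close>

lemma meet_family_extend:
  assumes h: "meet_family k h" and ij: "i < k" "j < k" "h (J x y) i = h (J x y) j"
  shows "\<exists>h'. meet_family (k + 3) h' \<and> (\<forall>w. \<forall>p < k. h' w p = h w p) \<and>
     h' x i = h' x k \<and> h' y k = h' y (k + 1) \<and> h' x (k + 1) = h' x (k + 2) \<and> h' y (k + 2) = h' y j"
proof -
  \<comment> \<open>the numbers \<open>k, k + 1, k + 2\<close> also name the new classes, those containing none of the old points\<close>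
  define z1 where "z1 w = (if x \<preceq> w then h w i else k)" for w
  define z2 where "z2 w = (if y \<preceq> w then z1 w else k + 1)" for w
  define z3 where "z3 w = (if x \<preceq> w then z2 w else if y \<preceq> w then h w j else k + 2)" for w
  define h' where "h' w p = (if p < k then h w p else if p = k then z1 w
    else if p = k + 1 then z2 w else z3 w)" for w p
  have lt: "h w p < k" if "p < k" for w p using h that unfolding meet_family_def by blast
  have mono: "h w' p = h w' q" if "w \<preceq> w'" "p < k" "q < k" "h w p = h w q" for w w' p q
    using h that unfolding meet_family_def by blast
  have meet: "h (M w w') p = h (M w w') q" if "p < k" "q < k" "h w p = h w q" "h w' p = h w' q" for w w' p q
    using h that unfolding meet_family_def by blast
  have eq: "h w i = h w j" if "x \<preceq> w" "y \<preceq> w" for w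
    using mono[OF J_least[OF that] ij] .
  have ne: "h w p \<noteq> k" "k \<noteq> h w p" "h w p \<noteq> Suc k" "Suc k \<noteq> h w p" "h w p \<noteq> Suc (Suc k)" "Suc (Suc k) \<noteq> h w p"
    if "p < k" for w p using lt[OF that, of w] by auto
  have cases: "p < k \<or> p = k \<or> p = k + 1 \<or> p = k + 2" if "p < k + 3" for p using that by linarith
  have "h' w p < k + 3" if "p < k + 3" for w p
    using lt[of p w] lt[OF ij(1), of w] lt[OF ij(2), of w] that
    by (auto simp: h'_def z1_def z2_def z3_def)
  moreover have "h' w' p = h' w' q" if le: "w \<preceq> w'" and "p < k + 3" "q < k + 3" and e: "h' w p = h' w q" for w w' p q
  proof -
    have x: "x \<preceq> w \<longrightarrow> x \<preceq> w'" and y: "y \<preceq> w \<longrightarrow> y \<preceq> w'" using le le_trans by blast+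
    have m: "h w' p = h w' i" if "p < k" "h w p = h w i" for p using mono[OF le] that ij by blast
    have m': "h w' p = h w' j" if "p < k" "h w p = h w j" for p using mono[OF le] that ij by blast
    have E: "x \<preceq> w' \<and> y \<preceq> w' \<longrightarrow> h w' j = h w' i" using eq by simp
    have "h w p = z1 w \<longrightarrow> h w' p = z1 w'" "h w p = z2 w \<longrightarrow> h w' p = z2 w'"
      "h w p = z3 w \<longrightarrow> h w' p = z3 w'" if "p < k" for p
      unfolding z1_def z2_def z3_def using that x y E m[OF that] m'[OF that] ne[OF that]
      by (auto split: if_splits)
    moreover have "z1 w = z2 w \<longrightarrow> z1 w' = z2 w'" "z1 w = z3 w \<longrightarrow> z1 w' = z3 w'"
      "z2 w = z3 w \<longrightarrow> z2 w' = z3 w'"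
      unfolding z1_def z2_def z3_def using x y E m[OF ij(1)] m'[OF ij(1)] ne[OF ij(1)] ne[OF ij(2)]
      by (auto split: if_splits)
    ultimately show ?thesis
      using cases[OF that(2)] cases[OF that(3)] e mono[OF le, of p q]
      unfolding h'_def by (elim disjE) (simp_all; metis)+
  qed
  moreover have "h' (M w w') p = h' (M w w') q" if "p < k + 3" "q < k + 3" "h' w p = h' w q" "h' w' p = h' w' q" for w w' p q
  proof -
    let ?v = "M w w'"
    have E: "x \<preceq> w \<and> y \<preceq> w \<longrightarrow> h w j = h w i" for w using eq by simp
    have m: "h ?v p = h ?v i" if "p < k" "h w p = h w i" "h w' p = h w' i" for p using meet that ij by blast
    have m': "h ?v p = h ?v j" if "p < k" "h w p = h w j" "h w' p = h w' j" for p using meet that ij by blast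
    have "h w p = z1 w \<and> h w' p = z1 w' \<longrightarrow> h ?v p = z1 ?v" "h w p = z2 w \<and> h w' p = z2 w' \<longrightarrow> h ?v p = z2 ?v"
      "h w p = z3 w \<and> h w' p = z3 w' \<longrightarrow> h ?v p = z3 ?v" if "p < k" for p
      unfolding z1_def z2_def z3_def le_M_iff using that E[of w] E[of w'] m[OF that] m'[OF that] ne[OF that]
      by (auto split: if_splits)
    moreover have "z1 w = z2 w \<and> z1 w' = z2 w' \<longrightarrow> z1 ?v = z2 ?v" "z1 w = z3 w \<and> z1 w' = z3 w' \<longrightarrow> z1 ?v = z3 ?v"
      "z2 w = z3 w \<and> z2 w' = z3 w' \<longrightarrow> z2 ?v = z3 ?v"
      unfolding z1_def z2_def z3_def le_M_iff using E[of w] E[of w'] m[OF ij(1)] m'[OF ij(1)] ne[OF ij(1)] ne[OF ij(2)]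
      by (auto split: if_splits)
    ultimately show ?thesis
      using cases[OF that(1)] cases[OF that(2)] that(3,4) meet[of p q w w']
      unfolding h'_def by (elim disjE) (simp_all; metis)+
  qed
  ultimately have "meet_family (k + 3) h'" unfolding meet_family_def by blast
  moreover have "h' x i = h' x k" "h' y k = h' y (k + 1)" "h' x (k + 1) = h' x (k + 2)" "h' y (k + 2) = h' y j"
    using ij eq by (auto simp: h'_def z1_def z2_def z3_def)
  ultimately show ?thesis by (intro exI[of _ h']) (simp add: h'_def)
qed

lemma kernel_extend:
  assumes "\<And>p. p < k \<Longrightarrow> h' p = h p" and "k \<le> k'"
  shows "kernel k h \<subseteq> kernel k' h'"
  using assms by (auto simp: kernel_def)

definition extends :: "nat \<Rightarrow> ('c \<Rightarrow> nat \<Rightarrow> nat) \<Rightarrow> nat \<Rightarrow> ('c \<Rightarrow> nat \<Rightarrow> nat) \<Rightarrow> bool" where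
  "extends k h k' h' \<longleftrightarrow> k \<le> k' \<and> (\<forall>w. \<forall>p < k. h' w p = h w p)"

lemma extends_eval:
  assumes "extends k h k' h'"
  shows "eval rmeet rjoin (\<lambda>n. kernel k (h (\<phi> n))) t \<subseteq> eval rmeet rjoin (\<lambda>n. kernel k' (h' (\<phi> n))) t"
  by (intro eval_relation_mono kernel_extend) (use assms in \<open>auto simp: extends_def\<close>)

lemma extends_refl: "extends k h k h"
  and extends_trans: "extends k h k' h' \<Longrightarrow> extends k' h' k'' h'' \<Longrightarrow> extends k h k'' h''"
  by (auto simp: extends_def)

text \<open>Unravelling the term: an intersection asks for both relations and needs no new point, a join of relations is
realised by an inserted path, whose edges are treated recursively.\<close>

lemma realize_pair:
  assumes "meet_family k h" and "i < k" and "j < k" and "h (eval M J \<phi> t) i = h (eval M J \<phi> t) j"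
  shows "\<exists>k' h'. meet_family k' h' \<and> extends k h k' h' \<and>
    (i, j) \<in> eval rmeet rjoin (\<lambda>n. kernel k' (h' (\<phi> n))) t"
  using assms
proof (induction t arbitrary: k h i j)
  case (LVar n)
  then show ?case by (intro exI[of _ k] exI[of _ h]) (auto simp: kernel_def extends_refl)
next
  case (LJoin s t)
  have "h (eval M J \<phi> s) i = h (eval M J \<phi> s) j" "h (eval M J \<phi> t) i = h (eval M J \<phi> t) j"
    using LJoin.prems unfolding meet_family_def eval.simps by (meson M_lb1 M_lb2)+
  then obtain k1 h1 where 1: "meet_family k1 h1" "extends k h k1 h1"
    "(i, j) \<in> eval rmeet rjoin (\<lambda>n. kernel k1 (h1 (\<phi> n))) s"
    using LJoin.IH(1)[OF LJoin.prems(1-3)] by blast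
  have "i < k1" "j < k1" "h1 (eval M J \<phi> t) i = h1 (eval M J \<phi> t) j"
    using 1(2) LJoin.prems \<open>h (eval M J \<phi> t) i = _\<close> unfolding extends_def by auto
  then obtain k2 h2 where 2: "meet_family k2 h2" "extends k1 h1 k2 h2"
    "(i, j) \<in> eval rmeet rjoin (\<lambda>n. kernel k2 (h2 (\<phi> n))) t"
    using LJoin.IH(2)[OF 1(1)] by blast
  have "(i, j) \<in> eval rmeet rjoin (\<lambda>n. kernel k2 (h2 (\<phi> n))) s"
    using 1(3) extends_eval[OF 2(2)] by blast
  then have "(i, j) \<in> eval rmeet rjoin (\<lambda>n. kernel k2 (h2 (\<phi> n))) (LJoin s t)"
    using 2(3) by (auto simp: rmeet_def)
  then show ?case using 2(1) extends_trans[OF 1(2) 2(2)] by blast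
next
  case (LMeet s t)
  let ?x = "eval M J \<phi> s" and ?y = "eval M J \<phi> t"
  obtain h0 where h0: "meet_family (k + 3) h0" "\<forall>w. \<forall>p < k. h0 w p = h w p"
     "h0 ?x i = h0 ?x k" "h0 ?y k = h0 ?y (k + 1)" "h0 ?x (k + 1) = h0 ?x (k + 2)" "h0 ?y (k + 2) = h0 ?y j"
    using meet_family_extend[OF LMeet.prems(1-3), of ?x ?y] LMeet.prems(4) by auto
  have ext0: "extends k h (k + 3) h0" using h0(2) by (simp add: extends_def)
  have in0: "i < k + 3" "j < k + 3" using LMeet.prems by auto
  obtain k1 h1 where 1: "meet_family k1 h1" "extends (k + 3) h0 k1 h1"
    "(i, k) \<in> eval rmeet rjoin (\<lambda>n. kernel k1 (h1 (\<phi> n))) s"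
    using LMeet.IH(1)[OF h0(1), of i k] h0(3) in0 by auto
  have "k < k1" "k + 1 < k1" "h1 ?y k = h1 ?y (k + 1)"
    using 1(2) h0(4) unfolding extends_def by auto
  then obtain k2 h2 where 2: "meet_family k2 h2" "extends k1 h1 k2 h2"
    "(k, k + 1) \<in> eval rmeet rjoin (\<lambda>n. kernel k2 (h2 (\<phi> n))) t"
    using LMeet.IH(2)[OF 1(1)] by blast
  note ext2 = extends_trans[OF 1(2) 2(2)]
  have "k + 1 < k2" "k + 2 < k2" "h2 ?x (k + 1) = h2 ?x (k + 2)"
    using ext2 h0(5) unfolding extends_def by auto
  then obtain k3 h3 where 3: "meet_family k3 h3" "extends k2 h2 k3 h3"
    "(k + 1, k + 2) \<in> eval rmeet rjoin (\<lambda>n. kernel k3 (h3 (\<phi> n))) s"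
    using LMeet.IH(1)[OF 2(1)] by blast
  note ext3 = extends_trans[OF ext2 3(2)]
  have "k + 2 < k3" "j < k3" "h3 ?y (k + 2) = h3 ?y j"
    using ext3 h0(6) in0 unfolding extends_def by auto
  then obtain k4 h4 where 4: "meet_family k4 h4" "extends k3 h3 k4 h4"
    "(k + 2, j) \<in> eval rmeet rjoin (\<lambda>n. kernel k4 (h4 (\<phi> n))) t"
    using LMeet.IH(2)[OF 3(1)] by blast
  let ?s = "eval rmeet rjoin (\<lambda>n. kernel k4 (h4 (\<phi> n))) s" and ?t = "eval rmeet rjoin (\<lambda>n. kernel k4 (h4 (\<phi> n))) t"
  have "(i, k) \<in> ?s" "(k, k + 1) \<in> ?t" "(k + 1, k + 2) \<in> ?s" "(k + 2, j) \<in> ?t"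
    using 1(3) 2(3) 3(3) 4(3) extends_eval[OF extends_trans[OF 2(2) extends_trans[OF 3(2) 4(2)]]]
      extends_eval[OF extends_trans[OF 3(2) 4(2)]] extends_eval[OF 4(2)] by blast+
  then have "(i, j) \<in> (?s \<union> ?t)\<^sup>+"
    by (meson UnI1 UnI2 r_into_trancl trancl_into_trancl)
  then have "(i, j) \<in> eval rmeet rjoin (\<lambda>n. kernel k4 (h4 (\<phi> n))) (LMeet s t)"
    by (simp add: rjoin_def)
  then show ?case using 4(1) extends_trans[OF ext0 extends_trans[OF ext3 4(2)]] by blast
qed

lemma eval_kernel_subset:
  assumes "meet_family k h"
  shows "eval rmeet rjoin (\<lambda>n. kernel k (h (\<phi> n))) t \<subseteq> kernel k (h (eval M J \<phi> t))"
proof (induction t)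
  case (LJoin s t)
  let ?x = "eval M J \<phi> s" and ?y = "eval M J \<phi> t"
  have "eval rmeet rjoin (\<lambda>n. kernel k (h (\<phi> n))) (LJoin s t) \<subseteq> kernel k (h ?x) \<inter> kernel k (h ?y)"
    using LJoin unfolding eval.simps rmeet_def by (intro Int_mono trancl_subset_trans trans_kernel)
  also have "\<dots> \<subseteq> kernel k (h (M ?x ?y))"
    using assms unfolding kernel_def meet_family_def by blast
  finally show ?case by simp
next
  case (LMeet s t)
  let ?x = "eval M J \<phi> s" and ?y = "eval M J \<phi> t"
  have "kernel k (h w) \<subseteq> kernel k (h w')" if "w \<preceq> w'" for w w'
    using assms that unfolding kernel_def meet_family_def by blast
  then have "kernel k (h ?x) \<subseteq> kernel k (h (J ?x ?y))" "kernel k (h ?y) \<subseteq> kernel k (h (J ?x ?y))"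
    by blast+
  then show ?case using LMeet unfolding eval.simps by (intro rjoin_subset trans_kernel) auto
qed simp

text \<open>Two points related exactly above the value of \<open>s\<close> form a meet family. Realising this pair for \<open>s\<close> in an
extension does not relate it in \<open>t\<close>, because evaluation stays below the kernel of the value of \<open>t\<close>. The roles of the
two operations are exchanged between the lattice and the relations, as varieties are dual to theories.\<close>

lemma partition_countermodel:
  assumes "\<not> eval M J \<phi> s \<preceq> eval M J \<phi> t"
  shows "\<exists>k \<psi>. (\<forall>n. finite_partition k (\<psi> n)) \<and> eval rmeet rjoin \<psi> s \<noteq> eval rmeet rjoin \<psi> t"
proof -
  define h :: "'c \<Rightarrow> nat \<Rightarrow> nat" where "h w p = (if eval M J \<phi> s \<preceq> w then 0 else p)" for w p
  have "meet_family 2 h"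
    unfolding meet_family_def h_def by (auto simp: le_M_iff intro: le_trans)
  moreover have "h (eval M J \<phi> s) 0 = h (eval M J \<phi> s) 1" by (simp add: h_def)
  ultimately obtain k h' where h': "meet_family k h'" "extends 2 h k h'"
    "(0, 1) \<in> eval rmeet rjoin (\<lambda>n. kernel k (h' (\<phi> n))) s"
    using realize_pair[of 2 h 0 1 \<phi> s] by auto
  have "(0, 1) \<notin> kernel k (h' (eval M J \<phi> t))"
    using h'(2) assms by (simp add: kernel_def extends_def h_def)
  then have "(0, 1) \<notin> eval rmeet rjoin (\<lambda>n. kernel k (h' (\<phi> n))) t"
    using eval_kernel_subset[OF h'(1)] by blast
  then show ?thesis
    by (intro exI[of _ k] exI[of _ "\<lambda>n. kernel k (h' (\<phi> n))"]) (use h'(3) finite_partition_kernel in auto)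
qed

end

lemma partition_countermodel_of_lattice:
  fixes L :: "('b, 'c) gorder_scheme"
  assumes "lattice L" and "\<not> lat_satisfies L (s, t)"
  shows "\<exists>k \<psi>. (\<forall>n. finite_partition k (\<psi> n)) \<and> eval rmeet rjoin \<psi> s \<noteq> eval rmeet rjoin \<psi> t"
proof -
  interpret L: lattice L by (rule assms(1))
  obtain \<phi> where \<phi>: "\<And>n. \<phi> n \<in> carrier L" and ne: "lterm_value L \<phi> s \<noteq> lterm_value L \<phi> t"
    using assms(2) by (auto simp: lat_satisfies_def image_subset_iff)
  have cl: "lterm_value L \<phi> t \<in> carrier L" for t by (induction t) (use \<phi> in auto)
  have "lattice_preorder (\<lambda>s t. lterm_value L \<phi> s \<sqsubseteq>\<^bsub>L\<^esub> lterm_value L \<phi> t) LJoin LMeet"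
    by unfold_locales (auto intro: cl L.le_trans L.join_left L.join_right L.join_le L.meet_left L.meet_right L.meet_le)
  then have dual: "lattice_preorder (\<lambda>s t. lterm_value L \<phi> t \<sqsubseteq>\<^bsub>L\<^esub> lterm_value L \<phi> s) LMeet LJoin"
    by (rule lattice_preorder.dual)
  have "\<not> lterm_value L \<phi> t \<sqsubseteq>\<^bsub>L\<^esub> lterm_value L \<phi> s \<or> \<not> lterm_value L \<phi> s \<sqsubseteq>\<^bsub>L\<^esub> lterm_value L \<phi> t"
    using ne L.le_antisym cl by blast
  then show ?thesis
    using lattice_preorder.partition_countermodel[OF dual, of LVar, unfolded eval_LVar] by metis
qed

section \<open>Theories of overcommutative varieties\<close>

definition word_subst :: "(nat \<Rightarrow> nat list) \<Rightarrow> nat list \<Rightarrow> nat list" where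
  "word_subst \<phi> w = concat (map \<phi> w)"

definition fully_invariant :: "(nat list \<times> nat list) set \<Rightarrow> bool" where
  "fully_invariant \<rho> \<longleftrightarrow> equiv {w. w \<noteq> []} \<rho> \<and>
     (\<forall>u v a b. (u, v) \<in> \<rho> \<longrightarrow> (a @ u @ b, a @ v @ b) \<in> \<rho>) \<and>
     (\<forall>u v \<phi>. (u, v) \<in> \<rho> \<longrightarrow> (\<forall>n. \<phi> n \<noteq> []) \<longrightarrow> (word_subst \<phi> u, word_subst \<phi> v) \<in> \<rho>)"

lemma word_subst_simps [simp]: "word_subst \<phi> [] = []" "word_subst \<phi> (i # w) = \<phi> i @ word_subst \<phi> w"
  "word_subst \<phi> (u @ v) = word_subst \<phi> u @ word_subst \<phi> v"
  by (auto simp: word_subst_def)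

lemma word_subst_eq_Nil [simp]: "(\<And>n. \<phi> n \<noteq> []) \<Longrightarrow> word_subst \<phi> w = [] \<longleftrightarrow> w = []"
  by (cases w) auto

lemma word_subst_single: "word_subst (\<lambda>i. [f i]) w = map f w"
  by (induction w) auto

lemma fully_invariantD:
  assumes "fully_invariant \<rho>"
  shows "(u, v) \<in> \<rho> \<Longrightarrow> u \<noteq> [] \<and> v \<noteq> []" and "u \<noteq> [] \<Longrightarrow> (u, u) \<in> \<rho>"
    and "(u, v) \<in> \<rho> \<Longrightarrow> (v, u) \<in> \<rho>" and "(u, v) \<in> \<rho> \<Longrightarrow> (v, w) \<in> \<rho> \<Longrightarrow> (u, w) \<in> \<rho>"
    and "(u, v) \<in> \<rho> \<Longrightarrow> (a @ u @ b, a @ v @ b) \<in> \<rho>"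
    and "(u, v) \<in> \<rho> \<Longrightarrow> (\<And>n. \<phi> n \<noteq> []) \<Longrightarrow> (word_subst \<phi> u, word_subst \<phi> v) \<in> \<rho>"
    and "trans \<rho>"
proof -
  have eq: "equiv {w. w \<noteq> []} \<rho>"
    and cong: "\<forall>u v a b. (u, v) \<in> \<rho> \<longrightarrow> (a @ u @ b, a @ v @ b) \<in> \<rho>"
    and subst: "\<forall>u v \<phi>. (u, v) \<in> \<rho> \<longrightarrow> (\<forall>n. \<phi> n \<noteq> []) \<longrightarrow> (word_subst \<phi> u, word_subst \<phi> v) \<in> \<rho>"
    using assms by (simp_all add: fully_invariant_def)
  show "(u, v) \<in> \<rho> \<Longrightarrow> u \<noteq> [] \<and> v \<noteq> []" using eq by (auto simp: equiv_def)
  show "u \<noteq> [] \<Longrightarrow> (u, u) \<in> \<rho>" using eq by (auto simp: equiv_def refl_on_def)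
  show "(u, v) \<in> \<rho> \<Longrightarrow> (v, u) \<in> \<rho>" using eq by (auto simp: equiv_def dest: symD)
  show "trans \<rho>" using eq by (simp add: equiv_def)
  then show "(u, v) \<in> \<rho> \<Longrightarrow> (v, w) \<in> \<rho> \<Longrightarrow> (u, w) \<in> \<rho>" by (rule transD)
  show "(u, v) \<in> \<rho> \<Longrightarrow> (a @ u @ b, a @ v @ b) \<in> \<rho>" using cong by simp
  show "(u, v) \<in> \<rho> \<Longrightarrow> (\<And>n. \<phi> n \<noteq> []) \<Longrightarrow> (word_subst \<phi> u, word_subst \<phi> v) \<in> \<rho>"
    using subst by simp
qed

lemma fully_invariantI:
  assumes "\<And>u v. (u, v) \<in> \<rho> \<Longrightarrow> u \<noteq> [] \<and> v \<noteq> []" and "\<And>u. u \<noteq> [] \<Longrightarrow> (u, u) \<in> \<rho>"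
    and "\<And>u v. (u, v) \<in> \<rho> \<Longrightarrow> (v, u) \<in> \<rho>" and "\<And>u v w. (u, v) \<in> \<rho> \<Longrightarrow> (v, w) \<in> \<rho> \<Longrightarrow> (u, w) \<in> \<rho>"
    and "\<And>u v a b. (u, v) \<in> \<rho> \<Longrightarrow> (a @ u @ b, a @ v @ b) \<in> \<rho>"
    and "\<And>u v \<phi>. (u, v) \<in> \<rho> \<Longrightarrow> (\<And>n. \<phi> n \<noteq> []) \<Longrightarrow> (word_subst \<phi> u, word_subst \<phi> v) \<in> \<rho>"
  shows "fully_invariant \<rho>"
  unfolding fully_invariant_def
proof (intro conjI allI impI equivI)
  show "\<rho> \<subseteq> {w. w \<noteq> []} \<times> {w. w \<noteq> []}" using assms(1) by auto
  show "refl_on {w. w \<noteq> []} \<rho>" using assms(2) by (auto simp: refl_on_def)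
  show "sym \<rho>" using assms(3) by (rule symI)
  show "trans \<rho>" using assms(4) by (rule transI)
qed (use assms(5,6) in blast)+

definition balanced :: "(nat list \<times> nat list) set" where
  "balanced = {(u, v). u \<noteq> [] \<and> v \<noteq> [] \<and> mset u = mset v}"

definition theory_of :: "'a sgrp set \<Rightarrow> (nat list \<times> nat list) set" where
  "theory_of W = {(u, v). u \<noteq> [] \<and> v \<noteq> [] \<and> (\<forall>S \<in> W. sgrp_satisfies S (u, v))}"

lemma word_value_Cons: "w \<noteq> [] \<Longrightarrow> word_value S \<phi> (i # w) = sgmult S (\<phi> i) (word_value S \<phi> w)"
  by (cases w) auto

lemma word_value_closed:
  assumes "is_sgrp S" and "range \<phi> \<subseteq> carrier S" and "w \<noteq> []"
  shows "word_value S \<phi> w \<in> carrier S"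
  using assms(3)
proof (induction w)
  case (Cons i w)
  then show ?case using assms(1,2) by (cases "w = []") (auto simp: word_value_Cons is_sgrp_def)
qed simp

lemma word_value_append:
  assumes "is_sgrp S" and "range \<phi> \<subseteq> carrier S" and "u \<noteq> []" and "v \<noteq> []"
  shows "word_value S \<phi> (u @ v) = sgmult S (word_value S \<phi> u) (word_value S \<phi> v)"
  using assms(3)
proof (induction u)
  case (Cons i u)
  have i: "\<phi> i \<in> carrier S" using assms(2) by auto
  show ?case
  proof (cases "u = []")
    case False
    then show ?thesis using Cons.IH i assms(1,4) word_value_closed[OF assms(1,2)]
      by (simp add: word_value_Cons is_sgrp_def)
  qed (use assms(4) in \<open>simp add: word_value_Cons\<close>)
qed simp

lemma word_value_subst:
  assumes "is_sgrp S" and "range \<phi> \<subseteq> carrier S" and "\<And>n. \<psi> n \<noteq> []" and "w \<noteq> []"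
  shows "word_value S \<phi> (word_subst \<psi> w) = word_value S (\<lambda>i. word_value S \<phi> (\<psi> i)) w"
  using assms(4)
proof (induction w)
  case (Cons i w)
  then show ?case
    by (cases "w = []") (simp_all add: word_value_Cons word_value_append[OF assms(1,2)] assms(3))
qed simp

lemma fully_invariant_theory_of:
  assumes "\<And>S. S \<in> W \<Longrightarrow> is_sgrp S"
  shows "fully_invariant (theory_of W)"
proof (rule fully_invariantI)
  fix u v a b :: "nat list"
  assume uv: "(u, v) \<in> theory_of W"
  have "word_value S \<phi> (a @ u @ b) = word_value S \<phi> (a @ v @ b)"
    if S: "S \<in> W" and \<phi>: "range \<phi> \<subseteq> carrier S" for S \<phi>
  proof -
    note app = word_value_append[OF assms[OF S] \<phi>]
    have "word_value S \<phi> u = word_value S \<phi> v" and "u \<noteq> []" "v \<noteq> []"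
      using uv S \<phi> by (auto simp: theory_of_def sgrp_satisfies_def)
    then show ?thesis by (cases "a = []"; cases "b = []") (simp_all add: app)
  qed
  then show "(a @ u @ b, a @ v @ b) \<in> theory_of W"
    using uv by (auto simp: theory_of_def sgrp_satisfies_def)
next
  fix u v and \<psi> :: "nat \<Rightarrow> nat list"
  assume uv: "(u, v) \<in> theory_of W" and \<psi>: "\<And>n. \<psi> n \<noteq> []"
  have "word_value S \<phi> (word_subst \<psi> u) = word_value S \<phi> (word_subst \<psi> v)"
    if S: "S \<in> W" and \<phi>: "range \<phi> \<subseteq> carrier S" for S \<phi>
  proof -
    have "range (\<lambda>i. word_value S \<phi> (\<psi> i)) \<subseteq> carrier S"
      using word_value_closed[OF assms[OF S] \<phi> \<psi>] by auto
    then show ?thesis using uv S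
      by (auto simp: theory_of_def sgrp_satisfies_def word_value_subst[OF assms[OF S] \<phi> \<psi>])
  qed
  then show "(word_subst \<psi> u, word_subst \<psi> v) \<in> theory_of W"
    using uv \<psi> by (auto simp: theory_of_def sgrp_satisfies_def)
qed (auto simp: theory_of_def sgrp_satisfies_def)

text \<open>The relatively free semigroup on countably many letters is countable, so it has a copy inside the infinite
type \<open>'a\<close>; the classes are coded by representatives.\<close>

lemma theory_of_models:
  assumes inf: "infinite (UNIV :: 'a set)" and \<rho>: "fully_invariant \<rho>"
  shows "theory_of (sgrp_models \<rho> :: 'a sgrp set) = \<rho>"
proof
  note D = fully_invariantD[OF \<rho>]
  show "\<rho> \<subseteq> theory_of (sgrp_models \<rho> :: 'a sgrp set)"
    using D(1) by (auto simp: theory_of_def sgrp_models_def)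
  obtain \<iota> :: "nat \<Rightarrow> 'a" where \<iota>: "inj \<iota>" using infinite_countable_subset[OF inf] by blast
  define rep where "rep u = (SOME v. (u, v) \<in> \<rho>)" for u
  have rep: "(u, rep u) \<in> \<rho>" if "u \<noteq> []" for u
    unfolding rep_def by (rule someI[of "\<lambda>v. (u, v) \<in> \<rho>"]) (rule D(2)[OF that])
  have rep_eq: "rep u = rep v" if "(u, v) \<in> \<rho>" for u v
  proof -
    have "(\<lambda>w. (u, w) \<in> \<rho>) = (\<lambda>w. (v, w) \<in> \<rho>)" using that D(3,4) by blast
    then show ?thesis unfolding rep_def by simp
  qed
  define code where "code u = \<iota> (list_encode (rep u))" for u
  have code: "code u = code v \<longleftrightarrow> (u, v) \<in> \<rho>" if "u \<noteq> []" "v \<noteq> []" for u v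
    using rep[OF that(1)] rep[OF that(2)] rep_eq D(3,4)
    unfolding code_def by (metis \<iota> injD list_encode_eq)
  define dec where "dec x = (SOME u. u \<noteq> [] \<and> code u = x)" for x
  have dec: "dec (code u) \<noteq> [] \<and> code (dec (code u)) = code u" if "u \<noteq> []" for u
    unfolding dec_def by (rule someI[of "\<lambda>v. v \<noteq> [] \<and> code v = code u"]) (use that in simp)
  define F :: "'a sgrp" where "F = \<lparr>carrier = code ` {u. u \<noteq> []}, sgmult = (\<lambda>x y. code (dec x @ dec y))\<rparr>"
  have mult: "sgmult F (code u) (code v) = code (u @ v)" if uv: "u \<noteq> []" "v \<noteq> []" for u v
  proof -
    have u: "(dec (code u), u) \<in> \<rho>" and v: "(dec (code v), v) \<in> \<rho>"
      using dec[OF uv(1)] dec[OF uv(2)] code uv by blast+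
    have "(dec (code u) @ dec (code v), u @ v) \<in> \<rho>"
      using D(4)[OF D(5)[OF u, of "[]" "dec (code v)"]] D(5)[OF v, of u "[]"] by simp
    then show ?thesis using dec[OF uv(1)] dec[OF uv(2)] code[of "dec (code u) @ dec (code v)" "u @ v"] uv
      by (simp add: F_def)
  qed
  have F: "is_sgrp F"
    unfolding is_sgrp_def
  proof (intro conjI ballI)
    show "carrier F \<noteq> {}" by (auto simp: F_def)
    fix x y assume "x \<in> carrier F" "y \<in> carrier F"
    then obtain u v where uv: "x = code u" "y = code v" "u \<noteq> []" "v \<noteq> []" by (auto simp: F_def)
    then show "sgmult F x y \<in> carrier F" using mult by (auto simp: F_def)
    fix z assume "z \<in> carrier F"
    then obtain w where "z = code w" "w \<noteq> []" by (auto simp: F_def)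
    then show "sgmult F (sgmult F x y) z = sgmult F x (sgmult F y z)" using uv by (simp add: mult)
  qed
  have val: "word_value F (\<lambda>i. code (\<psi> i)) w = code (word_subst \<psi> w)"
    if "\<And>n. \<psi> n \<noteq> []" "w \<noteq> []" for \<psi> w
    using that(2)
  proof (induction w)
    case (Cons i w)
    then show ?case using that(1) by (cases "w = []") (auto simp: word_value_Cons mult)
  qed simp
  have "F \<in> sgrp_models \<rho>"
    unfolding sgrp_models_def sgrp_satisfies_def
  proof (clarsimp simp: F)
    fix u v and \<phi> :: "nat \<Rightarrow> 'a"
    assume uv: "(u, v) \<in> \<rho>" and \<phi>: "range \<phi> \<subseteq> carrier F"
    have "\<exists>w. w \<noteq> [] \<and> \<phi> n = code w" for n using \<phi> by (auto simp: F_def)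
    then obtain \<psi> where \<psi>: "\<And>n. \<psi> n \<noteq> []" "\<And>n. \<phi> n = code (\<psi> n)" by metis
    then have "\<phi> = (\<lambda>n. code (\<psi> n))" by auto
    then show "word_value F \<phi> u = word_value F \<phi> v"
      using val[OF \<psi>(1)] D(1)[OF uv] D(6)[OF uv \<psi>(1)] code \<psi>(1) by simp
  qed
  then show "theory_of (sgrp_models \<rho> :: 'a sgrp set) \<subseteq> \<rho>"
  proof (intro subsetI, clarify)
    fix u v assume uv: "(u, v) \<in> theory_of (sgrp_models \<rho> :: 'a sgrp set)" and F': "F \<in> sgrp_models \<rho>"
    have "range (\<lambda>i. code [i]) \<subseteq> carrier F" by (auto simp: F_def)
    then have "word_value F (\<lambda>i. code [i]) u = word_value F (\<lambda>i. code [i]) v"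
      using uv F' unfolding theory_of_def sgrp_satisfies_def by simp
    then show "(u, v) \<in> \<rho>"
      using uv val[of "\<lambda>i. [i]"] code by (auto simp: theory_of_def word_subst_single)
  qed
qed

text \<open>Letters are counted in a copy of the additive semigroup of the natural numbers.\<close>

lemma theory_of_overcommutative:
  assumes inf: "infinite (UNIV :: 'a set)" and "(COM :: 'a sgrp set) \<subseteq> W"
  shows "theory_of W \<subseteq> balanced"
proof (clarify)
  fix u v assume uv: "(u, v) \<in> theory_of W"
  obtain \<iota> :: "nat \<Rightarrow> 'a" where \<iota>: "inj \<iota>" using infinite_countable_subset[OF inf] by blast
  define S :: "'a sgrp" where "S = \<lparr>carrier = range \<iota>, sgmult = (\<lambda>x y. \<iota> (inv \<iota> x + inv \<iota> y))\<rparr>"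
  have "S \<in> COM"
    by (auto simp: COM_def is_sgrp_def S_def inv_f_f[OF \<iota>] ac_simps)
  have val: "word_value S (\<lambda>i. \<iota> (f i)) w = \<iota> (sum_list (map f w))" if "w \<noteq> []" for f w
    using that
  proof (induction w)
    case (Cons i w)
    then show ?case by (cases "w = []") (auto simp: word_value_Cons S_def inv_f_f[OF \<iota>])
  qed simp
  have count: "sum_list (map (\<lambda>i. if i = x then 1 else 0) w) = count (mset w) x" for x w
    by (induction w) auto
  have "count (mset u) x = count (mset v) x" for x
  proof -
    let ?f = "\<lambda>i. if i = x then 1 else 0"
    have "range (\<lambda>i. \<iota> (?f i)) \<subseteq> carrier S" by (auto simp: S_def)
    then have "word_value S (\<lambda>i. \<iota> (?f i)) u = word_value S (\<lambda>i. \<iota> (?f i)) v"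
      using uv subsetD[OF assms(2) \<open>S \<in> COM\<close>] unfolding theory_of_def sgrp_satisfies_def by auto
    then show ?thesis using uv val \<iota> unfolding theory_of_def by (auto dest: injD simp: count)
  qed
  then show "(u, v) \<in> balanced" using uv by (auto simp: theory_of_def balanced_def intro: multiset_eqI)
qed

lemma COM_word_value:
  assumes "S \<in> COM" and "range \<phi> \<subseteq> carrier S" and "mset u = mset v" and "u \<noteq> []"
  shows "word_value S \<phi> u = word_value S \<phi> v"
  using assms(3,4)
proof (induction u arbitrary: v)
  case (Cons x u)
  have S: "is_sgrp S" and comm: "\<And>a b. a \<in> carrier S \<Longrightarrow> b \<in> carrier S \<Longrightarrow> sgmult S a b = sgmult S b a"
    using assms(1) by (auto simp: COM_def)
  note app = word_value_append[OF S assms(2)] and cl = word_value_closed[OF S assms(2)]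
  have "x \<in> set v" using Cons.prems(1) by (metis list.set_intros(1) mset_eq_setD)
  then obtain v1 v2 where v: "v = v1 @ x # v2" by (meson split_list)
  have front: "word_value S \<phi> (v1 @ x # v2) = word_value S \<phi> (x # v1 @ v2)"
  proof (cases "v1 = []")
    case False
    have "word_value S \<phi> (v1 @ [x]) = word_value S \<phi> ([x] @ v1)"
      using app[OF False, of "[x]"] app[of "[x]" v1] False comm[OF cl[OF False] cl[of "[x]"]] by simp
    then show ?thesis
      using app[of "v1 @ [x]" v2] app[of "[x] @ v1" v2] by (cases "v2 = []") auto
  qed simp
  have "mset u = mset (v1 @ v2)" using Cons.prems(1) v by simp
  then have "u = [] \<and> v1 @ v2 = [] \<or> u \<noteq> [] \<and> v1 @ v2 \<noteq> [] \<and> word_value S \<phi> u = word_value S \<phi> (v1 @ v2)"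
    using Cons.IH by (metis mset_zero_iff)
  then show ?case unfolding v front by (auto simp: word_value_Cons)
qed simp

lemma overcommutative_variety: "overcommutative X \<Longrightarrow> sgrp_variety X"
  by (simp add: overcommutative_def)

lemma variety_is_sgrp: "sgrp_variety X \<Longrightarrow> S \<in> X \<Longrightarrow> is_sgrp S"
  unfolding sgrp_variety_def sgrp_models_def by blast

lemma models_theory_of:
  fixes X :: "'a sgrp set"
  assumes "sgrp_variety X" shows "sgrp_models (theory_of X) = X"
proof -
  obtain \<Gamma> where \<Gamma>: "\<Gamma> \<subseteq> sgrp_identities" and X: "X = sgrp_models \<Gamma>"
    using assms unfolding sgrp_variety_def by blast
  have sat: "sgrp_satisfies S e" if "S \<in> X" "e \<in> \<Gamma>" for S e
    using that unfolding X sgrp_models_def by blast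
  have sg: "is_sgrp S" if "S \<in> X" for S
    using that unfolding X sgrp_models_def by blast
  have th: "e \<in> theory_of X" if "e \<in> \<Gamma>" for e
  proof -
    obtain u v where e: "e = (u, v)" by (cases e)
    have "u \<noteq> [] \<and> v \<noteq> []" using that \<Gamma> e by (auto simp: sgrp_identities_def)
    then show ?thesis using sat[OF _ that] unfolding e theory_of_def by simp
  qed
  show ?thesis
  proof (intro subset_antisym subsetI)
    fix S :: "'a sgrp" assume S: "S \<in> sgrp_models (theory_of X)"
    have "is_sgrp S" using S unfolding sgrp_models_def by simp
    moreover have "sgrp_satisfies S e" if "e \<in> \<Gamma>" for e
      using S th[OF that] unfolding sgrp_models_def by simp
    ultimately show "S \<in> X" unfolding X sgrp_models_def by simp
  next
    fix S assume S: "S \<in> X"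
    have "sgrp_satisfies S e" if "e \<in> theory_of X" for e
      using that S by (cases e) (simp add: theory_of_def)
    then show "S \<in> sgrp_models (theory_of X)" using sg[OF S] unfolding sgrp_models_def by simp
  qed
qed

lemma theory_of_antitone: "X \<subseteq> Y \<Longrightarrow> theory_of Y \<subseteq> theory_of X"
  by (auto simp: theory_of_def)

lemma fully_invariant_Int:
  assumes R: "fully_invariant R" and S: "fully_invariant S"
  shows "fully_invariant (R \<inter> S)"
proof (rule fully_invariantI; (elim IntE)?)
  note D = fully_invariantD[OF R] and E = fully_invariantD[OF S]
  fix u v
  show "(u, u) \<in> R \<inter> S" if "u \<noteq> []" using D(2) E(2) that by simp
  assume uv: "(u, v) \<in> R" "(u, v) \<in> S"
  show "u \<noteq> [] \<and> v \<noteq> []" using D(1) uv by simp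
  show "(v, u) \<in> R \<inter> S" using D(3) E(3) uv by simp
  show "(u, w) \<in> R \<inter> S" if "(v, w) \<in> R" "(v, w) \<in> S" for w using D(4) E(4) uv that by blast
  show "(a @ u @ b, a @ v @ b) \<in> R \<inter> S" for a b using D(5) E(5) uv by simp
  show "(word_subst \<phi> u, word_subst \<phi> v) \<in> R \<inter> S" if "\<And>n. \<phi> n \<noteq> []" for \<phi>
    using D(6)[OF uv(1) that] E(6)[OF uv(2) that] by simp
qed

lemma fully_invariant_rjoin:
  assumes R: "fully_invariant R" and S: "fully_invariant S"
  shows "fully_invariant (rjoin R S)"
proof (rule fully_invariantI)
  note D = fully_invariantD[OF R] and E = fully_invariantD[OF S]
  fix u v w a b :: "nat list"
  have "rjoin R S \<subseteq> {w. w \<noteq> []} \<times> {w. w \<noteq> []}"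
    by (rule rjoin_subset) (use D(1) E(1) in \<open>auto simp: trans_def\<close>)
  then show "u \<noteq> [] \<and> v \<noteq> []" if "(u, v) \<in> rjoin R S" using that by auto
  have "sym (R \<union> S)" using D(3) E(3) by (auto simp: sym_def)
  then show "(v, u) \<in> rjoin R S" if "(u, v) \<in> rjoin R S"
    using that unfolding rjoin_def by (meson sym_trancl symD)
  show "(a @ u @ b, a @ v @ b) \<in> rjoin R S" if "(u, v) \<in> rjoin R S"
    using rjoin_map[of R "\<lambda>u. a @ u @ b" R S S, OF D(5) E(5) that] .
  show "(word_subst \<phi> u, word_subst \<phi> v) \<in> rjoin R S" if "(u, v) \<in> rjoin R S" "\<And>n. \<phi> n \<noteq> []" for \<phi>
    using rjoin_map[of R "word_subst \<phi>" R S S, OF D(6)[OF _ that(2)] E(6)[OF _ that(2)] that(1)] .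
  show "(u, u) \<in> rjoin R S" if "u \<noteq> []"
    using D(2)[OF that] rjoin_ub(1) by blast
  show "(u, w) \<in> rjoin R S" if "(u, v) \<in> rjoin R S" "(v, w) \<in> rjoin R S"
    using that trans_rjoin by (metis transD)
qed

lemma trans_balanced: "trans balanced"
  by (auto simp: balanced_def trans_def)

context
  fixes V :: "'a sgrp set"
  assumes inf: "infinite (UNIV :: 'a set)" and V: "overcommutative V"
begin

lemma carrier_theory:
  assumes "X \<in> carrier (L_OC V)"
  shows "fully_invariant (theory_of X)" and "theory_of V \<subseteq> theory_of X" and "theory_of X \<subseteq> balanced"
    and "sgrp_models (theory_of X) = X"
proof -
  have X: "overcommutative X" "X \<subseteq> V" using assms by (auto simp: L_OC_def)
  show "fully_invariant (theory_of X)"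
    by (rule fully_invariant_theory_of)
      (rule variety_is_sgrp[OF overcommutative_variety[OF X(1)]])
  show "theory_of V \<subseteq> theory_of X" using X(2) by (auto simp: theory_of_def)
  show "theory_of X \<subseteq> balanced"
    using theory_of_overcommutative[OF inf] X(1) by (simp add: overcommutative_def)
  show "sgrp_models (theory_of X) = X" by (rule models_theory_of[OF overcommutative_variety[OF X(1)]])
qed

lemma models_carrier:
  assumes "fully_invariant \<sigma>" and "theory_of V \<subseteq> \<sigma>" and "\<sigma> \<subseteq> balanced"
  shows "sgrp_models \<sigma> \<in> carrier (L_OC V)"
proof -
  have "sgrp_models \<sigma> \<subseteq> (sgrp_models (theory_of V) :: 'a sgrp set)"
    using assms(2) by (auto simp: sgrp_models_def)
  then have "sgrp_models \<sigma> \<subseteq> V" using models_theory_of[OF overcommutative_variety[OF V]] by simp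
  moreover have "sgrp_variety (sgrp_models \<sigma> :: 'a sgrp set)"
    unfolding sgrp_variety_def sgrp_identities_def
    by (rule exI[of _ \<sigma>]) (use assms(3) in \<open>auto simp: balanced_def\<close>)
  moreover have "S \<in> sgrp_models \<sigma>" if S: "S \<in> COM" for S :: "'a sgrp"
  proof -
    have "is_sgrp S" using S by (simp add: COM_def)
    moreover have "sgrp_satisfies S e" if "e \<in> \<sigma>" for e
    proof -
      obtain u v where e: "e = (u, v)" by (cases e)
      then have "u \<noteq> []" "mset u = mset v" using that assms(3) by (auto simp: balanced_def)
      then show ?thesis using COM_word_value[OF S] unfolding sgrp_satisfies_def e by simp
    qed
    ultimately show ?thesis by (simp add: sgrp_models_def)
  qed
  ultimately show ?thesis unfolding L_OC_def overcommutative_def by (simp add: subset_iff)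
qed

lemma theory_join:
  assumes X: "X \<in> carrier (L_OC V)" and Y: "Y \<in> carrier (L_OC V)"
  shows "X \<squnion>\<^bsub>L_OC V\<^esub> Y \<in> carrier (L_OC V)"
    and "theory_of (X \<squnion>\<^bsub>L_OC V\<^esub> Y) = rmeet (theory_of X) (theory_of Y)"
proof -
  interpret L: lattice "L_OC V" by (rule lattice_L_OC[OF overcommutative_variety[OF V]])
  show cl: "X \<squnion>\<^bsub>L_OC V\<^esub> Y \<in> carrier (L_OC V)" using X Y by simp
  let ?\<sigma> = "theory_of X \<inter> theory_of Y"
  have "fully_invariant ?\<sigma>"
    by (intro fully_invariant_Int carrier_theory X Y)
  moreover have "theory_of V \<subseteq> ?\<sigma>" "?\<sigma> \<subseteq> balanced" using carrier_theory[OF X] carrier_theory[OF Y] by auto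
  ultimately have Z: "sgrp_models ?\<sigma> \<in> carrier (L_OC V)" and th: "theory_of (sgrp_models ?\<sigma> :: 'a sgrp set) = ?\<sigma>"
    using models_carrier theory_of_models[OF inf] by blast+
  have "X \<subseteq> sgrp_models ?\<sigma>" "Y \<subseteq> sgrp_models ?\<sigma>"
    using carrier_theory(4)[OF X] carrier_theory(4)[OF Y] unfolding sgrp_models_def by blast+
  then have "X \<squnion>\<^bsub>L_OC V\<^esub> Y \<subseteq> sgrp_models ?\<sigma>"
    using L.join_le[OF _ _ X Y Z] by (simp add: L_OC_def)
  then have "?\<sigma> \<subseteq> theory_of (X \<squnion>\<^bsub>L_OC V\<^esub> Y)" using theory_of_antitone th by blast
  moreover have "X \<subseteq> X \<squnion>\<^bsub>L_OC V\<^esub> Y" "Y \<subseteq> X \<squnion>\<^bsub>L_OC V\<^esub> Y"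
    using L.join_left[OF X Y] L.join_right[OF X Y] by (simp_all add: L_OC_def)
  then have "theory_of (X \<squnion>\<^bsub>L_OC V\<^esub> Y) \<subseteq> ?\<sigma>" using theory_of_antitone by blast
  ultimately show "theory_of (X \<squnion>\<^bsub>L_OC V\<^esub> Y) = rmeet (theory_of X) (theory_of Y)"
    using rmeet_trans fully_invariantD(7) carrier_theory(1) X Y by blast
qed

lemma theory_meet:
  assumes X: "X \<in> carrier (L_OC V)" and Y: "Y \<in> carrier (L_OC V)"
  shows "X \<sqinter>\<^bsub>L_OC V\<^esub> Y \<in> carrier (L_OC V)"
    and "theory_of (X \<sqinter>\<^bsub>L_OC V\<^esub> Y) = rjoin (theory_of X) (theory_of Y)"
proof -
  interpret L: lattice "L_OC V" by (rule lattice_L_OC[OF overcommutative_variety[OF V]])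
  show cl: "X \<sqinter>\<^bsub>L_OC V\<^esub> Y \<in> carrier (L_OC V)" using X Y by simp
  let ?\<sigma> = "rjoin (theory_of X) (theory_of Y)"
  have "fully_invariant ?\<sigma>"
    using carrier_theory(1) X Y by (blast intro: fully_invariant_rjoin)
  moreover have "theory_of V \<subseteq> ?\<sigma>" using carrier_theory(2)[OF X] rjoin_ub(1) by blast
  moreover have "?\<sigma> \<subseteq> balanced" using carrier_theory(3)[OF X] carrier_theory(3)[OF Y]
    by (intro rjoin_subset trans_balanced)
  ultimately have Z: "sgrp_models ?\<sigma> \<in> carrier (L_OC V)" and th: "theory_of (sgrp_models ?\<sigma> :: 'a sgrp set) = ?\<sigma>"
    using models_carrier theory_of_models[OF inf] by blast+
  have "sgrp_models ?\<sigma> \<subseteq> X" "sgrp_models ?\<sigma> \<subseteq> Y"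
    using carrier_theory(4)[OF X] carrier_theory(4)[OF Y] rjoin_ub unfolding sgrp_models_def by blast+
  then have "sgrp_models ?\<sigma> \<subseteq> X \<sqinter>\<^bsub>L_OC V\<^esub> Y"
    using L.meet_le[OF _ _ X Y Z] by (simp add: L_OC_def)
  then have "theory_of (X \<sqinter>\<^bsub>L_OC V\<^esub> Y) \<subseteq> ?\<sigma>" using theory_of_antitone th by blast
  moreover have "X \<sqinter>\<^bsub>L_OC V\<^esub> Y \<subseteq> X" "X \<sqinter>\<^bsub>L_OC V\<^esub> Y \<subseteq> Y"
    using L.meet_left[OF X Y] L.meet_right[OF X Y] by (simp_all add: L_OC_def)
  then have "?\<sigma> \<subseteq> theory_of (X \<sqinter>\<^bsub>L_OC V\<^esub> Y)"
    using theory_of_antitone fully_invariantD(7)[OF carrier_theory(1)[OF cl]] by (intro rjoin_subset)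
  ultimately show "theory_of (X \<sqinter>\<^bsub>L_OC V\<^esub> Y) = rjoin (theory_of X) (theory_of Y)" by blast
qed

lemma theory_value:
  assumes "\<And>n. \<phi> n \<in> carrier (L_OC V)"
  shows "lterm_value (L_OC V) \<phi> t \<in> carrier (L_OC V) \<and>
    theory_of (lterm_value (L_OC V) \<phi> t) = eval rmeet rjoin (\<lambda>n. theory_of (\<phi> n)) t"
  unfolding lterm_value_eval by (rule eval_hom_on) (use assms theory_join theory_meet in auto)

end

section \<open>Restriction to words with a given content\<close>

definition words :: "nat multiset \<Rightarrow> nat list set" where
  "words c = {u. mset u = c}"

definition renaming :: "nat multiset \<Rightarrow> (nat \<Rightarrow> nat) \<Rightarrow> bool" where
  "renaming c \<pi> \<longleftrightarrow> inj_on \<pi> (set_mset c) \<and> image_mset \<pi> c = c"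

definition invariant_equivs :: "nat multiset \<Rightarrow> (nat list \<times> nat list) set \<Rightarrow> (nat list \<times> nat list) set set" where
  "invariant_equivs c \<rho> = {R. equiv (words c) R \<and> \<rho> \<inter> words c \<times> words c \<subseteq> R \<and>
     (\<forall>\<pi> u v. renaming c \<pi> \<longrightarrow> (u, v) \<in> R \<longrightarrow> (map \<pi> u, map \<pi> v) \<in> R)}"

lemma finite_words: "finite (words c)"
proof (rule finite_subset)
  show "words c \<subseteq> {u. set u \<subseteq> set_mset c \<and> length u = size c}" by (auto simp: words_def)
  show "finite {u. set u \<subseteq> set_mset c \<and> length u = size c}" by (rule finite_lists_length_eq) simp
qed

lemma words_set: "u \<in> words c \<Longrightarrow> set u = set_mset c"
  by (auto simp: words_def)

lemma map_renaming_words: "renaming c \<pi> \<Longrightarrow> u \<in> words c \<Longrightarrow> map \<pi> u \<in> words c"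
  by (auto simp: words_def renaming_def)

lemma renaming_image: "renaming c \<pi> \<Longrightarrow> \<pi> ` set_mset c = set_mset c"
  unfolding renaming_def by (metis set_image_mset)

lemma renaming_inverse:
  assumes "renaming c \<pi>"
  obtains \<pi>' where "renaming c \<pi>'" and "\<And>x. x \<in># c \<Longrightarrow> \<pi>' (\<pi> x) = x" and "\<And>x. x \<in># c \<Longrightarrow> \<pi> (\<pi>' x) = x"
proof
  let ?\<pi>' = "inv_into (set_mset c) \<pi>"
  have inj: "inj_on \<pi> (set_mset c)" using assms by (simp add: renaming_def)
  note im = renaming_image[OF assms]
  show 1: "?\<pi>' (\<pi> x) = x" if "x \<in># c" for x using inv_into_f_f[OF inj that] .
  show "\<pi> (?\<pi>' x) = x" if "x \<in># c" for x using f_inv_into_f[of x \<pi> "set_mset c"] im that by simp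
  have "image_mset ?\<pi>' c = image_mset ?\<pi>' (image_mset \<pi> c)" using assms by (simp add: renaming_def)
  also have "\<dots> = image_mset (\<lambda>x. x) c" unfolding multiset.map_comp by (rule image_mset_cong) (simp add: 1)
  finally have "image_mset ?\<pi>' c = c" by simp
  moreover have "inj_on ?\<pi>' (set_mset c)" using inj_on_inv_into[of "set_mset c" \<pi>] im by blast
  ultimately show "renaming c ?\<pi>'" by (simp add: renaming_def)
qed

lemma renaming_comp: "renaming c \<pi> \<Longrightarrow> renaming c \<pi>' \<Longrightarrow> renaming c (\<pi> \<circ> \<pi>')"
  using renaming_image[of c \<pi>'] unfolding renaming_def
  by (metis comp_inj_on multiset.map_comp)

lemma renaming_id: "renaming c id"
  by (simp add: renaming_def)

text \<open>The fully invariant congruence generated by \<open>R\<close> and \<open>\<rho>\<close>, enlarged so that all balanced pairs of words that are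
longer than \<open>c\<close>, or equally long with fewer distinct letters, are identified. A substitution applied to a word with
content \<open>c\<close> either produces such a word or merely renames letters, and multiplication makes words longer; hence
nothing is added on the words with content \<open>c\<close> itself.\<close>

lemma realize_invariant_equiv:
  assumes \<rho>: "fully_invariant \<rho>" "\<rho> \<subseteq> balanced" and c: "c \<noteq> {#}" and R: "R \<in> invariant_equivs c \<rho>"
  obtains \<sigma> where "fully_invariant \<sigma>" and "\<rho> \<subseteq> \<sigma>" and "\<sigma> \<subseteq> balanced" and "\<sigma> \<inter> words c \<times> words c = R"
proof -
  note D = fully_invariantD[OF \<rho>(1)]
  have eqv: "equiv (words c) R" and \<rho>R: "\<And>u v. (u, v) \<in> \<rho> \<Longrightarrow> mset u = c \<Longrightarrow> mset v = c \<Longrightarrow> (u, v) \<in> R"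
    and inv: "\<And>\<pi> u v. renaming c \<pi> \<Longrightarrow> (u, v) \<in> R \<Longrightarrow> (map \<pi> u, map \<pi> v) \<in> R"
    using R by (auto simp: invariant_equivs_def words_def)
  have Rc: "mset u = c \<and> mset v = c" if "(u, v) \<in> R" for u v
    using eqv that unfolding equiv_def words_def by blast
  have Rsym: "(v, u) \<in> R" if "(u, v) \<in> R" for u v
    using eqv that unfolding equiv_def by (meson symD)
  have Rtrans: "(u, w) \<in> R" if "(u, v) \<in> R" "(v, w) \<in> R" for u v w
    using eqv that unfolding equiv_def by (meson transD)
  \<comment> \<open>words that no substitution or multiplication leads back to the content \<open>c\<close>\<close>
  define small where "small u \<longleftrightarrow> size c < length u \<or> length u = size c \<and> card (set u) < card (set_mset c)" for u :: "nat list"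
  \<comment> \<open>pairs that a renaming of letters carries into \<open>R\<close>\<close>
  define like where "like u v \<longleftrightarrow> (\<exists>\<pi>. inj_on \<pi> (set u) \<and> (map \<pi> u, map \<pi> v) \<in> R)" for u v :: "nat list"
  define \<sigma> where "\<sigma> = {(u, v). u \<noteq> [] \<and> mset u = mset v \<and> ((u, v) \<in> \<rho> \<or> small u \<or> like u v)}"
  have small_mset: "small u \<longleftrightarrow> small v" if "mset u = mset v" for u v
    using mset_eq_length[OF that] mset_eq_setD[OF that] by (simp add: small_def)
  have balD: "u \<noteq> [] \<and> v \<noteq> [] \<and> mset u = mset v" if "(u, v) \<in> \<rho>" for u v
    using \<rho>(2) that by (auto simp: balanced_def)
  have like_len: "length u = size c" and like_set: "card (set u) = card (set_mset c)" if "like u v" for u v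
  proof -
    from that obtain \<pi> where inj: "inj_on \<pi> (set u)" and "(map \<pi> u, map \<pi> v) \<in> R" by (auto simp: like_def)
    then have \<pi>: "inj_on \<pi> (set u)" "mset (map \<pi> u) = c" using Rc by blast+
    show "length u = size c" using \<pi>(2) by (metis length_map size_mset)
    show "card (set u) = card (set_mset c)" using card_image[OF \<pi>(1)] \<pi>(2) by (metis set_map set_mset_mset)
  qed
  have like_trans: "like u w" if ms: "mset u = mset v" "mset v = mset w"
    and rel: "(u, v) \<in> \<rho> \<or> like u v" "(v, w) \<in> \<rho> \<or> like v w" "like u v \<or> like v w" for u v w
  proof -
    have sets: "set u = set v" "set v = set w" using ms mset_eq_setD by blast+
    have \<rho>map: "(map \<pi> x, map \<pi> y) \<in> R" if "(x, y) \<in> \<rho>" "mset (map \<pi> x) = c" for \<pi> x y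
    proof -
      have "(map \<pi> x, map \<pi> y) \<in> \<rho>" using D(6)[OF that(1), of "\<lambda>i. [\<pi> i]"] by (simp add: word_subst_single)
      moreover have "mset (map \<pi> y) = c" using that balD[OF that(1)] by simp
      ultimately show ?thesis using \<rho>R that(2) by blast
    qed
    have 1: ?thesis if "like u v" "(v, w) \<in> \<rho>"
    proof -
      obtain \<pi> where \<pi>: "inj_on \<pi> (set u)" "(map \<pi> u, map \<pi> v) \<in> R" using \<open>like u v\<close> by (auto simp: like_def)
      have "mset (map \<pi> v) = c" using Rc[OF \<pi>(2)] by blast
      then show ?thesis unfolding like_def using \<pi> Rtrans[OF \<pi>(2) \<rho>map[OF \<open>(v, w) \<in> \<rho>\<close>]] by blast
    qed
    have 2: ?thesis if "like v w" "(u, v) \<in> \<rho>"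
    proof -
      obtain \<pi> where \<pi>: "inj_on \<pi> (set v)" "(map \<pi> v, map \<pi> w) \<in> R" using \<open>like v w\<close> by (auto simp: like_def)
      have "mset (map \<pi> u) = c" using Rc[OF \<pi>(2)] ms(1) by simp
      then show ?thesis unfolding like_def using \<pi> sets Rtrans[OF \<rho>map[OF \<open>(u, v) \<in> \<rho>\<close>] \<pi>(2)] by metis
    qed
    have 3: ?thesis if both: "like u v" "like v w"
    proof -
      obtain \<pi> where \<pi>: "inj_on \<pi> (set u)" "(map \<pi> u, map \<pi> v) \<in> R" using both(1) by (auto simp: like_def)
      obtain \<pi>' where \<pi>': "inj_on \<pi>' (set v)" "(map \<pi>' v, map \<pi>' w) \<in> R" using both(2) by (auto simp: like_def)
      let ?g = "\<pi> \<circ> inv_into (set v) \<pi>'"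
      have g: "?g (\<pi>' x) = \<pi> x" if "x \<in> set v" for x using that \<pi>'(1) by simp
      have c: "image_mset \<pi>' (mset v) = c" "image_mset \<pi> (mset v) = c" using Rc[OF \<pi>'(2)] Rc[OF \<pi>(2)] by auto
      have "image_mset ?g c = image_mset (?g \<circ> \<pi>') (mset v)" using c(1) by (metis multiset.map_comp)
      also have "\<dots> = image_mset \<pi> (mset v)" using g by (intro image_mset_cong) auto
      finally have im: "image_mset ?g c = c" using c(2) by simp
      have "inj_on ?g (\<pi>' ` set v)"
        using \<pi>(1) sets g by (auto simp: inj_on_def simp del: comp_apply)
      moreover have "set_mset c = \<pi>' ` set v" using c(1) by auto
      ultimately have "renaming c ?g" using im by (simp add: renaming_def)
      then have "(map ?g (map \<pi>' v), map ?g (map \<pi>' w)) \<in> R" using inv \<pi>'(2) by blast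
      moreover have "map ?g (map \<pi>' v) = map \<pi> v" "map ?g (map \<pi>' w) = map \<pi> w"
        using g sets by auto
      ultimately show ?thesis unfolding like_def using \<pi> Rtrans by metis
    qed
    show ?thesis using rel 1 2 3 by blast
  qed
  have "fully_invariant \<sigma>"
  proof (rule fully_invariantI)
    fix u v
    show "(u, u) \<in> \<sigma>" if "u \<noteq> []" using D(2) that by (auto simp: \<sigma>_def)
    assume uv: "(u, v) \<in> \<sigma>"
    then have uv': "u \<noteq> []" "v \<noteq> []" "mset u = mset v" "(u, v) \<in> \<rho> \<or> small u \<or> like u v" by (auto simp: \<sigma>_def)
    then show "u \<noteq> [] \<and> v \<noteq> []" by simp
    have "like v u" if "like u v"
      using that mset_eq_setD[OF uv'(3)] Rsym unfolding like_def by metis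
    then show "(v, u) \<in> \<sigma>" using uv' D(3) small_mset[OF uv'(3)] by (auto simp: \<sigma>_def)
    show "(u, w) \<in> \<sigma>" if "(v, w) \<in> \<sigma>" for w
    proof -
      have vw: "mset v = mset w" "(v, w) \<in> \<rho> \<or> small v \<or> like v w" using that by (auto simp: \<sigma>_def)
      show ?thesis
        using uv' vw like_trans[OF uv'(3) vw(1)] D(4) small_mset[OF uv'(3)] unfolding \<sigma>_def by auto
    qed
    show "(a @ u @ b, a @ v @ b) \<in> \<sigma>" for a b
    proof (cases "a = [] \<and> b = []")
      case False
      have len: "length u = size c" if "like u v" using like_len[OF that] .
      have "small (a @ u @ b)" if "small u \<or> like u v"
        using that len False unfolding small_def by (cases a; cases b) auto
      then show ?thesis using uv' D(5) by (auto simp: \<sigma>_def)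
    qed (use uv in simp)
    show "(word_subst \<phi> u, word_subst \<phi> v) \<in> \<sigma>" if \<phi>: "\<And>n. \<phi> n \<noteq> []" for \<phi>
    proof -
      have mset_subst: "mset (word_subst \<phi> w) = (\<Sum>i\<in>#mset w. mset (\<phi> i))" for w
        by (induction w) auto
      have subst: "(word_subst \<phi> u, word_subst \<phi> v) \<in> \<rho>" if "(u, v) \<in> \<rho>"
        by (rule D(6)[OF that]) (rule \<phi>)
      have ms: "mset (word_subst \<phi> u) = mset (word_subst \<phi> v)" using uv'(3) by (simp add: mset_subst)
      have long: "length w \<le> length (word_subst \<phi> w) \<and>
        (length (word_subst \<phi> w) = length w \<longrightarrow> word_subst \<phi> w = map (\<lambda>i. hd (\<phi> i)) w)" for w
      proof (induction w)
        case (Cons i w)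
        obtain x xs where "\<phi> i = x # xs" using \<phi>[of i] by (cases "\<phi> i") auto
        then show ?case using Cons by (cases xs) auto
      qed simp
      have "(word_subst \<phi> u, word_subst \<phi> v) \<in> \<rho> \<or> small (word_subst \<phi> u) \<or> like (word_subst \<phi> u) (word_subst \<phi> v)"
      proof (cases "length (word_subst \<phi> u) = length u")
        case False
        then have "length u < length (word_subst \<phi> u)" using long[of u] by simp
        then have "small (word_subst \<phi> u)" if "small u \<or> like u v"
          using that like_len unfolding small_def by fastforce
        then show ?thesis using uv'(4) subst by blast
      next
        case True
        let ?f = "\<lambda>i. hd (\<phi> i)"
        have u: "word_subst \<phi> u = map ?f u" using long True by blast
        have "length (word_subst \<phi> v) = length v"
          using mset_eq_length[OF ms] mset_eq_length[OF uv'(3)] True by simp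
        then have v: "word_subst \<phi> v = map ?f v" using long by blast
        have card: "card (set (map ?f u)) \<le> card (set u)" by (simp add: card_image_le)
        consider "(u, v) \<in> \<rho>" | "small u" | "like u v" "inj_on ?f (set u)" | "like u v" "\<not> inj_on ?f (set u)"
          using uv'(4) by blast
        then show ?thesis
        proof cases
          case 1
          show ?thesis using subst[OF 1] ..
        next
          case 2 then show ?thesis using card unfolding u small_def by auto
        next
          case 3
          then obtain \<pi> where \<pi>: "inj_on \<pi> (set u)" "(map \<pi> u, map \<pi> v) \<in> R" by (auto simp: like_def)
          let ?g = "\<pi> \<circ> inv_into (set u) ?f"
          have g: "?g (?f x) = \<pi> x" if "x \<in> set u" for x using inv_into_f_f[OF 3(2) that] by simp
          have "inj_on ?g (set (map ?f u))" using \<pi>(1) g by (auto simp: inj_on_def simp del: comp_apply)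
          moreover have "map ?g (map ?f u) = map \<pi> u" "map ?g (map ?f v) = map \<pi> v"
              using g mset_eq_setD[OF uv'(3)] by auto
          ultimately have "like (map ?f u) (map ?f v)" unfolding like_def using \<pi>(2) by metis
          then show ?thesis unfolding u v by blast
        next
          case 4
          then have "card (set (map ?f u)) < card (set u)"
            using card inj_on_iff_eq_card[of "set u" ?f] by (simp add: order_less_le)
          then show ?thesis using 4(1) like_len like_set unfolding u small_def by auto
        qed
      qed
      then show ?thesis using ms uv'(1) \<phi> by (simp add: \<sigma>_def)
    qed
  qed
  moreover have "\<rho> \<subseteq> \<sigma>" using balD by (auto simp: \<sigma>_def)
  moreover have "\<sigma> \<subseteq> balanced" by (auto simp: \<sigma>_def balanced_def)
  moreover have "\<sigma> \<inter> words c \<times> words c = R"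
  proof (intro equalityI subsetI; clarify)
    fix u v assume uv: "(u, v) \<in> \<sigma>" "u \<in> words c" "v \<in> words c"
    then have c': "mset u = c" "mset v = c" by (auto simp: words_def)
    have "\<not> small u" using c' by (auto simp: small_def)
    then consider "(u, v) \<in> \<rho>" | \<pi> where "inj_on \<pi> (set u)" "(map \<pi> u, map \<pi> v) \<in> R"
      using uv(1) by (auto simp: \<sigma>_def like_def)
    then show "(u, v) \<in> R"
    proof cases
      case 2
      have "renaming c \<pi>" unfolding renaming_def using 2(1) Rc[OF 2(2)] c'(1) by (metis mset_map set_mset_mset)
      then obtain \<pi>' where \<pi>': "renaming c \<pi>'" "\<And>x. x \<in># c \<Longrightarrow> \<pi>' (\<pi> x) = x" by (rule renaming_inverse) blast
      have "map \<pi>' (map \<pi> w) = w" if "mset w = c" for w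
        unfolding map_map by (rule map_idI) (use \<pi>'(2) that in auto)
      then have "map \<pi>' (map \<pi> u) = u" "map \<pi>' (map \<pi> v) = v" using c' by blast+
      then show ?thesis using inv[OF \<pi>'(1) 2(2)] by simp
    qed (use \<rho>R c' in blast)
  next
    fix u v assume uv: "(u, v) \<in> R"
    have "like u v" unfolding like_def by (rule exI[of _ id]) (use uv in simp)
    then show "(u, v) \<in> \<sigma> \<inter> words c \<times> words c" using Rc[OF uv] c by (auto simp: \<sigma>_def words_def)
  qed
  ultimately show thesis by (rule that)
qed

lemma restrict_rmeet:
  assumes "trans \<sigma>" and "trans \<tau>"
  shows "rmeet \<sigma> \<tau> \<inter> A \<times> A = rmeet (\<sigma> \<inter> A \<times> A) (\<tau> \<inter> A \<times> A)"
proof -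
  have "trans (\<sigma> \<inter> A \<times> A)" "trans (\<tau> \<inter> A \<times> A)" using assms by (auto simp: trans_def)
  then show ?thesis using assms by (auto simp: rmeet_trans)
qed

text \<open>Chains of balanced pairs never change the content of a word.\<close>

lemma restrict_rjoin:
  assumes "\<sigma> \<subseteq> balanced" and "\<tau> \<subseteq> balanced"
  shows "rjoin \<sigma> \<tau> \<inter> words c \<times> words c = rjoin (\<sigma> \<inter> words c \<times> words c) (\<tau> \<inter> words c \<times> words c)"
proof
  have "(u, v) \<in> rjoin (\<sigma> \<inter> words c \<times> words c) (\<tau> \<inter> words c \<times> words c) \<and> v \<in> words c"
    if "(u, v) \<in> (\<sigma> \<union> \<tau>)\<^sup>+" "u \<in> words c" for u v
    using that
  proof (induction rule: trancl_induct)
    case (base v)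
    then have "v \<in> words c" using assms by (auto simp: balanced_def words_def)
    then show ?case using base unfolding rjoin_def by auto
  next
    case (step v w)
    then have "w \<in> words c" using assms by (auto simp: balanced_def words_def)
    then show ?case using step unfolding rjoin_def by (auto intro: trancl_into_trancl)
  qed
  then show "rjoin \<sigma> \<tau> \<inter> words c \<times> words c \<subseteq> rjoin (\<sigma> \<inter> words c \<times> words c) (\<tau> \<inter> words c \<times> words c)"
    unfolding rjoin_def[of \<sigma>] by auto
  show "rjoin (\<sigma> \<inter> words c \<times> words c) (\<tau> \<inter> words c \<times> words c) \<subseteq> rjoin \<sigma> \<tau> \<inter> words c \<times> words c"
  proof (rule rjoin_subset)
    show "trans (rjoin \<sigma> \<tau> \<inter> words c \<times> words c)"
      using trans_rjoin[of \<sigma> \<tau>] unfolding trans_def by blast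
  qed (use rjoin_ub in blast)+
qed

lemma invariant_equivs_closed:
  assumes R: "R \<in> invariant_equivs c \<rho>" and S: "S \<in> invariant_equivs c \<rho>"
  shows "rmeet R S \<in> invariant_equivs c \<rho>" and "rjoin R S \<in> invariant_equivs c \<rho>"
proof -
  have eq: "equiv (words c) R" "equiv (words c) S" and sub: "\<rho> \<inter> words c \<times> words c \<subseteq> R" "\<rho> \<inter> words c \<times> words c \<subseteq> S"
    and inv: "\<And>\<pi> u v. renaming c \<pi> \<Longrightarrow> (u, v) \<in> R \<Longrightarrow> (map \<pi> u, map \<pi> v) \<in> R"
     "\<And>\<pi> u v. renaming c \<pi> \<Longrightarrow> (u, v) \<in> S \<Longrightarrow> (map \<pi> u, map \<pi> v) \<in> S"
    using R S by (auto simp: invariant_equivs_def)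
  have meet: "rmeet R S = R \<inter> S" using eq by (simp add: equiv_def rmeet_trans)
  have "equiv (words c) (R \<inter> S)" using eq unfolding equiv_def refl_on_def by (auto intro: sym_Int trans_Int)
  then show "rmeet R S \<in> invariant_equivs c \<rho>"
    unfolding meet invariant_equivs_def using sub inv by auto
  have "equiv (words c) (rjoin R S)"
  proof (rule equivI)
    show "rjoin R S \<subseteq> words c \<times> words c"
      by (rule rjoin_subset) (use eq in \<open>auto simp: equiv_def trans_def\<close>)
    show "refl_on (words c) (rjoin R S)" using eq rjoin_ub(1)[of R S] unfolding equiv_def refl_on_def by blast
    have "sym (R \<union> S)" using eq by (simp add: equiv_def sym_Un)
    then show "sym (rjoin R S)" unfolding rjoin_def by (rule sym_trancl)
  qed (rule trans_rjoin)
  moreover have "(map \<pi> u, map \<pi> v) \<in> rjoin R S" if "renaming c \<pi>" "(u, v) \<in> rjoin R S" for \<pi> u v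
    using rjoin_map[of R "map \<pi>" R S S, OF inv(1)[OF that(1)] inv(2)[OF that(1)] that(2)] .
  ultimately show "rjoin R S \<in> invariant_equivs c \<rho>"
    unfolding invariant_equivs_def using sub(1) rjoin_ub(1)[of R S] by blast
qed

lemma restrict_invariant_equivs:
  assumes "fully_invariant \<sigma>" and "\<rho> \<subseteq> \<sigma>" and "c \<noteq> {#}"
  shows "\<sigma> \<inter> words c \<times> words c \<in> invariant_equivs c \<rho>"
proof -
  note D = fully_invariantD[OF assms(1)]
  have "equiv (words c) (\<sigma> \<inter> words c \<times> words c)"
  proof (rule equivI)
    show "refl_on (words c) (\<sigma> \<inter> words c \<times> words c)" using D(2) assms(3) by (auto simp: refl_on_def words_def)
    show "sym (\<sigma> \<inter> words c \<times> words c)" using D(3) by (auto simp: sym_def)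
    show "trans (\<sigma> \<inter> words c \<times> words c)" using D(4) unfolding trans_def by blast
  qed auto
  moreover have "(map \<pi> u, map \<pi> v) \<in> \<sigma>" if "(u, v) \<in> \<sigma>" for \<pi> u v
    using D(6)[OF that, of "\<lambda>i. [\<pi> i]"] by (simp add: word_subst_single)
  ultimately show ?thesis unfolding invariant_equivs_def using assms(2) map_renaming_words by auto
qed

context
  fixes V :: "'a sgrp set"
  assumes inf: "infinite (UNIV :: 'a set)" and V: "overcommutative V"
begin

lemma theory_of_V: "fully_invariant (theory_of V)" "theory_of V \<subseteq> balanced"
  using carrier_theory[OF inf V, of V] V by (auto simp: L_OC_def)

lemma eval_restrict:
  assumes "\<And>n. X n \<in> carrier (L_OC V)"
  shows "theory_of (lterm_value (L_OC V) X t) \<inter> words c \<times> words c =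
    eval rmeet rjoin (\<lambda>n. theory_of (X n) \<inter> words c \<times> words c) t"
proof -
  let ?B = "{\<sigma>. trans \<sigma> \<and> \<sigma> \<subseteq> balanced}"
  have "theory_of (X n) \<in> ?B" for n
    using carrier_theory[OF inf V assms] fully_invariantD(7) by blast
  moreover have "rmeet \<sigma> \<tau> \<in> ?B \<and> rmeet \<sigma> \<tau> \<inter> words c \<times> words c = rmeet (\<sigma> \<inter> words c \<times> words c) (\<tau> \<inter> words c \<times> words c)"
    if "\<sigma> \<in> ?B" "\<tau> \<in> ?B" for \<sigma> \<tau>
    using that restrict_rmeet[of \<sigma> \<tau> "words c"] trans_rmeet[of \<sigma> \<tau>] rmeet_trans[of \<sigma> \<tau>] by auto
  moreover have "rjoin \<sigma> \<tau> \<in> ?B \<and> rjoin \<sigma> \<tau> \<inter> words c \<times> words c = rjoin (\<sigma> \<inter> words c \<times> words c) (\<tau> \<inter> words c \<times> words c)"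
    if "\<sigma> \<in> ?B" "\<tau> \<in> ?B" for \<sigma> \<tau>
    using that restrict_rjoin[of \<sigma> \<tau> c] trans_rjoin[of \<sigma> \<tau>] rjoin_subset[OF _ _ trans_balanced, of \<sigma> \<tau>] by simp
  ultimately have "eval rmeet rjoin (\<lambda>n. theory_of (X n)) t \<inter> words c \<times> words c =
    eval rmeet rjoin (\<lambda>n. theory_of (X n) \<inter> words c \<times> words c) t"
    using eval_hom_on[of ?B rmeet "\<lambda>\<sigma>. \<sigma> \<inter> words c \<times> words c" rmeet rjoin rjoin "\<lambda>n. theory_of (X n)" t] by blast
  then show ?thesis using theory_value[OF inf V assms] by simp
qed

text \<open>Restriction is a lattice homomorphism onto \<open>invariant_equivs c\<close> for each nonempty \<open>c\<close>, and the
restrictions to all these contents determine a variety.\<close>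

lemma satisfies_iff_invariant_equivs:
  "lat_satisfies (L_OC V) (s, t) \<longleftrightarrow> (\<forall>c \<psi>. c \<noteq> {#} \<longrightarrow> (\<forall>n. \<psi> n \<in> invariant_equivs c (theory_of V)) \<longrightarrow>
     eval rmeet rjoin \<psi> s = eval rmeet rjoin \<psi> t)"
proof
  assume L: "lat_satisfies (L_OC V) (s, t)"
  show "\<forall>c \<psi>. c \<noteq> {#} \<longrightarrow> (\<forall>n. \<psi> n \<in> invariant_equivs c (theory_of V)) \<longrightarrow>
     eval rmeet rjoin \<psi> s = eval rmeet rjoin \<psi> t"
  proof (intro allI impI)
    fix c and \<psi> :: "nat \<Rightarrow> (nat list \<times> nat list) set" assume c: "c \<noteq> {#}" and \<psi>: "\<forall>n. \<psi> n \<in> invariant_equivs c (theory_of V)"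
    have "\<exists>X \<in> carrier (L_OC V). theory_of X \<inter> words c \<times> words c = \<psi> n" for n
    proof -
      obtain \<sigma> where \<sigma>: "fully_invariant \<sigma>" "theory_of V \<subseteq> \<sigma>" "\<sigma> \<subseteq> balanced" "\<sigma> \<inter> words c \<times> words c = \<psi> n"
        using realize_invariant_equiv[OF theory_of_V c] \<psi> by metis
      then show ?thesis
        using models_carrier[OF inf V \<sigma>(1-3)] theory_of_models[OF inf \<sigma>(1)] by metis
    qed
    then obtain X :: "nat \<Rightarrow> 'a sgrp set" where X: "\<And>n. X n \<in> carrier (L_OC V)" "\<And>n. theory_of (X n) \<inter> words c \<times> words c = \<psi> n"
      by metis
    have "lterm_value (L_OC V) X s = lterm_value (L_OC V) X t"
      using L X(1) by (auto simp: lat_satisfies_def)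
    then show "eval rmeet rjoin \<psi> s = eval rmeet rjoin \<psi> t"
      using eval_restrict[of X s c] eval_restrict[of X t c] X(1) by (simp add: X(2))
  qed
next
  assume R: "\<forall>c \<psi>. c \<noteq> {#} \<longrightarrow> (\<forall>n. \<psi> n \<in> invariant_equivs c (theory_of V)) \<longrightarrow>
     eval rmeet rjoin \<psi> s = eval rmeet rjoin \<psi> t"
  show "lat_satisfies (L_OC V) (s, t)"
    unfolding lat_satisfies_def
  proof (intro allI impI)
    fix X :: "nat \<Rightarrow> 'a sgrp set" assume "range X \<subseteq> carrier (L_OC V)"
    then have X: "X n \<in> carrier (L_OC V)" for n by auto
    let ?s = "lterm_value (L_OC V) X s" and ?t = "lterm_value (L_OC V) X t"
    have val: "?s \<in> carrier (L_OC V)" "?t \<in> carrier (L_OC V)" using theory_value[OF inf V X] by auto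
    have eq: "theory_of ?s \<inter> words c \<times> words c = theory_of ?t \<inter> words c \<times> words c" if "c \<noteq> {#}" for c
    proof -
      have "theory_of (X n) \<inter> words c \<times> words c \<in> invariant_equivs c (theory_of V)" for n
        by (rule restrict_invariant_equivs[OF carrier_theory(1,2)[OF inf V X] that])
      then show ?thesis unfolding eval_restrict[OF X] using R that by simp
    qed
    have "theory_of ?s = theory_of ?t"
    proof -
      have "(u, v) \<in> theory_of ?s \<longleftrightarrow> (u, v) \<in> theory_of ?t" for u v
      proof (cases "u \<noteq> [] \<and> mset u = mset v")
        case True
        then have "u \<in> words (mset u)" "v \<in> words (mset u)" "mset u \<noteq> {#}" by (auto simp: words_def)
        then show ?thesis using eq[of "mset u"] by blast
      next
        case False
        then show ?thesis using carrier_theory(3)[OF inf V val(1)] carrier_theory(3)[OF inf V val(2)]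
          by (auto simp: balanced_def)
      qed
      then show ?thesis by auto
    qed
    then have "sgrp_models (theory_of ?s) = (sgrp_models (theory_of ?t) :: 'a sgrp set)" by simp
    then show "lterm_value (L_OC V) X (fst (s, t)) = lterm_value (L_OC V) X (snd (s, t))"
      unfolding carrier_theory(4)[OF inf V val(1)] carrier_theory(4)[OF inf V val(2)] by simp
  qed
qed

end

section \<open>Partition lattices inside the lattices of invariant equivalences\<close>

text \<open>Contents of the form \<open>mset [0..<k]\<close> are kept in this shape.\<close>

declare mset_upt [simp del]

lemma finite_partition_closed:
  assumes "finite_partition k \<theta>" and "finite_partition k \<theta>'"
  shows "finite_partition k (rmeet \<theta> \<theta>')" and "finite_partition k (rjoin \<theta> \<theta>')"
proof -
  have eq: "equiv UNIV \<theta>" "equiv UNIV \<theta>'" and small: "\<theta> \<union> \<theta>' \<subseteq> Id \<union> {..<k} \<times> {..<k}"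
    using assms by (auto simp: finite_partition_def)
  have meet: "rmeet \<theta> \<theta>' = \<theta> \<inter> \<theta>'" using eq by (simp add: equiv_def rmeet_trans)
  have "equiv UNIV (\<theta> \<inter> \<theta>')" using eq unfolding equiv_def refl_on_def by (auto intro: sym_Int trans_Int)
  then show "finite_partition k (rmeet \<theta> \<theta>')" unfolding meet using small by (auto simp: finite_partition_def)
  have "rjoin \<theta> \<theta>' \<subseteq> Id \<union> {..<k} \<times> {..<k}"
    by (rule rjoin_subset) (use small in \<open>auto simp: trans_def\<close>)
  moreover have "equiv UNIV (rjoin \<theta> \<theta>')"
  proof (rule equivI)
    show "refl_on UNIV (rjoin \<theta> \<theta>')" using eq rjoin_ub(1)[of \<theta> \<theta>'] unfolding equiv_def refl_on_def by blast
    have "sym (\<theta> \<union> \<theta>')" using eq by (simp add: equiv_def sym_Un)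
    then show "sym (rjoin \<theta> \<theta>')" unfolding rjoin_def by (rule sym_trancl)
  qed (auto intro: trans_rjoin)
  ultimately show "finite_partition k (rjoin \<theta> \<theta>')" by (auto simp: finite_partition_def)
qed

text \<open>An injective homomorphism from the partitions of \<open>{..<k}\<close> would transport a failing identity. Of the two
inclusions for joins only the stated one carries content, the other one follows from monotonicity.\<close>

lemma no_partition_embedding:
  assumes sat: "\<And>\<psi>. (\<And>n. \<psi> n \<in> invariant_equivs c \<rho>) \<Longrightarrow> eval rmeet rjoin \<psi> s = eval rmeet rjoin \<psi> t"
    and \<psi>: "\<And>n. finite_partition k (\<psi> n)" and ne: "eval rmeet rjoin \<psi> s \<noteq> eval rmeet rjoin \<psi> t"
    and Y: "\<And>\<theta>. finite_partition k \<theta> \<Longrightarrow> Y \<theta> \<in> invariant_equivs c \<rho>"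
    and meet: "\<And>\<theta> \<theta>'. finite_partition k \<theta> \<Longrightarrow> finite_partition k \<theta>' \<Longrightarrow> Y (\<theta> \<inter> \<theta>') = Y \<theta> \<inter> Y \<theta>'"
    and join: "\<And>\<theta> \<theta>'. finite_partition k \<theta> \<Longrightarrow> finite_partition k \<theta>' \<Longrightarrow> Y (rjoin \<theta> \<theta>') \<subseteq> rjoin (Y \<theta>) (Y \<theta>')"
    and detect: "\<And>p q. p < k \<Longrightarrow> q < k \<Longrightarrow> \<exists>u v. \<forall>\<theta>. finite_partition k \<theta> \<longrightarrow> (u, v) \<in> Y \<theta> \<longleftrightarrow> (p, q) \<in> \<theta>"
  shows False
proof -
  let ?B = "{\<theta>. finite_partition k \<theta>}"
  have tr: "trans \<theta>" if "finite_partition k \<theta>" for \<theta> using that by (simp add: finite_partition_def equiv_def)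
  have trY: "trans (Y \<theta>)" if "finite_partition k \<theta>" for \<theta>
    using Y[OF that] by (simp add: invariant_equivs_def equiv_def)
  have "rmeet \<theta> \<theta>' \<in> ?B \<and> Y (rmeet \<theta> \<theta>') = rmeet (Y \<theta>) (Y \<theta>')" if "\<theta> \<in> ?B" "\<theta>' \<in> ?B" for \<theta> \<theta>'
    using that finite_partition_closed(1)[of k \<theta> \<theta>'] meet[of \<theta> \<theta>'] tr trY by (simp add: rmeet_trans)
  moreover have mono: "Y \<theta> \<subseteq> Y \<theta>'" if "\<theta> \<in> ?B" "\<theta>' \<in> ?B" "\<theta> \<subseteq> \<theta>'" for \<theta> \<theta>'
    using meet[of \<theta> \<theta>'] that by (simp add: Int_absorb2) (metis Int_lower2)
  have "rjoin \<theta> \<theta>' \<in> ?B \<and> Y (rjoin \<theta> \<theta>') = rjoin (Y \<theta>) (Y \<theta>')" if "\<theta> \<in> ?B" "\<theta>' \<in> ?B" for \<theta> \<theta>'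
  proof -
    have J: "rjoin \<theta> \<theta>' \<in> ?B" using that finite_partition_closed(2) by blast
    have "rjoin (Y \<theta>) (Y \<theta>') \<subseteq> Y (rjoin \<theta> \<theta>')"
      by (rule rjoin_subset[OF mono[OF that(1) J rjoin_ub(1)] mono[OF that(2) J rjoin_ub(2)]])
        (use J trY in simp)
    then show ?thesis using J join that by blast
  qed
  ultimately have "eval rmeet rjoin \<psi> t \<in> ?B \<and> Y (eval rmeet rjoin \<psi> t) = eval rmeet rjoin (\<lambda>n. Y (\<psi> n)) t" for t
    using \<psi> by (intro eval_hom_on) auto
  moreover have "eval rmeet rjoin (\<lambda>n. Y (\<psi> n)) s = eval rmeet rjoin (\<lambda>n. Y (\<psi> n)) t"
    by (rule sat) (rule Y[OF \<psi>])
  ultimately have eq: "Y (eval rmeet rjoin \<psi> s) = Y (eval rmeet rjoin \<psi> t)"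
    and fp: "finite_partition k (eval rmeet rjoin \<psi> s)" "finite_partition k (eval rmeet rjoin \<psi> t)"
    by auto
  have "(p, q) \<in> eval rmeet rjoin \<psi> s \<longleftrightarrow> (p, q) \<in> eval rmeet rjoin \<psi> t" for p q
  proof (cases "p < k \<and> q < k")
    case True
    then obtain u v where "\<forall>\<theta>. finite_partition k \<theta> \<longrightarrow> (u, v) \<in> Y \<theta> \<longleftrightarrow> (p, q) \<in> \<theta>"
      using detect by blast
    then show ?thesis using eq fp by blast
  next
    case False
    have "(p, q) \<in> \<theta> \<longleftrightarrow> p = q" if "finite_partition k \<theta>" for \<theta>
      using that False by (auto simp: finite_partition_def equiv_def refl_on_def)
    then show ?thesis using fp by blast
  qed
  then show False using ne by auto
qed

text \<open>Words in the same orbit of the renamings, modulo \<open>\<rho>\<close>.\<close>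

definition orbit_rel :: "nat multiset \<Rightarrow> (nat list \<times> nat list) set \<Rightarrow> (nat list \<times> nat list) set" where
  "orbit_rel c \<rho> = {(u, v). u \<in> words c \<and> v \<in> words c \<and> (\<exists>\<pi>. renaming c \<pi> \<and> (map \<pi> u, v) \<in> \<rho>)}"

lemma fully_invariant_map: "fully_invariant \<rho> \<Longrightarrow> (u, v) \<in> \<rho> \<Longrightarrow> (map \<pi> u, map \<pi> v) \<in> \<rho>"
  using fully_invariantD(6)[of \<rho> u v "\<lambda>i. [\<pi> i]"] by (simp add: word_subst_single)

lemma equiv_orbit_rel:
  assumes \<rho>: "fully_invariant \<rho>" and c: "c \<noteq> {#}"
  shows "equiv (words c) (orbit_rel c \<rho>)"
proof (rule equivI)
  note D = fully_invariantD[OF \<rho>]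
  show "orbit_rel c \<rho> \<subseteq> words c \<times> words c" by (auto simp: orbit_rel_def)
  show "refl_on (words c) (orbit_rel c \<rho>)"
    unfolding refl_on_def
  proof
    fix u assume "u \<in> words c"
    moreover from this have "u \<noteq> []" using c by (auto simp: words_def)
    then have "(map id u, u) \<in> \<rho>" using D(2) by simp
    ultimately show "(u, u) \<in> orbit_rel c \<rho>" using renaming_id unfolding orbit_rel_def by blast
  qed
  show "sym (orbit_rel c \<rho>)"
  proof (rule symI)
    fix u v assume "(u, v) \<in> orbit_rel c \<rho>"
    then obtain \<pi> where uv: "u \<in> words c" "v \<in> words c" "renaming c \<pi>" "(map \<pi> u, v) \<in> \<rho>"
      by (auto simp: orbit_rel_def)
    obtain \<pi>' where \<pi>': "renaming c \<pi>'" "\<And>x. x \<in># c \<Longrightarrow> \<pi>' (\<pi> x) = x"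
      using renaming_inverse[OF uv(3)] by blast
    have "map \<pi>' (map \<pi> u) = u" unfolding map_map
      by (rule map_idI) (use \<pi>'(2) words_set[OF uv(1)] in auto)
    then have "(u, map \<pi>' v) \<in> \<rho>" using fully_invariant_map[OF \<rho> uv(4), of \<pi>'] by simp
    then show "(v, u) \<in> orbit_rel c \<rho>" using D(3) uv \<pi>'(1) unfolding orbit_rel_def by blast
  qed
  show "trans (orbit_rel c \<rho>)"
  proof (rule transI)
    fix u v w assume "(u, v) \<in> orbit_rel c \<rho>" "(v, w) \<in> orbit_rel c \<rho>"
    then obtain \<pi> \<pi>' where *: "u \<in> words c" "w \<in> words c" "renaming c \<pi>" "(map \<pi> u, v) \<in> \<rho>"
      "renaming c \<pi>'" "(map \<pi>' v, w) \<in> \<rho>"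
      by (auto simp: orbit_rel_def)
    have "(map \<pi>' (map \<pi> u), map \<pi>' v) \<in> \<rho>" by (rule fully_invariant_map[OF \<rho> *(4)])
    then have "(map (\<pi>' \<circ> \<pi>) u, w) \<in> \<rho>" using D(4)[OF _ *(6)] by simp
    then show "(u, w) \<in> orbit_rel c \<rho>"
      using * renaming_comp[OF *(5,3)] unfolding orbit_rel_def by blast
  qed
qed

text \<open>Otherwise the words can be distributed over \<open>k\<close> nonempty unions of orbits, and every partition of \<open>{..<k}\<close>
glues these unions to an invariant equivalence.\<close>

lemma few_orbits:
  assumes \<rho>: "fully_invariant \<rho>" and c: "c \<noteq> {#}"
    and sat: "\<And>\<psi>. (\<And>n. \<psi> n \<in> invariant_equivs c \<rho>) \<Longrightarrow> eval rmeet rjoin \<psi> s = eval rmeet rjoin \<psi> t"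
    and \<psi>: "\<And>n. finite_partition k (\<psi> n)" and ne: "eval rmeet rjoin \<psi> s \<noteq> eval rmeet rjoin \<psi> t" and "0 < k"
  shows "card (words c // orbit_rel c \<rho>) < k"
proof (rule ccontr)
  note D = fully_invariantD[OF \<rho>] and E = equiv_orbit_rel[OF \<rho> c]
  let ?Q = "words c // orbit_rel c \<rho>"
  assume "\<not> card ?Q < k"
  then have card: "k \<le> card ?Q" by simp
  have fin: "finite ?Q" using finite_quotient[OF finite_words equiv_type[OF E]] .
  obtain g where g: "bij_betw g ?Q {0..<card ?Q}" using ex_bij_betw_finite_nat[OF fin] by blast
  \<comment> \<open>all surplus orbits are merged into the last union\<close>
  define orb where "orb u = min (g (orbit_rel c \<rho> `` {u})) (k - 1)" for u
  have orb_lt: "orb u < k" for u using \<open>0 < k\<close> by (auto simp: orb_def)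
  have orb_eq: "orb u = orb v" if "(u, v) \<in> orbit_rel c \<rho>" for u v
    using equiv_class_eq[OF E that] by (simp add: orb_def)
  have orb_surj: "\<exists>u \<in> words c. orb u = i" if "i < k" for i
  proof -
    have "i \<in> g ` ?Q" using g card that by (auto simp: bij_betw_def)
    then obtain u where "u \<in> words c" "g (orbit_rel c \<rho> `` {u}) = i" by (auto elim!: quotientE)
    then show ?thesis using that by (intro bexI[of _ u]) (auto simp: orb_def)
  qed
  define Y where "Y \<theta> = {(u, v). u \<in> words c \<and> v \<in> words c \<and> (orb u, orb v) \<in> \<theta>}" for \<theta>
  show False
  proof (rule no_partition_embedding[OF sat \<psi> ne, where Y = Y])
    fix \<theta> assume "finite_partition k \<theta>"
    then have \<theta>: "equiv UNIV \<theta>" by (simp add: finite_partition_def)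
    have "equiv (words c) (Y \<theta>)"
    proof (rule equivI)
      show "refl_on (words c) (Y \<theta>)" using \<theta> by (auto simp: Y_def equiv_def refl_on_def)
      show "sym (Y \<theta>)" using \<theta> by (auto simp: Y_def equiv_def intro!: symI dest: symD)
      show "trans (Y \<theta>)" using \<theta> by (auto simp: Y_def equiv_def intro!: transI dest: transD)
    qed (auto simp: Y_def)
    moreover have "\<rho> \<inter> words c \<times> words c \<subseteq> Y \<theta>"
    proof clarify
      fix u v assume uv: "(u, v) \<in> \<rho>" "u \<in> words c" "v \<in> words c"
      then have "(u, v) \<in> orbit_rel c \<rho>" unfolding orbit_rel_def
        using renaming_id by (auto intro!: exI[of _ id])
      then show "(u, v) \<in> Y \<theta>" using orb_eq \<theta> uv by (auto simp: Y_def equiv_def refl_on_def)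
    qed
    moreover have "(map \<pi> u, map \<pi> v) \<in> Y \<theta>" if \<pi>: "renaming c \<pi>" and uv: "(u, v) \<in> Y \<theta>" for \<pi> u v
    proof -
      have "orb (map \<pi> w) = orb w" if "w \<in> words c" for w
      proof -
        have "map \<pi> w \<noteq> []" using that c by (auto simp: words_def)
        then have "(w, map \<pi> w) \<in> orbit_rel c \<rho>"
          using that \<pi> D(2) map_renaming_words unfolding orbit_rel_def by blast
        then show ?thesis using orb_eq by simp
      qed
      then show ?thesis using uv map_renaming_words[OF \<pi>] by (auto simp: Y_def)
    qed
    ultimately show "Y \<theta> \<in> invariant_equivs c \<rho>" by (simp add: invariant_equivs_def)
  next
    fix \<theta> \<theta>' show "Y (\<theta> \<inter> \<theta>') = Y \<theta> \<inter> Y \<theta>'" by (auto simp: Y_def)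
  next
    fix \<theta> \<theta>' assume fp: "finite_partition k \<theta>" "finite_partition k \<theta>'"
    have one_step: "(u, v) \<in> rjoin (Y \<theta>) (Y \<theta>')" if "(orb u, orb v) \<in> \<theta> \<union> \<theta>'" "u \<in> words c" "v \<in> words c" for u v
    proof -
      have "(u, v) \<in> Y \<theta> \<union> Y \<theta>'" using that by (auto simp: Y_def)
      then show ?thesis unfolding rjoin_def by (rule r_into_trancl)
    qed
    have "v \<in> words c \<Longrightarrow> (u, v) \<in> rjoin (Y \<theta>) (Y \<theta>')" if "(orb u, q) \<in> (\<theta> \<union> \<theta>')\<^sup>+" "q = orb v" "u \<in> words c" for u v q
      using that(1,2)
    proof (induction arbitrary: v rule: trancl_induct)
      case (base q)
      then show ?case using that(3) one_step by blast
    next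
      case (step p q)
      have "p < k"
        using step.hyps(2) step.prems(2) fp orb_lt[of v] unfolding finite_partition_def
        by (cases "p = q") auto
      then obtain w where w: "w \<in> words c" "orb w = p" using orb_surj by blast
      then have "(u, w) \<in> rjoin (Y \<theta>) (Y \<theta>')" using step.IH by blast
      moreover have "(w, v) \<in> rjoin (Y \<theta>) (Y \<theta>')"
        using one_step step w by blast
      ultimately show ?case using trans_rjoin by (metis transD)
    qed
    then show "Y (rjoin \<theta> \<theta>') \<subseteq> rjoin (Y \<theta>) (Y \<theta>')"
      unfolding rjoin_def[of \<theta>] Y_def[of "(\<theta> \<union> \<theta>')\<^sup>+"] by auto
  next
    fix p q assume "p < k" "q < k"
    then obtain u v where "u \<in> words c" "orb u = p" "v \<in> words c" "orb v = q" using orb_surj by metis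
    then show "\<exists>u v. \<forall>\<theta>. finite_partition k \<theta> \<longrightarrow> (u, v) \<in> Y \<theta> \<longleftrightarrow> (p, q) \<in> \<theta>"
      by (intro exI[of _ u] exI[of _ v]) (auto simp: Y_def)
  qed
qed

definition swap_at :: "nat \<Rightarrow> nat \<Rightarrow> 'x list \<Rightarrow> 'x list" where
  "swap_at p q u = u[p := u ! q, q := u ! p]"

lemma length_swap_at [simp]: "length (swap_at p q u) = length u"
  by (simp add: swap_at_def)

lemma mset_swap_at: "p < length u \<Longrightarrow> q < length u \<Longrightarrow> mset (swap_at p q u) = mset u"
  unfolding swap_at_def by (rule mset_swap)

lemma nth_swap_at: "p < length u \<Longrightarrow> q < length u \<Longrightarrow> i < length u \<Longrightarrow>
  swap_at p q u ! i = (if i = q then u ! p else if i = p then u ! q else u ! i)"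
  by (simp add: swap_at_def nth_list_update)

text \<open>Words without repeated letters are permuted by exchanging positions. The relation \<open>young k \<theta>\<close> consists of the
orbits of the Young subgroup of \<open>\<theta>\<close>, the permutations of positions preserving its blocks.\<close>

definition young :: "nat \<Rightarrow> (nat \<times> nat) set \<Rightarrow> (nat list \<times> nat list) set" where
  "young k \<theta> = {(u, v). u \<in> words (mset [0..<k]) \<and> v \<in> words (mset [0..<k]) \<and>
     (\<forall>p < k. \<forall>q < k. u ! p = v ! q \<longrightarrow> (p, q) \<in> \<theta>)}"

lemma words_upt:
  assumes "u \<in> words (mset [0..<k])"
  shows "length u = k" and "distinct u" and "set u = {..<k}"
proof -
  have m: "mset u = mset [0..<k]" using assms by (simp add: words_def)
  show "length u = k" using mset_eq_length[OF m] by simp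
  show "distinct u" using mset_eq_imp_distinct_iff[OF m] by simp
  show "set u = {..<k}" using mset_eq_setD[OF m] by (simp add: lessThan_atLeast0)
qed

lemma words_upt_pos:
  assumes "u \<in> words (mset [0..<k])" and "v \<in> words (mset [0..<k])" and "p < k"
  obtains q where "q < k" and "v ! q = u ! p"
proof -
  have "u ! p \<in> set v" using words_upt[OF assms(1)] words_upt[OF assms(2)] assms(3) nth_mem[of p u] by simp
  then show thesis using that words_upt(1)[OF assms(2)] unfolding in_set_conv_nth by blast
qed

lemma equiv_young:
  assumes "equiv UNIV \<theta>" shows "equiv (words (mset [0..<k])) (young k \<theta>)"
proof (rule equivI)
  show "young k \<theta> \<subseteq> words (mset [0..<k]) \<times> words (mset [0..<k])" by (auto simp: young_def)
  have \<theta>: "(p, p) \<in> \<theta>" "(p, q) \<in> \<theta> \<Longrightarrow> (q, p) \<in> \<theta>" "(p, q) \<in> \<theta> \<Longrightarrow> (q, r) \<in> \<theta> \<Longrightarrow> (p, r) \<in> \<theta>" for p q r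
    using assms unfolding equiv_def refl_on_def sym_def trans_def by blast+
  show "refl_on (words (mset [0..<k])) (young k \<theta>)"
    unfolding refl_on_def young_def
  proof clarify
    fix u p q assume u: "u \<in> words (mset [0..<k])" and pq: "p < k" "q < k" "u ! p = u ! q"
    then have "p = q" using words_upt[OF u] nth_eq_iff_index_eq by metis
    then show "(p, q) \<in> \<theta>" using \<theta>(1) by simp
  qed
  show "sym (young k \<theta>)"
    by (rule symI) (auto simp: young_def intro: \<theta>(2))
  show "trans (young k \<theta>)"
  proof (rule transI)
    fix u v w assume uv: "(u, v) \<in> young k \<theta>" and vw: "(v, w) \<in> young k \<theta>"
    have "(p, q) \<in> \<theta>" if pq: "p < k" "q < k" "u ! p = w ! q" for p q
    proof -
      obtain r where r: "r < k" "v ! r = u ! p"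
        using words_upt_pos[of u k v p] uv pq(1) by (auto simp: young_def)
      have "(p, r) \<in> \<theta>" "(r, q) \<in> \<theta>" using uv vw pq r by (auto simp: young_def)
      then show ?thesis by (rule \<theta>(3))
    qed
    then show "(u, w) \<in> young k \<theta>" using uv vw by (auto simp: young_def)
  qed
qed

lemma swap_young:
  assumes "equiv UNIV \<theta>" and "(p, q) \<in> \<theta>" and "p < k" and "q < k" and u: "u \<in> words (mset [0..<k])"
  shows "(u, swap_at p q u) \<in> young k \<theta>"
proof -
  note W = words_upt[OF u]
  have \<theta>: "(r, r) \<in> \<theta>" "(q, p) \<in> \<theta>" for r
    using assms(1,2) unfolding equiv_def refl_on_def sym_def by blast+
  have "swap_at p q u \<in> words (mset [0..<k])"
    using u mset_swap_at[of p u q] W assms by (simp add: words_def)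
  moreover have "(i, j) \<in> \<theta>" if "i < k" "j < k" "u ! i = swap_at p q u ! j" for i j
    using that W assms \<theta> by (auto simp: nth_swap_at nth_eq_iff_index_eq split: if_splits)
  ultimately show ?thesis using u by (auto simp: young_def)
qed

lemma swap_at_conj:
  assumes "p < length u" "q < length u" "r < length u" "p \<noteq> q" "q \<noteq> r" "p \<noteq> r"
  shows "swap_at q r (swap_at p q (swap_at q r u)) = swap_at p r u"
  by (rule nth_equalityI) (use assms in \<open>auto simp: nth_swap_at\<close>)

text \<open>Transpositions of positions in one block of the join are conjugates of transpositions within blocks of the two
partitions, and every permutation that preserves the blocks is a product of such transpositions.\<close>

lemma young_rjoin:
  assumes fp: "finite_partition k \<theta>" "finite_partition k \<theta>'"
  shows "young k (rjoin \<theta> \<theta>') \<subseteq> rjoin (young k \<theta>) (young k \<theta>')"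
proof -
  let ?Z = "rjoin (young k \<theta>) (young k \<theta>')" and ?J = "rjoin \<theta> \<theta>'" and ?W = "words (mset [0..<k])"
  have eq: "equiv UNIV \<theta>" "equiv UNIV \<theta>'" "equiv UNIV ?J"
    using fp finite_partition_closed(2)[OF fp] by (auto simp: finite_partition_def)
  have Zrefl: "(u, u) \<in> ?Z" if "u \<in> ?W" for u
    using that equiv_young[OF eq(1), of k] rjoin_ub(1) unfolding equiv_def refl_on_def by blast
  have Ztrans: "(u, w) \<in> ?Z" if "(u, v) \<in> ?Z" "(v, w) \<in> ?Z" for u v w
    using that trans_rjoin by (metis transD)
  have swapW: "swap_at p q u \<in> ?W" if "p < k" "q < k" "u \<in> ?W" for p q u
    using that mset_swap_at[of p u q] words_upt[OF that(3)] by (simp add: words_def)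
  have one_swap: "(u, swap_at p q u) \<in> ?Z" if "(p, q) \<in> \<theta> \<union> \<theta>'" "p < k" "q < k" "u \<in> ?W" for p q u
    using that swap_young[OF eq(1)] swap_young[OF eq(2)] rjoin_ub by blast
  have same: "swap_at p p u = u" for p and u :: "nat list" by (simp add: swap_at_def)
  \<comment> \<open>induction along a chain from \<open>p\<close> to \<open>q\<close>, with \<open>swap_at_conj\<close> in the generic case\<close>
  have swap: "\<forall>u \<in> ?W. q < k \<longrightarrow> (u, swap_at p q u) \<in> ?Z" if "(p, q) \<in> (\<theta> \<union> \<theta>')\<^sup>+" "p < k" for p q
    using that(1)
  proof (induction rule: trancl_induct)
    case (base q)
    then show ?case using one_swap that(2) by blast
  next
    case (step q r)
    show ?case
    proof (intro ballI impI)
      fix u assume u: "u \<in> ?W" and r: "r < k"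
      have q: "q < k" using step(2) r fp unfolding finite_partition_def by (cases "q = r") auto
      note len = words_upt(1)[OF u]
      consider "q = r" | "p = r" | "p = q" | "p \<noteq> q" "q \<noteq> r" "p \<noteq> r" by blast
      then show "(u, swap_at p r u) \<in> ?Z"
      proof cases
        case 4
        let ?u1 = "swap_at q r u" and ?u2 = "swap_at p q (swap_at q r u)"
        have u1: "?u1 \<in> ?W" using swapW[OF q r u] .
        have u2: "?u2 \<in> ?W" using swapW[OF that(2) q u1] .
        have "(u, ?u1) \<in> ?Z" "(?u2, swap_at q r ?u2) \<in> ?Z" using one_swap[OF step(2) q r] u u2 by blast+
        moreover have "(?u1, ?u2) \<in> ?Z" using step.IH u1 q by blast
        ultimately have "(u, swap_at q r ?u2) \<in> ?Z" using Ztrans by blast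
        then show ?thesis using swap_at_conj[of p u q r] that(2) q r len 4 by simp
      qed (use step one_swap u r q that(2) Zrefl same in auto)
    qed
  qed
  have ZJ: "?Z \<subseteq> young k ?J"
  proof (rule rjoin_subset)
    show "young k \<theta> \<subseteq> young k ?J" "young k \<theta>' \<subseteq> young k ?J"
      using subsetD[OF rjoin_ub(1)[of \<theta> \<theta>']] subsetD[OF rjoin_ub(2)[of \<theta>' \<theta>]]
      by (auto simp: young_def)
    show "trans (young k ?J)" using equiv_young[OF eq(3)] by (simp add: equiv_def)
  qed
  have "(u, v) \<in> ?Z" if "(u, v) \<in> young k ?J" for u v
    using that
  proof (induction "card {p. p < k \<and> u ! p \<noteq> v ! p}" arbitrary: u rule: less_induct)
    case less
    have u: "u \<in> ?W" and v: "v \<in> ?W" using less.prems by (auto simp: young_def)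
    show ?case
    proof (cases "u = v")
      case True then show ?thesis using Zrefl u by simp
    next
      case False
      then obtain p where p: "p < k" "u ! p \<noteq> v ! p"
        using words_upt(1)[OF u] words_upt(1)[OF v] by (metis nth_equalityI)
      \<comment> \<open>one exchange brings the correct letter to position \<open>p\<close>\<close>
      obtain q where q: "q < k" "u ! q = v ! p" using words_upt_pos[OF v u p(1)] by blast
      have "(q, p) \<in> ?J" using less.prems p q by (auto simp: young_def)
      then have Z: "(u, swap_at q p u) \<in> ?Z" using swap q(1) p(1) u unfolding rjoin_def[of \<theta>] by blast
      let ?u = "swap_at q p u"
      have "(?u, u) \<in> young k ?J" using Z ZJ equiv_young[OF eq(3), of k] unfolding equiv_def sym_def by blast
      then have J: "(?u, v) \<in> young k ?J"
        using less.prems equiv_young[OF eq(3), of k] unfolding equiv_def by (meson transD)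
      have "v ! q \<noteq> v ! p" using words_upt[OF v] p q nth_eq_iff_index_eq by metis
      have nth: "?u ! i = (if i = p then u ! q else if i = q then u ! p else u ! i)" if "i < k" for i
        using that p(1) q(1) words_upt(1)[OF u] by (simp add: nth_swap_at)
      have "i < k \<and> u ! i \<noteq> v ! i" if "i < k" "?u ! i \<noteq> v ! i" for i
        using that nth[OF that(1)] p q \<open>v ! q \<noteq> v ! p\<close> by (auto split: if_splits)
      moreover have "?u ! p = v ! p" using nth[OF p(1)] q(2) by simp
      ultimately have "{i. i < k \<and> ?u ! i \<noteq> v ! i} \<subset> {i. i < k \<and> u ! i \<noteq> v ! i}"
        using p by blast
      then have "card {i. i < k \<and> ?u ! i \<noteq> v ! i} < card {i. i < k \<and> u ! i \<noteq> v ! i}"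
        by (intro psubset_card_mono) auto
      then have "(?u, v) \<in> ?Z" using less.hyps J by blast
      then show ?thesis using Ztrans Z by blast
    qed
  qed
  then show ?thesis by auto
qed

text \<open>Without permutation identities \<open>\<rho>\<close> is trivial on the words with content \<open>mset [0..<k]\<close>, so \<open>young k\<close> embeds the
partitions.\<close>

lemma permutation_identity:
  assumes \<rho>: "fully_invariant \<rho>"
    and sat: "\<And>\<psi>. (\<And>n. \<psi> n \<in> invariant_equivs (mset [0..<k]) \<rho>) \<Longrightarrow> eval rmeet rjoin \<psi> s = eval rmeet rjoin \<psi> t"
    and \<psi>: "\<And>n. finite_partition k (\<psi> n)" and ne: "eval rmeet rjoin \<psi> s \<noteq> eval rmeet rjoin \<psi> t"
  shows "\<exists>u v. (u, v) \<in> \<rho> \<and> u \<noteq> v \<and> distinct u \<and> mset u = mset v"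
proof (rule ccontr)
  assume no: "\<nexists>u v. (u, v) \<in> \<rho> \<and> u \<noteq> v \<and> distinct u \<and> mset u = mset v"
  show False
  proof (rule no_partition_embedding[OF sat \<psi> ne, where Y = "young k"])
    fix \<theta> assume "finite_partition k \<theta>"
    then have \<theta>: "equiv UNIV \<theta>" by (simp add: finite_partition_def)
    let ?W = "words (mset [0..<k])"
    have eqv: "equiv ?W (young k \<theta>)" by (rule equiv_young[OF \<theta>])
    moreover have "\<rho> \<inter> ?W \<times> ?W \<subseteq> young k \<theta>"
    proof clarify
      fix u v assume uv: "(u, v) \<in> \<rho>" "u \<in> ?W" "v \<in> ?W"
      then have "mset u = mset v" by (simp add: words_def)
      then have "u = v" using no words_upt(2)[OF uv(2)] uv(1) by blast
      then show "(u, v) \<in> young k \<theta>" using eqv uv(2) by (auto simp: equiv_def refl_on_def)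
    qed
    moreover have "(map \<pi> u, map \<pi> v) \<in> young k \<theta>" if \<pi>: "renaming (mset [0..<k]) \<pi>" and uv: "(u, v) \<in> young k \<theta>" for \<pi> u v
    proof -
      have W: "u \<in> ?W" "v \<in> ?W" using uv by (auto simp: young_def)
      have inj: "inj_on \<pi> {..<k}" using \<pi> by (simp add: renaming_def lessThan_atLeast0)
      have "u ! p = v ! q" if "p < k" "q < k" "map \<pi> u ! p = map \<pi> v ! q" for p q
        using that words_upt[OF W(1)] words_upt[OF W(2)] inj_onD[OF inj, of "u ! p" "v ! q"]
          nth_mem[of p u] nth_mem[of q v] by auto
      then show ?thesis using uv map_renaming_words[OF \<pi>] by (auto simp: young_def)
    qed
    ultimately show "young k \<theta> \<in> invariant_equivs (mset [0..<k]) \<rho>" by (simp add: invariant_equivs_def)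
  next
    fix \<theta> \<theta>' show "young k (\<theta> \<inter> \<theta>') = young k \<theta> \<inter> young k \<theta>'" by (auto simp: young_def)
  next
    fix p q assume pq: "p < k" "q < k"
    have u: "[0..<k] \<in> words (mset [0..<k])" by (simp add: words_def)
    have "([0..<k], swap_at p q [0..<k]) \<in> young k \<theta> \<longleftrightarrow> (p, q) \<in> \<theta>" if "finite_partition k \<theta>" for \<theta>
    proof
      assume "([0..<k], swap_at p q [0..<k]) \<in> young k \<theta>"
      moreover have "swap_at p q [0..<k] ! q = p" using pq by (simp add: nth_swap_at)
      ultimately show "(p, q) \<in> \<theta>" using pq by (auto simp: young_def)
    next
      assume "(p, q) \<in> \<theta>"
      then show "([0..<k], swap_at p q [0..<k]) \<in> young k \<theta>"
        using swap_young[OF _ _ pq u] that by (simp add: finite_partition_def)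
    qed
    then show "\<exists>u v. \<forall>\<theta>. finite_partition k \<theta> \<longrightarrow> (u, v) \<in> young k \<theta> \<longleftrightarrow> (p, q) \<in> \<theta>" by blast
  qed (assumption | rule young_rjoin)+
qed

section \<open>Consequences of a permutation identity\<close>

text \<open>If every pair of neighbours of \<open>u\<close> were neighbours in \<open>v\<close>, then \<open>v\<close> would contain \<open>u\<close> as a contiguous block.\<close>

lemma broken_adjacency:
  assumes "distinct u" and m: "mset u = mset v" and "u \<noteq> v"
  shows "\<exists>p x y s. u = p @ x # y # s \<and> (\<forall>p' s'. v \<noteq> p' @ x # y # s')"
proof (rule ccontr)
  assume "\<nexists>p x y s. u = p @ x # y # s \<and> (\<forall>p' s'. v \<noteq> p' @ x # y # s')"
  then have adj: "\<exists>p' s'. v = p' @ x # y # s'" if "u = p @ x # y # s" for p x y s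
    using that by blast
  have dv: "distinct v" using mset_eq_imp_distinct_iff[OF m] assms(1) by simp
  have len: "length v = length u" using mset_eq_length[OF m] by simp
  have "u \<noteq> []" using assms m by auto
  then have "u ! 0 \<in> set v" using mset_eq_setD[OF m] by (cases u) auto
  then obtain j where j: "j < length u" "v ! j = u ! 0" using len by (metis in_set_conv_nth)
  have shift: "j + i < length u \<and> v ! (j + i) = u ! i" if "i < length u" for i
    using that
  proof (induction i)
    case (Suc i)
    have "u = take i u @ u ! i # u ! Suc i # drop (Suc (Suc i)) u"
      using Suc.prems by (metis Cons_nth_drop_Suc Suc_lessD append_take_drop_id)
    then obtain p' s' where v: "v = p' @ u ! i # u ! Suc i # s'" using adj by blast
    have "v ! length p' = v ! (j + i)" "length p' < length v" using v Suc by (auto simp: nth_append)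
    then have "length p' = j + i" using dv Suc len nth_eq_iff_index_eq by (metis Suc_lessD)
    moreover have "v ! Suc (length p') = u ! Suc i" "Suc (length p') < length v"
      by (subst v, simp add: nth_append)+
    ultimately show ?case using len by simp
  qed (use j in simp)
  have "j = 0" using shift[of "length u - 1"] \<open>u \<noteq> []\<close> by (cases "length u") auto
  then have "u = v" using shift len by (intro nth_equalityI) auto
  then show False using assms(3) by simp
qed

lemma word_subst_id: "(\<And>i. i \<in> set w \<Longrightarrow> \<phi> i = [i]) \<Longrightarrow> word_subst \<phi> w = w"
  by (induction w) auto

lemma word_subst_cong: "(\<And>i. i \<in> set w \<Longrightarrow> \<phi> i = \<psi> i) \<Longrightarrow> word_subst \<phi> w = word_subst \<psi> w"
  by (induction w) auto

text \<open>Let \<open>x\<close> and \<open>y\<close> be neighbours in \<open>u\<close> but not in \<open>v\<close>. A new letter \<open>z\<close> can be inserted after \<open>x\<close> or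
before \<open>y\<close>; in \<open>u\<close> this makes no difference, whereas in \<open>v\<close> the letter \<open>z\<close> appears in two different places.\<close>

lemma moving_letter:
  assumes \<rho>: "fully_invariant \<rho>" and uv: "(u, v) \<in> \<rho>" and "u \<noteq> v" and "distinct u" and m: "mset u = mset v"
  obtains a b c z where "distinct (z # a @ b @ c)" and "b \<noteq> []" and "(a @ z # b @ c, a @ b @ z # c) \<in> \<rho>"
proof -
  note D = fully_invariantD[OF \<rho>]
  obtain p x y s where u: "u = p @ x # y # s" and na: "\<And>p' s'. v \<noteq> p' @ x # y # s'"
    using broken_adjacency[OF assms(4) m assms(3)] by blast
  have dv: "distinct v" using mset_eq_imp_distinct_iff[OF m] assms(4) by simp
  obtain z where z: "z \<notin> set u" using ex_new_if_finite[of "set u"] by auto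
  have sets: "set u = set v" using mset_eq_setD[OF m] .
  have zv: "z \<notin> set v" using z sets by simp
  define \<phi> \<psi> where "\<phi> i = (if i = x then [x, z] else [i])" and "\<psi> i = (if i = y then [z, y] else [i])" for i
  have xy: "x \<noteq> y" "x \<notin> set p" "x \<notin> set s" "y \<notin> set p" "y \<notin> set s" using assms(4) u by auto
  have \<phi>id: "word_subst \<phi> w = w" if "x \<notin> set w" for w
    by (rule word_subst_id) (use that in \<open>auto simp: \<phi>_def\<close>)
  have \<psi>id: "word_subst \<psi> w = w" if "y \<notin> set w" for w
    by (rule word_subst_id) (use that in \<open>auto simp: \<psi>_def\<close>)
  have "word_subst \<phi> u = word_subst \<psi> u"
    using xy unfolding u by (simp add: \<phi>id \<psi>id) (simp add: \<phi>_def \<psi>_def)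
  moreover have "(word_subst \<phi> u, word_subst \<phi> v) \<in> \<rho>" "(word_subst \<psi> u, word_subst \<psi> v) \<in> \<rho>"
    by (rule D(6)[OF uv]; simp add: \<phi>_def \<psi>_def)+
  ultimately have \<phi>\<psi>: "(word_subst \<phi> v, word_subst \<psi> v) \<in> \<rho>" "(word_subst \<psi> v, word_subst \<phi> v) \<in> \<rho>"
    using D(3,4) by metis+
  have "x \<in> set v" "y \<in> set v" using sets u by auto
  then obtain A B where v: "v = A @ x # B" by (meson split_list)
  have "y \<in> set A \<or> y \<in> set B" using \<open>y \<in> set v\<close> v xy(1) by auto
  then show thesis
  proof
    assume "y \<in> set B"
    then obtain B1 C where B: "B = B1 @ y # C" by (meson split_list)
    have "B1 \<noteq> []" using na[of A C] v B by auto
    have dist: "distinct (A @ x # B1 @ y # C)" using dv v B by simp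
    have "word_subst \<phi> v = (A @ [x]) @ z # B1 @ (y # C)" "word_subst \<psi> v = (A @ [x]) @ B1 @ z # (y # C)"
      using dist unfolding v B by (simp_all add: \<phi>id \<psi>id) (simp_all add: \<phi>_def \<psi>_def)
    moreover have "distinct (z # (A @ [x]) @ B1 @ (y # C))" using dist zv v B by auto
    ultimately show thesis using that \<open>B1 \<noteq> []\<close> \<phi>\<psi>(1) by metis
  next
    assume "y \<in> set A"
    then obtain A1 B1 where A: "A = A1 @ y # B1" by (meson split_list)
    have dist: "distinct (A1 @ y # B1 @ x # B)" using dv v A by simp
    have "word_subst \<phi> v = A1 @ (y # B1 @ [x]) @ z # B" "word_subst \<psi> v = A1 @ z # (y # B1 @ [x]) @ B"
      using dist unfolding v A by (simp_all add: \<phi>id \<psi>id) (simp_all add: \<phi>_def \<psi>_def)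
    moreover have "distinct (z # A1 @ (y # B1 @ [x]) @ B)" using dist zv v A by auto
    ultimately show thesis using that[of z A1 "y # B1 @ [x]" B] \<phi>\<psi>(2) by simp
  qed
qed

lemma word_subst_onto:
  assumes "distinct w" and "length w \<le> length b" and "w = [] \<Longrightarrow> b = []"
  shows "\<exists>\<phi>. (\<forall>n. \<phi> n \<noteq> []) \<and> word_subst \<phi> w = b"
  using assms
proof (induction w arbitrary: b)
  case Nil
  then show ?case by (intro exI[of _ "\<lambda>n. [n]"]) auto
next
  case (Cons i w)
  obtain x b' where b: "b = x # b'" using Cons.prems(2) by (cases b) auto
  show ?case
  proof (cases "w = []")
    case True
    then show ?thesis using b by (intro exI[of _ "\<lambda>_. b"]) auto
  next
    case False
    then obtain \<phi> where \<phi>: "\<forall>n. \<phi> n \<noteq> []" "word_subst \<phi> w = b'"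
      using Cons.IH[of b'] Cons.prems b by auto
    have "word_subst (\<phi>(i := [x])) w = word_subst \<phi> w"
      by (rule word_subst_cong) (use Cons.prems(1) in auto)
    then have "word_subst (\<phi>(i := [x])) (i # w) = b" using \<phi>(2) b by (simp del: fun_upd_apply) simp
    moreover have "\<forall>n. (\<phi>(i := [x])) n \<noteq> []" using \<phi>(1) by simp
    ultimately show ?thesis by blast
  qed
qed

text \<open>As the letters are distinct, \<open>z\<close> and the letters of \<open>b\<close> can be replaced by arbitrary words \<open>y\<close> and
\<open>b'\<close>. Surplus letters of \<open>a'\<close> and \<open>c'\<close> stay outside as context, which also covers empty \<open>a\<close> and \<open>c\<close>.\<close>

lemma move_past_block:
  assumes \<rho>: "fully_invariant \<rho>" and dist: "distinct (z # a @ b @ c)" and "b \<noteq> []"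
    and id: "(a @ z # b @ c, a @ b @ z # c) \<in> \<rho>"
    and len: "length a \<le> length a'" "length b \<le> length b'" "length c \<le> length c'" and y: "y \<noteq> []"
  shows "(a' @ y @ b' @ c', a' @ b' @ y @ c') \<in> \<rho>"
proof -
  define a0 a1 where "a0 = take (length a' - length a) a'" and "a1 = drop (length a' - length a) a'"
  define c1 c0 where "c1 = take (length c) c'" and "c0 = drop (length c) c'"
  have a: "a' = a0 @ a1" "length a1 = length a" and c: "c' = c1 @ c0" "length c1 = length c"
    using len by (simp_all add: a0_def a1_def c0_def c1_def)
  obtain \<alpha> where \<alpha>: "\<forall>n. \<alpha> n \<noteq> []" "word_subst \<alpha> a = a1"
    using word_subst_onto[of a a1] dist a(2) by force
  obtain \<beta> where \<beta>: "\<forall>n. \<beta> n \<noteq> []" "word_subst \<beta> b = b'"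
    using word_subst_onto[of b b'] dist len \<open>b \<noteq> []\<close> by auto
  obtain \<gamma> where \<gamma>: "\<forall>n. \<gamma> n \<noteq> []" "word_subst \<gamma> c = c1"
    using word_subst_onto[of c c1] dist c(2) by force
  define \<phi> where "\<phi> n = (if n = z then y else if n \<in> set a then \<alpha> n else if n \<in> set b then \<beta> n else \<gamma> n)" for n
  have "word_subst \<phi> a = word_subst \<alpha> a" "word_subst \<phi> b = word_subst \<beta> b" "word_subst \<phi> c = word_subst \<gamma> c"
    by (rule word_subst_cong; use dist in \<open>auto simp: \<phi>_def\<close>)+
  then have w: "word_subst \<phi> a = a1" "word_subst \<phi> b = b'" "word_subst \<phi> c = c1" and z: "\<phi> z = y"
    using \<alpha> \<beta> \<gamma> by (simp_all add: \<phi>_def)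
  have "\<phi> n \<noteq> []" for n using \<alpha> \<beta> \<gamma> y by (simp add: \<phi>_def)
  then have "(word_subst \<phi> (a @ z # b @ c), word_subst \<phi> (a @ b @ z # c)) \<in> \<rho>"
    by (rule fully_invariantD(6)[OF \<rho> id])
  then have "(a1 @ y @ b' @ c1, a1 @ b' @ y @ c1) \<in> \<rho>" by (simp add: w z)
  from fully_invariantD(5)[OF \<rho> this, of a0 c0] show ?thesis by (simp add: a c)
qed

text \<open>Both \<open>x y b1\<close> and \<open>y x b1\<close> can be brought into the form \<open>y b1 x\<close>: the word \<open>x\<close> is moved past the block
\<open>y b1\<close>, respectively past the block \<open>b1\<close>. Both blocks are long enough to be substituted for \<open>q\<close>.\<close>

lemma interior_commutes:
  assumes \<rho>: "fully_invariant \<rho>" and "(u, v) \<in> \<rho>" and "u \<noteq> v" and "distinct u" and "mset u = mset v"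
  obtains K where "0 < K" and "\<And>a b x y. K \<le> length a \<Longrightarrow> K \<le> length b \<Longrightarrow> x \<noteq> [] \<Longrightarrow> y \<noteq> [] \<Longrightarrow>
    (a @ x @ y @ b, a @ y @ x @ b) \<in> \<rho>"
proof -
  note D = fully_invariantD[OF \<rho>]
  obtain p q r z where pqr: "distinct (z # p @ q @ r)" "q \<noteq> []" "(p @ z # q @ r, p @ q @ z # r) \<in> \<rho>"
    using moving_letter[OF assms] by metis
  note move = move_past_block[OF \<rho> pqr]
  define K where "K = Suc (length p + length q + length r)"
  show thesis
  proof (rule that[of K])
    fix a b x y :: "nat list"
    assume len: "K \<le> length a" "K \<le> length b" and ne: "x \<noteq> []" "y \<noteq> []"
    define b1 b2 where "b1 = take (length q) b" and "b2 = drop (length q) b"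
    have b: "b = b1 @ b2" "length b1 = length q" "length r \<le> length b2"
      using len by (simp_all add: b1_def b2_def K_def)
    have "(a @ x @ (y @ b1) @ b2, a @ (y @ b1) @ x @ b2) \<in> \<rho>"
      by (rule move) (use len b ne in \<open>auto simp: K_def\<close>)
    moreover have "((a @ y) @ x @ b1 @ b2, (a @ y) @ b1 @ x @ b2) \<in> \<rho>"
      by (rule move) (use len b ne in \<open>auto simp: K_def\<close>)
    ultimately have "(a @ x @ y @ b1 @ b2, a @ y @ b1 @ x @ b2) \<in> \<rho>" "(a @ y @ b1 @ x @ b2, a @ y @ x @ b1 @ b2) \<in> \<rho>"
      using D(3) by simp_all
    then show "(a @ x @ y @ b, a @ y @ x @ b) \<in> \<rho>"
      unfolding b(1) by (rule D(4))
  qed (simp add: K_def)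
qed

section \<open>Counting invariant equivalences\<close>

definition ends :: "nat \<Rightarrow> 'x list \<Rightarrow> 'x list" where
  "ends K u = take K u @ drop (length u - K) u"

lemma map_ends: "ends K (map f u) = map f (ends K u)"
  by (simp add: ends_def take_map drop_map)

lemma set_ends: "set (ends K u) \<subseteq> set u"
  unfolding ends_def using set_take_subset set_drop_subset by fastforce

lemma length_ends: "2 * K \<le> length u \<Longrightarrow> length (ends K u) = 2 * K"
  by (simp add: ends_def)

definition commuting_interior :: "nat \<Rightarrow> (nat list \<times> nat list) set \<Rightarrow> bool" where
  "commuting_interior K \<rho> \<longleftrightarrow> 0 < K \<and> (\<forall>a b x y. K \<le> length a \<longrightarrow> K \<le> length b \<longrightarrow>
     x \<noteq> [] \<longrightarrow> y \<noteq> [] \<longrightarrow> (a @ x @ y @ b, a @ y @ x @ b) \<in> \<rho>)"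

lemma interior_permutes:
  assumes \<rho>: "fully_invariant \<rho>" and K: "commuting_interior K \<rho>"
    and "K \<le> length a" "K \<le> length b" "mset w = mset w'"
  shows "(a @ w @ b, a @ w' @ b) \<in> \<rho>"
  using assms(3,5)
proof (induction w arbitrary: a w')
  case Nil
  then have "a @ b \<noteq> []" using K by (auto simp: commuting_interior_def)
  then show ?case using Nil fully_invariantD(2)[OF \<rho>] by simp
next
  case (Cons x w)
  have "x \<in> set w'" using Cons.prems(2) by (metis list.set_intros(1) mset_eq_setD)
  then obtain w1 w2 where w': "w' = w1 @ x # w2" by (meson split_list)
  have "mset w = mset (w1 @ w2)" using Cons.prems(2) w' by simp
  then have 1: "((a @ [x]) @ w @ b, (a @ [x]) @ (w1 @ w2) @ b) \<in> \<rho>"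
    using Cons.IH[of "a @ [x]" "w1 @ w2"] Cons.prems(1) by simp
  have 2: "(a @ [x] @ w1 @ (w2 @ b), a @ w1 @ [x] @ (w2 @ b)) \<in> \<rho>"
  proof (cases "w1 = []")
    case True then show ?thesis using fully_invariantD(2)[OF \<rho>] by simp
  next
    case False
    have "K \<le> length (w2 @ b)" using assms(4) by simp
    then show ?thesis using K False Cons.prems(1) unfolding commuting_interior_def by blast
  qed
  show ?case using fully_invariantD(4)[OF \<rho> _ 2] 1 w' by simp
qed

lemma same_ends:
  assumes \<rho>: "fully_invariant \<rho>" and K: "commuting_interior K \<rho>"
    and m: "mset u = mset v" and "2 * K \<le> length u" and e: "ends K u = ends K v"
  shows "(u, v) \<in> \<rho>"
proof -
  have len: "length v = length u" using mset_eq_length[OF m] by simp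
  have split: "w = take K w @ take (length w - 2 * K) (drop K w) @ drop (length w - K) w" if "2 * K \<le> length w" for w :: "nat list"
  proof -
    have "drop (length w - K) w = drop (length w - 2 * K) (drop K w)" using that by (simp add: add.commute)
    then show ?thesis by (metis append_take_drop_id)
  qed
  have t: "take K u = take K v" and d: "drop (length u - K) u = drop (length v - K) v"
    using e assms(4) len unfolding ends_def by (simp_all add: append_eq_append_conv)
  let ?a = "take K u" and ?b = "drop (length u - K) u"
  let ?u = "take (length u - 2 * K) (drop K u)" and ?v = "take (length v - 2 * K) (drop K v)"
  have u: "u = ?a @ ?u @ ?b" using split assms(4) by blast
  have v: "v = ?a @ ?v @ ?b" unfolding t d using split[of v] assms(4) len by simp
  have "mset (?a @ ?u @ ?b) = mset (?a @ ?v @ ?b)" using m u v by simp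
  then have "mset ?u = mset ?v" by simp
  then have "(?a @ ?u @ ?b, ?a @ ?v @ ?b) \<in> \<rho>"
    using assms(4) by (intro interior_permutes[OF \<rho> K]) auto
  then show ?thesis using u v by simp
qed

lemma count_renaming:
  assumes "renaming c \<pi>" and "x \<in># c" shows "count c (\<pi> x) = count c x"
proof -
  have "\<pi> -` {\<pi> x} \<inter> set_mset c = {x}" using assms by (auto simp: renaming_def inj_on_def)
  then have "count (image_mset \<pi> c) (\<pi> x) = count c x" by (simp add: count_image_mset)
  then show ?thesis using assms(1) by (simp add: renaming_def)
qed

lemma renamingI:
  assumes "bij_betw h (set_mset c) (set_mset c)" and "\<And>x. x \<in># c \<Longrightarrow> count c (h x) = count c x"
  shows "renaming c h"
  unfolding renaming_def
proof
  show inj: "inj_on h (set_mset c)" using assms(1) by (rule bij_betw_imp_inj_on)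
  have surj: "h ` set_mset c = set_mset c" using assms(1) by (rule bij_betw_imp_surj_on)
  show "image_mset h c = c"
  proof (rule multiset_eqI)
    fix y
    show "count (image_mset h c) y = count c y"
    proof (cases "y \<in># c")
      case True
      then have "y \<in> h ` set_mset c" using surj by simp
      then obtain x where x: "x \<in># c" "h x = y" by auto
      then have "h -` {y} \<inter> set_mset c = {x}" using inj by (auto dest: inj_onD)
      then show ?thesis using assms(2)[OF x(1)] x(2) by (simp add: count_image_mset)
    next
      case False
      then have "y \<notin> h ` set_mset c" using surj by simp
      then have "h -` {y} \<inter> set_mset c = {}" by auto
      then show ?thesis using False by (simp add: count_image_mset not_in_iff)
    qed
  qed
qed

text \<open>One point at a time, each time correcting the renaming by a transposition of two letters that occur equally often.\<close>

lemma extend_to_renaming: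
  assumes "finite A" and "A \<subseteq> set_mset c" and "inj_on f A" and "\<And>x. x \<in> A \<Longrightarrow> f x \<in># c \<and> count c (f x) = count c x"
  shows "\<exists>\<mu>. renaming c \<mu> \<and> (\<forall>x \<in> A. \<mu> x = f x)"
  using assms
proof (induction A rule: finite_induct)
  case empty
  then show ?case using renaming_id by blast
next
  case (insert a A)
  then obtain \<mu> where \<mu>: "renaming c \<mu>" "\<forall>x \<in> A. \<mu> x = f x" by auto
  define s where "s y = (if y = \<mu> a then f a else if y = f a then \<mu> a else y)" for y
  have a: "a \<in># c" "f a \<in># c" "count c (f a) = count c a" using insert.prems by auto
  have \<mu>a: "\<mu> a \<in># c" "count c (\<mu> a) = count c a"
    using renaming_image[OF \<mu>(1)] count_renaming[OF \<mu>(1) a(1)] a(1) by auto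
  have "renaming c s"
  proof (rule renamingI)
    have "s (s y) = y" for y by (simp add: s_def)
    moreover have "s y \<in># c" if "y \<in># c" for y using that a \<mu>a by (simp add: s_def)
    ultimately show "bij_betw s (set_mset c) (set_mset c)"
      by (intro bij_betw_byWitness[where f' = s]) auto
    show "count c (s y) = count c y" if "y \<in># c" for y using a \<mu>a by (simp add: s_def)
  qed
  then have "renaming c (s \<circ> \<mu>)" using \<mu>(1) by (rule renaming_comp)
  moreover have "(s \<circ> \<mu>) x = f x" if x: "x \<in> insert a A" for x
  proof (cases "x = a")
    case False
    then have "x \<in> A" "x \<in># c" using x insert.prems(1) by auto
    then have "\<mu> x = f x" "\<mu> x \<noteq> \<mu> a" "f x \<noteq> f a"
      using \<mu> a(1) False x insert.prems(2) by (auto simp: renaming_def inj_on_def)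
    then show ?thesis by (simp add: s_def)
  qed (simp add: s_def)
  ultimately show ?case by blast
qed

text \<open>The values of \<open>\<mu>\<close> are prescribed on the images of \<open>A\<close> under \<open>\<tau>\<close> and of \<open>B\<close> under \<open>\<tau>'\<close>. Equality of
the two patterns of coincidences says that the prescriptions agree where they overlap and are injective.\<close>

lemma align_renamings:
  assumes ren: "renaming c \<pi>" "renaming c \<pi>'" "renaming c \<tau>" "renaming c \<tau>'"
    and sub: "A \<subseteq> set_mset c" "B \<subseteq> set_mset c"
    and eq: "\<And>x y. x \<in> A \<Longrightarrow> y \<in> B \<Longrightarrow> \<pi> x = \<pi>' y \<longleftrightarrow> \<tau> x = \<tau>' y"
  shows "\<exists>\<mu>. renaming c \<mu> \<and> (\<forall>x \<in> A. \<mu> (\<tau> x) = \<pi> x) \<and> (\<forall>y \<in> B. \<mu> (\<tau>' y) = \<pi>' y)"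
proof -
  have inj: "inj_on \<pi> (set_mset c)" "inj_on \<pi>' (set_mset c)" "inj_on \<tau> (set_mset c)" "inj_on \<tau>' (set_mset c)"
    using ren by (auto simp: renaming_def)
  define f where "f z = (if z \<in> \<tau> ` A then \<pi> (inv_into A \<tau> z) else \<pi>' (inv_into B \<tau>' z))" for z
  have fA: "f (\<tau> x) = \<pi> x" if "x \<in> A" for x
    using that inj_on_subset[OF inj(3) sub(1)] by (simp add: f_def)
  have fB: "f (\<tau>' y) = \<pi>' y" if y: "y \<in> B" for y
  proof (cases "\<tau>' y \<in> \<tau> ` A")
    case True
    then obtain x where "x \<in> A" "\<tau>' y = \<tau> x" by auto
    then show ?thesis using fA eq[of x y] y by simp
  next
    case False
    then show ?thesis using y inj_on_subset[OF inj(4) sub(2)] by (simp add: f_def)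
  qed
  have im: "\<And>x. x \<in># c \<Longrightarrow> \<pi> x \<in># c" "\<And>x. x \<in># c \<Longrightarrow> \<pi>' x \<in># c" "\<And>x. x \<in># c \<Longrightarrow> \<tau> x \<in># c" "\<And>x. x \<in># c \<Longrightarrow> \<tau>' x \<in># c"
    using renaming_image[OF ren(1)] renaming_image[OF ren(2)] renaming_image[OF ren(3)] renaming_image[OF ren(4)] by blast+
  have "\<exists>\<mu>. renaming c \<mu> \<and> (\<forall>z \<in> \<tau> ` A \<union> \<tau>' ` B. \<mu> z = f z)"
  proof (rule extend_to_renaming)
    have "finite A" "finite B" using sub by (auto intro: finite_subset)
    then show "finite (\<tau> ` A \<union> \<tau>' ` B)" by simp
    show "\<tau> ` A \<union> \<tau>' ` B \<subseteq> set_mset c" using im(3,4) sub by blast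
    show "f z \<in># c \<and> count c (f z) = count c z" if "z \<in> \<tau> ` A \<union> \<tau>' ` B" for z
      using that
    proof
      assume "z \<in> \<tau> ` A"
      then obtain x where "x \<in> A" "z = \<tau> x" by auto
      then show ?thesis using fA im(1) sub(1) count_renaming[OF ren(1)] count_renaming[OF ren(3)] by auto
    next
      assume "z \<in> \<tau>' ` B"
      then obtain x where "x \<in> B" "z = \<tau>' x" by auto
      then show ?thesis using fB im(2) sub(2) count_renaming[OF ren(2)] count_renaming[OF ren(4)] by auto
    qed
    have AA: "x = x'" if "x \<in> A" "x' \<in> A" "\<pi> x = \<pi> x'" for x x'
      using inj_onD[OF inj(1) that(3)] that sub by blast
    have BB: "x = x'" if "x \<in> B" "x' \<in> B" "\<pi>' x = \<pi>' x'" for x x'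
      using inj_onD[OF inj(2) that(3)] that sub by blast
    show "inj_on f (\<tau> ` A \<union> \<tau>' ` B)"
    proof (rule inj_onI)
      fix z z' assume z: "z \<in> \<tau> ` A \<union> \<tau>' ` B" and z': "z' \<in> \<tau> ` A \<union> \<tau>' ` B" and f: "f z = f z'"
      from z consider x where "x \<in> A" "z = \<tau> x" | x where "x \<in> B" "z = \<tau>' x" by blast
      then show "z = z'"
      proof cases
        case (1 x)
        from z' consider y where "y \<in> A" "z' = \<tau> y" | y where "y \<in> B" "z' = \<tau>' y" by blast
        then show ?thesis using 1 f fA fB AA eq by cases (metis, metis)
      next
        case (2 x)
        from z' consider y where "y \<in> A" "z' = \<tau> y" | y where "y \<in> B" "z' = \<tau>' y" by blast
        then show ?thesis using 2 f fA fB BB eq by cases (metis, metis)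
      qed
    qed
  qed
  then show ?thesis using fA fB by auto
qed

text \<open>Modulo \<open>\<rho>\<close> every word is a renamed representative \<open>w i\<close> of its orbit. Whether two renamed representatives are
related depends only on the pattern of coincidences between their end letters: renamings with the same pattern are
aligned by one further renaming, up to words with equal ends, and these are identified by \<open>\<rho>\<close>. So an
invariant equivalence is determined by its set of triples of two indices and a pattern.\<close>

lemma card_invariant_equivs_long:
  assumes \<rho>: "fully_invariant \<rho>" and c: "c \<noteq> {#}" and K: "commuting_interior K \<rho>" and size: "2 * K \<le> size c"
    and few: "card (words c // orbit_rel c \<rho>) < k"
  shows "card (invariant_equivs c \<rho>) \<le> 2 ^ (k * (k * 2 ^ (2 * K * (2 * K))))"
proof -
  note D = fully_invariantD[OF \<rho>] and E = equiv_orbit_rel[OF \<rho> c]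
  let ?Q = "words c // orbit_rel c \<rho>"
  have fin: "finite ?Q" using finite_quotient[OF finite_words equiv_type[OF E]] .
  obtain g where g: "bij_betw g {0..<card ?Q} ?Q" using ex_bij_betw_nat_finite[OF fin] by blast
  have "\<exists>w. i < card ?Q \<longrightarrow> w \<in> words c \<and> g i = orbit_rel c \<rho> `` {w}" for i
  proof (cases "i < card ?Q")
    case True
    then have "g i \<in> ?Q" using bij_betwE[OF g] by simp
    then show ?thesis by (auto elim!: quotientE)
  qed simp
  then obtain w where w: "\<And>i. i < card ?Q \<Longrightarrow> w i \<in> words c \<and> g i = orbit_rel c \<rho> `` {w i}" by metis
  have cover: "\<exists>i \<pi>. i < k \<and> w i \<in> words c \<and> renaming c \<pi> \<and> (map \<pi> (w i), u) \<in> \<rho>" if u: "u \<in> words c" for u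
  proof -
    have "orbit_rel c \<rho> `` {u} \<in> g ` {0..<card ?Q}" using g quotientI[OF u] by (auto simp: bij_betw_def)
    then obtain i where i: "i < card ?Q" "orbit_rel c \<rho> `` {w i} = orbit_rel c \<rho> `` {u}" using w by fastforce
    then have "(w i, u) \<in> orbit_rel c \<rho>" using eq_equiv_class[OF i(2) E u] by blast
    moreover have "i < k" using i(1) few by simp
    ultimately show ?thesis unfolding orbit_rel_def by blast
  qed
  define pat where "pat i j \<pi> \<pi>' = {(p, q). p < 2 * K \<and> q < 2 * K \<and>
    map \<pi> (ends K (w i)) ! p = map \<pi>' (ends K (w j)) ! q}" for i j and \<pi> \<pi>' :: "nat \<Rightarrow> nat"
  define code where "code R = {(i, j, pat i j \<pi> \<pi>') | i j \<pi> \<pi>'. i < k \<and> j < k \<and> w i \<in> words c \<and> w j \<in> words c \<and>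
    renaming c \<pi> \<and> renaming c \<pi>' \<and> (map \<pi> (w i), map \<pi>' (w j)) \<in> R}" for R
  let ?T = "{..<k} \<times> {..<k} \<times> Pow ({..<2 * K} \<times> {..<2 * K})"
  have codeT: "code R \<in> Pow ?T" for R by (auto simp: code_def pat_def)
  have sub: "R \<subseteq> S" if R: "R \<in> invariant_equivs c \<rho>" and S: "S \<in> invariant_equivs c \<rho>" and RS: "code R \<subseteq> code S" for R S
  proof clarify
    fix u v assume uv: "(u, v) \<in> R"
    have R': "equiv (words c) R" "\<rho> \<inter> words c \<times> words c \<subseteq> R" using R by (auto simp: invariant_equivs_def)
    have S': "equiv (words c) S" "\<rho> \<inter> words c \<times> words c \<subseteq> S" using S by (auto simp: invariant_equivs_def)
    have Sinv: "(map \<mu> x, map \<mu> y) \<in> S" if "renaming c \<mu>" "(x, y) \<in> S" for \<mu> x y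
      using S that by (auto simp: invariant_equivs_def)
    have W: "u \<in> words c" "v \<in> words c" using R'(1) uv by (auto simp: equiv_def)
    obtain i \<pi> where i: "i < k" "w i \<in> words c" "renaming c \<pi>" "(map \<pi> (w i), u) \<in> \<rho>" using cover[OF W(1)] by blast
    obtain j \<pi>' where j: "j < k" "w j \<in> words c" "renaming c \<pi>'" "(map \<pi>' (w j), v) \<in> \<rho>" using cover[OF W(2)] by blast
    note mW = map_renaming_words[OF i(3,2)] map_renaming_words[OF j(3,2)]
    have "(map \<pi> (w i), u) \<in> R" "(v, map \<pi>' (w j)) \<in> R" using R'(2) i(4) D(3)[OF j(4)] mW W by blast+
    then have "(map \<pi> (w i), map \<pi>' (w j)) \<in> R" using R'(1) uv unfolding equiv_def by (meson transD)
    then have "(i, j, pat i j \<pi> \<pi>') \<in> code S" using RS i j unfolding code_def by blast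
    then obtain \<tau> \<tau>' where \<tau>: "renaming c \<tau>" "renaming c \<tau>'" "(map \<tau> (w i), map \<tau>' (w j)) \<in> S"
      "pat i j \<pi> \<pi>' = pat i j \<tau> \<tau>'" by (auto simp: code_def)
    have len: "length x = size c" if "x \<in> words c" for x using that by (auto simp: words_def)
    let ?e = "ends K (w i)" and ?e' = "ends K (w j)"
    have el: "length ?e = 2 * K" "length ?e' = 2 * K" using len[OF i(2)] len[OF j(2)] size by (simp_all add: length_ends)
    have "\<pi> x = \<pi>' y \<longleftrightarrow> \<tau> x = \<tau>' y" if x: "x \<in> set ?e" and y: "y \<in> set ?e'" for x y
    proof -
      obtain p q where "p < 2 * K" "x = ?e ! p" "q < 2 * K" "y = ?e' ! q"
        using x y el by (metis in_set_conv_nth)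
      moreover from this have "(p, q) \<in> pat i j \<pi> \<pi>' \<longleftrightarrow> (p, q) \<in> pat i j \<tau> \<tau>'" using \<tau>(4) by simp
      ultimately show ?thesis using el by (simp add: pat_def)
    qed
    moreover have "set ?e \<subseteq> set_mset c" "set ?e' \<subseteq> set_mset c"
      using set_ends words_set[OF i(2)] words_set[OF j(2)] by fastforce+
    ultimately obtain \<mu> where \<mu>: "renaming c \<mu>" "\<forall>x \<in> set ?e. \<mu> (\<tau> x) = \<pi> x" "\<forall>y \<in> set ?e'. \<mu> (\<tau>' y) = \<pi>' y"
      using align_renamings[OF i(3) j(3) \<tau>(1,2), of "set ?e" "set ?e'"] by blast
    have aligned: "(map \<mu> (map \<sigma> x), map \<sigma>' x) \<in> S" if "renaming c \<sigma>" "renaming c \<sigma>'" "x \<in> words c" "\<forall>y \<in> set (ends K x). \<mu> (\<sigma> y) = \<sigma>' y" for \<sigma> \<sigma>' x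
    proof -
      have W: "map \<mu> (map \<sigma> x) \<in> words c" "map \<sigma>' x \<in> words c"
        using that map_renaming_words \<mu>(1) by blast+
      have "(map \<mu> (map \<sigma> x), map \<sigma>' x) \<in> \<rho>"
      proof (rule same_ends[OF \<rho> K])
        show "mset (map \<mu> (map \<sigma> x)) = mset (map \<sigma>' x)" using W by (simp add: words_def)
        have "size (mset x) = size c" using that(3) by (simp add: words_def)
        then show "2 * K \<le> length (map \<mu> (map \<sigma> x))" using size by simp
        show "ends K (map \<mu> (map \<sigma> x)) = ends K (map \<sigma>' x)" using that(4) by (simp add: map_ends)
      qed
      then show ?thesis using S'(2) W by blast
    qed
    have "(map \<mu> (map \<tau> (w i)), map \<mu> (map \<tau>' (w j))) \<in> S" by (rule Sinv[OF \<mu>(1) \<tau>(3)])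
    moreover have "(map \<mu> (map \<tau> (w i)), map \<pi> (w i)) \<in> S" "(map \<mu> (map \<tau>' (w j)), map \<pi>' (w j)) \<in> S"
      using aligned[OF \<tau>(1) i(3,2) \<mu>(2)] aligned[OF \<tau>(2) j(3,2) \<mu>(3)] .
    moreover have "(map \<pi> (w i), u) \<in> S" "(map \<pi>' (w j), v) \<in> S" using S'(2) i(4) j(4) mW W by blast+
    ultimately show "(u, v) \<in> S"
      using S'(1) unfolding equiv_def by (meson symD transD)
  qed
  have "inj_on code (invariant_equivs c \<rho>)" using sub by (intro inj_onI) blast
  then have "card (invariant_equivs c \<rho>) = card (code ` invariant_equivs c \<rho>)" by (simp add: card_image)
  also have "\<dots> \<le> card (Pow ?T)" by (rule card_mono) (use codeT in auto)
  also have "\<dots> = 2 ^ (k * (k * 2 ^ (2 * K * (2 * K))))" by (simp add: card_Pow card_cartesian_product)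
  finally show ?thesis .
qed

lemma finite_invariant_equivs: "finite (invariant_equivs c \<rho>)"
  and card_invariant_equivs_le: "card (invariant_equivs c \<rho>) \<le> 2 ^ (card (words c) * card (words c))"
proof -
  have sub: "invariant_equivs c \<rho> \<subseteq> Pow (words c \<times> words c)"
    by (auto simp: invariant_equivs_def equiv_def)
  have fin: "finite (Pow (words c \<times> words c))" using finite_words by simp
  show "finite (invariant_equivs c \<rho>)" using sub fin by (rule finite_subset)
  show "card (invariant_equivs c \<rho>) \<le> 2 ^ (card (words c) * card (words c))"
    using card_mono[OF fin sub] finite_words[of c] by (simp add: card_Pow card_cartesian_product)
qed

lemma card_words_le: "card (words c) \<le> size c ^ size c"
proof -
  have "card (words c) \<le> card {u. set u \<subseteq> set_mset c \<and> length u = size c}"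
    by (rule card_mono[OF finite_lists_length_eq]) (auto simp: words_def)
  also have "\<dots> = card (set_mset c) ^ size c" by (rule card_lists_length_eq) simp
  also have "\<dots> \<le> size c ^ size c"
  proof (rule power_mono)
    have "card (set_mset c) = (\<Sum>x\<in>set_mset c. 1)" by simp
    also have "\<dots> \<le> (\<Sum>x\<in>set_mset c. count c x)" by (rule sum_mono) (simp add: Suc_le_eq)
    finally show "card (set_mset c) \<le> size c" by (simp add: size_multiset_overloaded_eq)
  qed simp
  finally show ?thesis .
qed

lemma card_invariant_equivs_bounded:
  assumes \<rho>: "fully_invariant \<rho>" and K: "commuting_interior K \<rho>"
    and few: "\<And>c. c \<noteq> {#} \<Longrightarrow> card (words c // orbit_rel c \<rho>) < k"
  shows "\<exists>N > 0. \<forall>c. c \<noteq> {#} \<longrightarrow> card (invariant_equivs c \<rho>) \<le> N"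
proof -
  define N1 N2 :: nat where "N1 = 2 ^ (k * (k * 2 ^ (2 * K * (2 * K))))"
    and "N2 = 2 ^ ((2 * K) ^ (2 * K) * (2 * K) ^ (2 * K))"
  have "card (invariant_equivs c \<rho>) \<le> N1 + N2" if c: "c \<noteq> {#}" for c
  proof (cases "2 * K \<le> size c")
    case True
    then show ?thesis using card_invariant_equivs_long[OF \<rho> c K True few[OF c]] by (simp add: N1_def)
  next
    case False
    have "size c ^ size c \<le> (2 * K) ^ size c" using False by (intro power_mono) auto
    also have "\<dots> \<le> (2 * K) ^ (2 * K)" using False by (intro power_increasing) auto
    finally have "card (words c) \<le> (2 * K) ^ (2 * K)" using card_words_le[of c] by linarith
    then have "(2::nat) ^ (card (words c) * card (words c)) \<le> N2"
      unfolding N2_def by (intro power_increasing mult_le_mono) auto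
    then show ?thesis using card_invariant_equivs_le[of c \<rho>] by linarith
  qed
  moreover have "0 < N1 + N2" by (simp add: N1_def)
  ultimately show ?thesis by blast
qed

text \<open>The radius and size identities hold in all lattices \<open>invariant_equivs c\<close> and therefore in \<open>L_OC V\<close>.\<close>

lemma finite_basis_of_bounded_equivs:
  fixes V :: "'a sgrp set"
  assumes inf: "infinite (UNIV :: 'a set)" and V: "overcommutative V" and "0 < N"
    and N: "\<And>c. c \<noteq> {#} \<Longrightarrow> card (invariant_equivs c (theory_of V)) \<le> N"
  shows "has_finite_identity_basis (L_OC V)"
proof -
  interpret R: lattice_preorder "\<lambda>R S :: (nat list \<times> nat list) set. S\<^sup>+ \<subseteq> R\<^sup>+" rmeet rjoin
    by (rule lattice_preorder_relations)
  have closed: "eval rmeet rjoin \<psi> t \<in> invariant_equivs c (theory_of V)"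
    if "\<And>n. \<psi> n \<in> invariant_equivs c (theory_of V)" for c \<psi> t
    by (induction t) (use that invariant_equivs_closed in auto)
  have tr: "R\<^sup>+ = R" if "R \<in> invariant_equivs c (theory_of V)" for c R
    using that by (simp add: invariant_equivs_def equiv_def trancl_id)
  have eqI: "eval rmeet rjoin \<psi> s = eval rmeet rjoin \<psi> t"
    if "\<And>n. \<psi> n \<in> invariant_equivs c (theory_of V)"
      "R.equivalent (eval rmeet rjoin \<psi> s) (eval rmeet rjoin \<psi> t)" for c \<psi> s t
    using that(2) tr[OF closed[OF that(1)]] unfolding R.equivalent_def by auto
  show ?thesis
  proof (rule finite_basis_of_bounded_size[OF \<open>0 < N\<close>])
    fix e assume e: "e \<in> radius_identities (N * N)"
    obtain s t where st: "e = (s, t)" by (cases e)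
    show "lat_satisfies (L_OC V) e"
      unfolding st satisfies_iff_invariant_equivs[OF inf V]
    proof (intro allI impI)
      fix c and \<psi> :: "nat \<Rightarrow> (nat list \<times> nat list) set" assume c: "c \<noteq> {#}" and \<psi>: "\<forall>n. \<psi> n \<in> invariant_equivs c (theory_of V)"
      show "eval rmeet rjoin \<psi> s = eval rmeet rjoin \<psi> t"
      proof (rule eqI)
        show "R.equivalent (eval rmeet rjoin \<psi> s) (eval rmeet rjoin \<psi> t)"
          by (rule R.radius_identities_valid[OF _ _ finite_invariant_equivs N[OF c]])
            (use \<psi> e st invariant_equivs_closed in auto)
      qed (use \<psi> in blast)
    qed
  next
    fix R
    show "lat_satisfies (L_OC V) (size_term N R 0, size_term N R 1)"
      unfolding satisfies_iff_invariant_equivs[OF inf V]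
    proof (intro allI impI)
      fix c and \<psi> :: "nat \<Rightarrow> (nat list \<times> nat list) set" assume c: "c \<noteq> {#}" and \<psi>: "\<forall>n. \<psi> n \<in> invariant_equivs c (theory_of V)"
      show "eval rmeet rjoin \<psi> (size_term N R 0) = eval rmeet rjoin \<psi> (size_term N R 1)"
      proof (rule eqI)
        show "R.equivalent (eval rmeet rjoin \<psi> (size_term N R 0)) (eval rmeet rjoin \<psi> (size_term N R 1))"
          by (rule R.size_term_valid[OF finite_invariant_equivs N[OF c]]) (use \<psi> in auto)
      qed (use \<psi> in blast)
    qed
  qed
qed

theorem corollary1p2:
  fixes V :: "'a sgrp set" and M :: "'b gorder" and e :: "lterm \<times> lterm"
  assumes "infinite (UNIV :: 'a set)"
    and "overcommutative V"
    and "lat_satisfies (L_OC V) e"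
    and "lattice M" and "\<not> lat_satisfies M e"
  shows "has_finite_identity_basis (L_OC V)"
proof -
  let ?\<rho> = "theory_of V"
  have \<rho>: "fully_invariant ?\<rho>" by (rule theory_of_V[OF assms(1,2)])
  obtain s t where e: "e = (s, t)" by (cases e)
  obtain k \<psi> where \<psi>: "\<And>n. finite_partition k (\<psi> n)" and ne: "eval rmeet rjoin \<psi> s \<noteq> eval rmeet rjoin \<psi> t"
    using partition_countermodel_of_lattice[OF assms(4)] assms(5) e by metis
  have sat: "eval rmeet rjoin \<chi> s = eval rmeet rjoin \<chi> t"
    if "c \<noteq> {#}" "\<And>n. \<chi> n \<in> invariant_equivs c ?\<rho>" for c \<chi>
    using assms(3) that unfolding e satisfies_iff_invariant_equivs[OF assms(1,2)] by blast
  have \<psi>': "finite_partition (Suc k) (\<psi> n)" for n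
    using \<psi>[of n] by (auto simp: finite_partition_def)
  have nonempty: "mset [0..<Suc k] \<noteq> {#}" by simp
  obtain u v where uv: "(u, v) \<in> ?\<rho>" "u \<noteq> v" "distinct u" "mset u = mset v"
    using permutation_identity[OF \<rho> sat[OF nonempty] \<psi>' ne] by blast
  obtain K where K: "commuting_interior K ?\<rho>"
    using interior_commutes[OF \<rho> uv] unfolding commuting_interior_def by metis
  have few: "card (words c // orbit_rel c ?\<rho>) < Suc k" if "c \<noteq> {#}" for c
    by (rule few_orbits[OF \<rho> that sat[OF that] \<psi>' ne]) auto
  obtain N where "0 < N" "\<And>c. c \<noteq> {#} \<Longrightarrow> card (invariant_equivs c ?\<rho>) \<le> N"
    using card_invariant_equivs_bounded[OF \<rho> K few] by blast
  then show ?thesis by (rule finite_basis_of_bounded_equivs[OF assms(1,2)])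
qed

end
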